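(* Let $1\le r<s\le\infty$, $m\in\mathbb N$ and let $T$ be a sublinear operator. Assume that $T$ and $\mathcal M^{\#}_{T,s}$ are locally weak $L^r$-bounded (with functions $\varphi_{T,r}$ and $\varphi_{\mathcal M^{\#}_{T,s},r}$, respectively). Then there exist $C_{m,n}>1$ and $\lambda_{m,n}\in(0,1)$, depending only on $m$ and $n$, such that for any $f,g\in L^\infty_c(\mathbb R^n)$ and $b\in L^1_{\rm loc}(\mathbb R^n)$ there is a $\frac1{2\cdot3^n}$-sparse collection of cubes $\mathcal S$ such that $$\int_{\mathbb R^n}|T_b^mf||g|\le C\Big(\sum_{Q\in\mathcal S}\big\langle|b-\langle b\rangle_Q|^m|f|\big\rangle_{r,Q}\langle|g|\rangle_{s',Q}|Q|+\sum_{Q\in\mathcal S}\langle|f|\rangle_{r,Q}\big\langle|b-\langle b\rangle_Q|^m|g|\big\rangle_{s',Q}|Q|\Big),$$ where $$C:=C_{m,n}\big(\varphi_{T,r}(\lambda_{m,n})+\varphi_{\mathcal M^{\#}_{T,s},r}(\lambda_{m,n})\big).$$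
   Context: Cubes in $\mathbb R^n$ have sides parallel to the axes; $\alpha Q$ is the cube with the same center as $Q$ and side length $\alpha\ell(Q)$. $\langle f\rangle_Q:=\frac1{|Q|}\int_Qf$ and $\langle f\rangle_{r,Q}:=\langle f^r\rangle_Q^{1/r}$ for $f\ge0$. $L^\infty_c(\mathbb R^n)$ is the set of bounded functions with compact support; $s'$ is the H\"older conjugate of $s$. A family $\mathcal S$ of cubes is $\eta$-sparse, $\eta\in(0,1)$, if for every $Q\in\mathcal S$ there is $E_Q\subseteq Q$ with $|E_Q|\ge\eta|Q|$ and the sets $\{E_Q\}_{Q\in\mathcal S}$ are pairwise disjoint. Sublinear means $|T(f+g)|\le|Tf|+|Tg|$ and $|T(cf)|=|c||Tf|$; $T$ is assumed to be defined on all functions to which it is applied. For such $T$, $b\in L^1_{\rm loc}(\mathbb R^n)$ and $m\in\mathbb N$, the $m$-th order commutator is defined by $T_b^mf(x):=T\big((b(x)-b(\cdot))^mf\big)(x)$. For $1\le s\le\infty$ the sharp grand maximal truncation operator is $$\mathcal M^{\#}_{T,s}f(x):=\sup_{Q\ni x}\operatorname{osc}_s\big(T(f\chi_{\mathbb R^n\setminus3Q});Q\big),\qquad \operatorname{osc}_s(h;Q):=\Big(\frac1{|Q|^2}\int_{Q\times Q}|h(x')-h(x'')|^s\,dx'\,dx''\Big)^{1/s}$$ (essential supremum if $s=\infty$), the supremum being over all cubes $Q$ containing $x$. An operator $T$ is locally weak $L^r$-bounded ($r\in[1,\infty)$) if there is a non-increasing function $\varphi_{T,r}:(0,1)\to[0,\infty)$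 such that for every cube $Q$ and $f\in L^r(Q)$, $$|\{x\in Q:|T(f\chi_Q)(x)|>\varphi_{T,r}(\lambda)\langle|f|\rangle_{r,Q}\}|\le\lambda|Q|,\qquad\lambda\in(0,1).$$ *)

theory Defs
  imports "HOL-Analysis.Analysis" "HOL-Probability.Essential_Supremum"
begin

definition cube :: "real ^ 'n \<Rightarrow> real \<Rightarrow> (real ^ 'n) set" where
  "cube c l = cbox (c - (\<chi> i. l / 2)) (c + (\<chi> i. l / 2))"

definition is_cube :: "(real ^ 'n) set \<Rightarrow> bool" where
  "is_cube Q \<longleftrightarrow> (\<exists>c l. 0 < l \<and> Q = cube c l)"

definition sparse_cubes :: "real \<Rightarrow> (real ^ 'n) set set \<Rightarrow> bool" where
  "sparse_cubes \<eta> \<S> \<longleftrightarrow> (\<forall>Q\<in>\<S>. is_cube Q) \<and>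
     (\<exists>E. disjoint_family_on E \<S> \<and>
        (\<forall>Q\<in>\<S>. E Q \<in> sets lebesgue \<and> E Q \<subseteq> Q \<and>
           ennreal \<eta> * emeasure lebesgue Q \<le> emeasure lebesgue (E Q)))"

text \<open>The power \<open>a\<^sup>p\<close> in \<open>[0, \<infinity>]\<close>, used only for \<open>p > 0\<close>.\<close>

definition epowr :: "ennreal \<Rightarrow> real \<Rightarrow> ennreal" where
  "epowr a p = (if a = \<infinity> then \<infinity> else ennreal (enn2real a powr p))"

text \<open>Functions take values in a complete normed field \<open>'k\<close>, which is the field of real or of
  complex numbers (Gelfand--Mazur); both cases are covered at once.\<close>

definition mean :: "(real ^ 'n \<Rightarrow> 'k::{real_normed_field, banach, second_countable_topology})
    \<Rightarrow> (real ^ 'n) set \<Rightarrow> 'k" where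
  "mean b Q = (LINT x:Q|lebesgue. b x) /\<^sub>R measure lebesgue Q"

text \<open>\<open>Lp_mean p Q h\<close> is \<open>\<langle>h\<rangle>\<^bsub>p,Q\<^esub>\<close>, for \<open>h \<ge> 0\<close> and \<open>1 \<le> p < \<infinity>\<close>; it may be infinite.\<close>

definition Lp_mean :: "real \<Rightarrow> (real ^ 'n) set \<Rightarrow> (real ^ 'n \<Rightarrow> real) \<Rightarrow> ennreal" where
  "Lp_mean p Q h =
     epowr ((\<integral>\<^sup>+x\<in>Q. ennreal (h x powr p) \<partial>lebesgue) / emeasure lebesgue Q) (1 / p)"

definition conj_exponent :: "ereal \<Rightarrow> real" where
  "conj_exponent s = (if s = \<infinity> then 1 else real_of_ereal s / (real_of_ereal s - 1))"

definition in_Linf_c :: "(real ^ 'n \<Rightarrow> 'k::real_normed_field) \<Rightarrow> bool" where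
  "in_Linf_c f \<longleftrightarrow> f \<in> borel_measurable lebesgue \<and> bounded (range f) \<and> bounded {x. f x \<noteq> 0}"

definition in_L1_loc ::
    "(real ^ 'n \<Rightarrow> 'k::{real_normed_field, banach, second_countable_topology}) \<Rightarrow> bool" where
  "in_L1_loc b \<longleftrightarrow> (\<forall>K. compact K \<longrightarrow> set_integrable lebesgue K b)"

definition in_Lp_on :: "real \<Rightarrow> (real ^ 'n) set \<Rightarrow> (real ^ 'n \<Rightarrow> 'k::real_normed_field) \<Rightarrow> bool" where
  "in_Lp_on p Q f \<longleftrightarrow> f \<in> borel_measurable (lebesgue_on Q) \<and>
     (\<integral>\<^sup>+x\<in>Q. ennreal (norm (f x) powr p) \<partial>lebesgue) < \<infinity>"

text \<open>The functions \<open>f \<chi>\<^sub>Q\<close> with \<open>Q\<close> a cube and \<open>f \<in> L\<^sup>p(Q)\<close>.\<close>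

definition Lp_c :: "real \<Rightarrow> (real ^ 'n \<Rightarrow> 'k::real_normed_field) set" where
  "Lp_c p = {f. in_Lp_on p UNIV f \<and> bounded {x. f x \<noteq> 0}}"

text \<open>An operator is a total map on functions, but it is required to take measurable values and to
  be sublinear only on \<open>L\<^sup>r\<close> functions of compact support, the functions for which local weak
  \<open>L\<^sup>r\<close>-boundedness presupposes that it is defined; elsewhere its values are arbitrary.
  Sublinearity holds at every point (and not just almost everywhere), since the commutator evaluates
  at \<open>x\<close> the image of a function which itself depends on \<open>x\<close>.\<close>

definition sublinear_operator :: "real \<Rightarrow>
    ((real ^ 'n \<Rightarrow> 'k::real_normed_field) \<Rightarrow> real ^ 'n \<Rightarrow> 'k) \<Rightarrow> bool" where
  "sublinear_operator r T \<longleftrightarrow>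
     (\<forall>f\<in>Lp_c r. T f \<in> borel_measurable lebesgue) \<and>
     (\<forall>f\<in>Lp_c r. \<forall>g\<in>Lp_c r. \<forall>x. norm (T (\<lambda>y. f y + g y) x) \<le> norm (T f x) + norm (T g x)) \<and>
     (\<forall>f\<in>Lp_c r. \<forall>c x. norm (T (\<lambda>y. c * f y) x) = norm c * norm (T f x))"

definition commutator :: "((real ^ 'n \<Rightarrow> 'k::real_normed_field) \<Rightarrow> real ^ 'n \<Rightarrow> 'k)
    \<Rightarrow> (real ^ 'n \<Rightarrow> 'k) \<Rightarrow> nat \<Rightarrow> (real ^ 'n \<Rightarrow> 'k) \<Rightarrow> real ^ 'n \<Rightarrow> 'k" where
  "commutator T b m f x = T (\<lambda>y. (b x - b y) ^ m * f y) x"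

definition osc :: "ereal \<Rightarrow> (real ^ 'n \<Rightarrow> 'k::real_normed_field) \<Rightarrow> (real ^ 'n) set \<Rightarrow> ennreal" where
  "osc s h Q =
     (let M = lebesgue_on Q \<Otimes>\<^sub>M lebesgue_on Q in
      if s = \<infinity> then esssup M (\<lambda>(x, y). ennreal (norm (h x - h y)))
      else epowr ((\<integral>\<^sup>+(x, y). ennreal (norm (h x - h y) powr real_of_ereal s) \<partial>M)
                    / (emeasure lebesgue Q)\<^sup>2) (1 / real_of_ereal s))"

definition sharp_grand_maximal :: "((real ^ 'n \<Rightarrow> 'k::real_normed_field) \<Rightarrow> real ^ 'n \<Rightarrow> 'k)
    \<Rightarrow> ereal \<Rightarrow> (real ^ 'n \<Rightarrow> 'k) \<Rightarrow> real ^ 'n \<Rightarrow> ennreal" where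
  "sharp_grand_maximal T s f x =
     (SUP (c, l) \<in> {(c, l). 0 < l \<and> x \<in> cube c l}.
        osc s (T (\<lambda>y. indicator (- cube c (3 * l)) y *\<^sub>R f y)) (cube c l))"

text \<open>\<open>A f\<close> stands for the absolute value of the image of \<open>f\<close>. Measurability of the level sets is
  stated because \<^const>\<open>emeasure\<close> is \<open>0\<close> on non-measurable sets; it is automatic for the sharp grand
  maximal operator, whose level sets are unions of cubes.\<close>

definition locally_weak_bounded :: "real \<Rightarrow> (real \<Rightarrow> real) \<Rightarrow>
    ((real ^ 'n \<Rightarrow> 'k::real_normed_field) \<Rightarrow> real ^ 'n \<Rightarrow> ennreal) \<Rightarrow> bool" where
  "locally_weak_bounded r \<phi> A \<longleftrightarrow>
     antimono_on {0<..<1} \<phi> \<and> (\<forall>t\<in>{0<..<1}. 0 \<le> \<phi> t) \<and>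
     (\<forall>Q f. is_cube Q \<longrightarrow> in_Lp_on r Q f \<longrightarrow> (\<forall>t\<in>{0<..<1}.
        let B = {x\<in>Q. ennreal (\<phi> t) * Lp_mean r Q (\<lambda>y. norm (f y))
                        < A (\<lambda>y. indicator Q y *\<^sub>R f y) x}
        in B \<in> sets lebesgue \<and> emeasure lebesgue B \<le> ennreal t * emeasure lebesgue Q))"

definition sparse_form :: "nat \<Rightarrow> real \<Rightarrow> ereal \<Rightarrow> (real ^ 'n) set set \<Rightarrow>
    (real ^ 'n \<Rightarrow> 'k::{real_normed_field, banach, second_countable_topology}) \<Rightarrow>
    (real ^ 'n \<Rightarrow> 'k) \<Rightarrow> (real ^ 'n \<Rightarrow> 'k) \<Rightarrow> ennreal" where
  "sparse_form m r s \<S> b f g =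
     (\<Sum>\<^sub>\<infinity>Q\<in>\<S>. Lp_mean r Q (\<lambda>x. norm (b x - mean b Q) ^ m * norm (f x))
               * Lp_mean (conj_exponent s) Q (\<lambda>x. norm (g x)) * emeasure lebesgue Q) +
     (\<Sum>\<^sub>\<infinity>Q\<in>\<S>. Lp_mean r Q (\<lambda>x. norm (f x))
               * Lp_mean (conj_exponent s) Q (\<lambda>x. norm (b x - mean b Q) ^ m * norm (g x))
               * emeasure lebesgue Q)"

text \<open>\<open>a \<le> C A\<close> in \<open>[0, \<infinity>]\<close> for a real constant \<open>C \<ge> 0\<close>, where a bound by an infinite \<open>A\<close> is
  void. For \<open>C > 0\<close> this is just \<open>a \<le> ennreal C * A\<close>; the case distinction matters only for
  \<open>C = 0\<close>, where the library has \<open>0 * \<infinity> = 0\<close>.\<close>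

definition bounded_by :: "ennreal \<Rightarrow> real \<Rightarrow> ennreal \<Rightarrow> bool" where
  "bounded_by a C A \<longleftrightarrow> A = \<infinity> \<or> a \<le> ennreal C * A"

end

theory Submission
  imports Defs
begin

text \<open>
  The commutator is localised to the dilates \<open>3Q\<close> of the cubes of one dyadic grid. For a fixed \<open>Q\<close>,
  expanding \<open>(b(x) - b)\<^sup>m\<close> around the mean of \<open>b\<close> over \<open>3Q\<close> reduces matters to \<open>T\<close> applied to the finitely
  many functions \<open>F\<^sub>k = (b - \<langle>b\<rangle>)\<^sup>k f \<chi>\<close>. Outside a small set, \<open>T F\<^sub>k\<close>, the sharp grand maximal function
  and a dyadic maximal function of \<open>F\<^sub>k\<close> are all controlled by the mean of \<open>F\<^sub>k\<close> over \<open>3Q\<close>. Covering this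
  set by an open one (so that no density theorem is needed) and applying a Calderon--Zygmund stopping
  time gives disjoint subcubes \<open>P\<close> of total measure at most half of that of \<open>Q\<close>. On \<open>P\<close> the function
  \<open>T(F\<^sub>k \<chi>)\<close>, with \<open>\<chi>\<close> cutting off \<open>3P\<close>, differs from its values at good points of \<open>P\<close> by an oscillation,
  which pairs with \<open>g\<close> by duality. What is left is the commutator localised to \<open>3P\<close>, and one iterates.
  Almost every point lies in finitely many of the selected cubes, so the iteration is a finite chain of
  pointwise inequalities, and no measurability of the commutator itself is required. The mixed means
  with exponents \<open>k\<close> and \<open>m - k\<close> are finally interpolated between the two extreme ones.
\<close>

section \<open>Means and oscillations\<close>

text \<open>The obstacle is the number b(x) inside the argument of T. Writing b(x) - b = (b(x) - c)
  + (c - b) with c fixed on the cube turns it into a coefficient |b(x) - c|^(m-k) in front of T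
  applied to a function that no longer depends on x. This coefficient depends on x only and can be
  moved onto g; this is how weighted means of g arise. One stopping family has to serve all k <= m,
  hence the factor m + 1 in both \<open>lam\<close> and \<Lambda>. The means that occur are taken
  over 3P, which is not a dyadic cube; they are compared with the averages over finitely many cells
  of the size of P. The cubes 3Q themselves form the sparse family: half of Q is 1/(2 * 3^n) of 3Q.
  One grid suffices because a single cell of it contains the supports of f and g. The hypotheses
  only speak about T on \<open>Lp_c r\<close>, so b^m f has to lie there. If it does not, a single
  cube already makes the sparse form infinite, unless g vanishes almost everywhere.\<close>

lemma epowr_ennreal: "0 \<le> x \<Longrightarrow> epowr (ennreal x) p = ennreal (x powr p)"
  by (simp add: epowr_def)

lemma epowr_top: "epowr top p = top"
  by (simp add: epowr_def)

lemma epowr_mono: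
  assumes "a \<le> b" "0 \<le> p"
  shows "epowr a p \<le> epowr b p"
proof (cases "b = top")
  case True
  then show ?thesis by (simp add: epowr_top)
next
  case False
  then have "a \<noteq> top" using assms(1) by (auto simp: top_unique)
  then show ?thesis
    using assms False by (cases a; cases b) (auto simp: epowr_ennreal ennreal_le_iff intro!: powr_mono2)
qed

lemma epowr_mult:
  assumes "0 < c" "0 \<le> p"
  shows "epowr (ennreal c * a) p = ennreal (c powr p) * epowr a p"
proof (cases a)
  case (real x)
  then show ?thesis using assms by (simp add: epowr_ennreal powr_mult flip: ennreal_mult)
next
  case top
  then show ?thesis using assms by (simp add: epowr_top ennreal_mult_top)
qed

lemma epowr_eq_0_iff: "epowr a p = 0 \<longleftrightarrow> a = 0"
  by (cases a) (auto simp: epowr_ennreal epowr_top ennreal_eq_0_iff)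

text \<open>Division by the sum brings both terms into [0, 1], where y <= y^p because p <=
  1.\<close>

lemma powr_add_le:
  fixes a b p :: real
  assumes "0 \<le> a" "0 \<le> b" "0 < p" "p \<le> 1"
  shows "(a + b) powr p \<le> a powr p + b powr p"
proof (cases "a + b = 0")
  case True
  then show ?thesis by simp
next
  case False
  define s where "s = a + b"
  have s: "s > 0" using False assms by (simp add: s_def)
  have *: "x / s \<le> (x / s) powr p" if "0 \<le> x" "x \<le> s" for x
  proof (cases "x = 0")
    case False
    then show ?thesis using that s assms powr_mono'[of p 1 "x / s"] by simp
  qed simp
  have "1 = a / s + b / s" using s by (simp add: s_def flip: add_divide_distrib)
  also have "\<dots> \<le> (a / s) powr p + (b / s) powr p"
    using assms by (intro add_mono *) (auto simp: s_def)
  also have "\<dots> = (a powr p + b powr p) / s powr p"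
    using assms s by (simp add: powr_divide add_divide_distrib)
  finally show ?thesis using s by (simp add: s_def field_simps)
qed

lemma epowr_add_le:
  assumes "0 < p" "p \<le> 1"
  shows "epowr (a + b) p \<le> epowr a p + epowr b p"
proof (cases "a = top \<or> b = top")
  case True
  then show ?thesis by (auto simp: epowr_top)
next
  case False
  then show ?thesis
    by (cases a; cases b) (use assms in \<open>auto simp: epowr_ennreal powr_add_le simp flip: ennreal_plus intro!: ennreal_leI\<close>)
qed

lemma epowr_inverse:
  assumes "epowr a (1 / p) = ennreal t" "0 \<le> t" "0 < p"
  shows "a = ennreal (t powr p)"
proof (cases a)
  case (real x)
  then have "t = x powr (1 / p)" using assms by (simp add: epowr_ennreal)
  then show ?thesis using real assms by (simp add: powr_powr)
next
  case top
  then show ?thesis using assms by (simp add: epowr_top)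
qed

text \<open>Young's inequality, normalised by the means of \<open>u\<^sup>p\<close> and \<open>v\<^sup>q\<close>; the
  superfluous factor 2 is harmless and avoids a discussion of the constants.\<close>

lemma nn_integral_Holder:
  fixes u v :: "'a \<Rightarrow> real"
  assumes pq: "1 < p" "1 / p + 1 / q = 1"
    and [measurable]: "u \<in> borel_measurable M" "v \<in> borel_measurable M"
    and u: "\<And>x. 0 \<le> u x" and v: "\<And>x. 0 \<le> v x" and c: "0 < c" "c < top"
  shows "(\<integral>\<^sup>+x. ennreal (u x * v x) \<partial>M) / c
    \<le> 2 * epowr ((\<integral>\<^sup>+x. ennreal (u x powr p) \<partial>M) / c) (1 / p)
        * epowr ((\<integral>\<^sup>+x. ennreal (v x powr q) \<partial>M) / c) (1 / q)"
    (is "_ \<le> 2 * epowr ?U _ * epowr ?V _")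
proof -
  have "1 / q = 1 - 1 / p" "1 / p < 1" "0 < 1 / p" using pq by auto
  then have "0 < 1 / q" "1 / q < 1" by linarith+
  then have q: "1 < q" by (metis less_divide_eq_1_pos zero_less_divide_1_iff divide_less_eq_1_pos)
  have cfin: "c \<noteq> 0" "c \<noteq> top" using c by auto
  consider "?U = 0 \<or> ?V = 0" | "?U \<noteq> 0" "?V \<noteq> 0" "?U = top \<or> ?V = top"
    | "?U \<noteq> 0" "?V \<noteq> 0" "?U \<noteq> top" "?V \<noteq> top" by blast
  then show ?thesis
  proof cases
    case 1
    then have "(AE x in M. u x = 0) \<or> (AE x in M. v x = 0)"
      using cfin u v
      by (auto simp: nn_integral_0_iff_AE ennreal_eq_0_iff not_less
          elim: eventually_mono)
    then have "AE x in M. ennreal (u x * v x) = 0"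
      by (auto elim: eventually_mono)
    then have "(\<integral>\<^sup>+x. ennreal (u x * v x) \<partial>M) = 0"
      by (subst nn_integral_0_iff_AE) auto
    then show ?thesis by simp
  next
    case 2
    \<comment> \<open>Both means are nonzero here, so the product is infinite; a zero factor would
      have made it 0 by the convention 0 * top = 0.\<close>
    then have "epowr ?U (1/p) * epowr ?V (1/q) = top"
      by (auto simp: ennreal_mult_eq_top_iff epowr_eq_0_iff epowr_top)
    then show ?thesis by (simp add: mult.assoc ennreal_mult_top)
  next
    case 3
    define U V where "U = enn2real ?U" and "V = enn2real ?V"
    have U: "?U = ennreal U" "0 < U" and V: "?V = ennreal V" "0 < V"
      using 3 by (simp_all add: U_def V_def enn2real_positive_iff less_top zero_less_iff_neq_zero)
    \<comment> \<open>Normalised norms of u and v. Since X^p = U and Y^q = V, each of the two Young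
      terms below contributes exactly X * Y after integration and division by c.\<close>
    define X Y where "X = U powr (1/p)" and "Y = V powr (1/q)"
    have XY: "0 < X" "0 < Y" "X powr p = U" "Y powr q = V"
      using U V pq q by (auto simp: X_def Y_def powr_powr)
    have young: "u x * v x \<le> X * Y / U * u x powr p + X * Y / V * v x powr q" for x
    proof -
      have "(u x / X) * (v x / Y) \<le> (u x / X) powr p / p + (v x / Y) powr q / q"
        using Youngs_inequality[of p q "u x / X" "v x / Y"] pq q u v XY by simp
      also have "\<dots> \<le> (u x / X) powr p + (v x / Y) powr q"
        using pq q by (intro add_mono divide_left_mono[of 1 _ "_ powr _", simplified]) auto
      also have "\<dots> = u x powr p / U + v x powr q / V"
        using XY u v by (simp add: powr_divide)
      finally have "X * Y * ((u x / X) * (v x / Y)) \<le> X * Y * (u x powr p / U + v x powr q / V)"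
        using XY by (intro mult_left_mono) auto
      then show ?thesis
        using XY by (simp add: distrib_left)
    qed
    have young': "ennreal (u x * v x)
      \<le> ennreal (X * Y / U) * ennreal (u x powr p) + ennreal (X * Y / V) * ennreal (v x powr q)" for x
    proof -
      have "ennreal (u x * v x) \<le> ennreal (X * Y / U * u x powr p + X * Y / V * v x powr q)"
        by (rule ennreal_leI[OF young])
      also have "\<dots> = ennreal (X * Y / U * u x powr p) + ennreal (X * Y / V * v x powr q)"
        using XY(1,2) U(2) V(2) by (intro ennreal_plus) auto
      also have "ennreal (X * Y / U * u x powr p) = ennreal (X * Y / U) * ennreal (u x powr p)"
        using XY(1,2) U(2) by (intro ennreal_mult) auto
      also have "ennreal (X * Y / V * v x powr q) = ennreal (X * Y / V) * ennreal (v x powr q)"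
        using XY(1,2) V(2) by (intro ennreal_mult) auto
      finally show ?thesis .
    qed
    have "(\<integral>\<^sup>+x. ennreal (u x * v x) \<partial>M)
        \<le> (\<integral>\<^sup>+x. ennreal (X * Y / U) * ennreal (u x powr p) + ennreal (X * Y / V) * ennreal (v x powr q) \<partial>M)"
      by (intro nn_integral_mono young')
    also have "\<dots> = ennreal (X * Y / U) * (\<integral>\<^sup>+x. ennreal (u x powr p) \<partial>M)
                 + ennreal (X * Y / V) * (\<integral>\<^sup>+x. ennreal (v x powr q) \<partial>M)"
      by (simp add: nn_integral_add nn_integral_cmult)
    finally have "(\<integral>\<^sup>+x. ennreal (u x * v x) \<partial>M) / c
        \<le> (ennreal (X * Y / U) * (\<integral>\<^sup>+x. ennreal (u x powr p) \<partial>M)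
                 + ennreal (X * Y / V) * (\<integral>\<^sup>+x. ennreal (v x powr q) \<partial>M)) / c"
      by (rule divide_right_mono_ennreal)
    also have "\<dots> = ennreal (X * Y / U) * ?U + ennreal (X * Y / V) * ?V"
      by (simp add: add_divide_distrib_ennreal ennreal_times_divide)
    also have "\<dots> = ennreal (2 * X * Y)"
      using U V XY by (simp flip: ennreal_mult ennreal_plus)
    also have "\<dots> = 2 * epowr ?U (1 / p) * epowr ?V (1 / q)"
      using U V XY by (simp add: epowr_ennreal X_def Y_def ennreal_mult)
    finally show ?thesis .
  qed
qed

text \<open>If a > t then a = a^(1-p) a^p <= t^(1-p) a^p, the exponent 1 - p being nonpositive. This
  linearises Jensen's inequality: with t a mean of exponent p, the right-hand side is additive in
  the p-th powers and its two terms contribute equally, at the price of a factor 2.\<close>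

lemma le_add_powr:
  fixes a t p :: real
  assumes "0 \<le> a" "0 < t" "1 \<le> p"
  shows "a \<le> t + t powr (1 - p) * a powr p"
proof (cases "a \<le> t")
  case True
  then show ?thesis using assms by (simp add: add_increasing2)
next
  case False
  then have "a > t" "a > 0" using assms by auto
  then have "a = a powr (1 - p) * a powr p" by (simp flip: powr_add)
  also have "\<dots> \<le> t powr (1 - p) * a powr p"
    using \<open>a > t\<close> assms by (intro mult_right_mono powr_mono2') auto
  finally show ?thesis using assms by linarith
qed


section \<open>Means over a set and over its disjoint subsets\<close>

lemma Lp_mean_cong:
  "(\<And>x. x \<in> Q \<Longrightarrow> h x = h' x) \<Longrightarrow> Lp_mean p Q h = Lp_mean p Q h'"
  unfolding Lp_mean_def
  by (intro arg_cong2[where f=epowr] arg_cong2[where f="(/)"] nn_integral_cong) (auto simp: indicator_def)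

lemma Lp_mean_mono:
  assumes "\<And>x. x \<in> Q \<Longrightarrow> 0 \<le> h x" "\<And>x. x \<in> Q \<Longrightarrow> h x \<le> h' x" "0 < p"
  shows "Lp_mean p Q h \<le> Lp_mean p Q h'"
  unfolding Lp_mean_def using assms
  by (intro epowr_mono divide_right_mono_ennreal nn_integral_mono)
     (auto simp: indicator_def intro!: ennreal_leI powr_mono2)

lemma ennreal_divide_mult_cancel: "c \<noteq> 0 \<Longrightarrow> c \<noteq> top \<Longrightarrow> a / c * c = (a::ennreal)"
  by (simp add: ennreal_divide_times less_top)

text \<open>Means of exponent p are not additive in the set, but integrals of p-th powers are; this
  passes from one to the other when the mean is finite.\<close>

lemma Lp_mean_eq_ennreal_iff:
  assumes "0 < emeasure lebesgue Q" "emeasure lebesgue Q < top" "0 \<le> t" "0 < p"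
  shows "Lp_mean p Q h = ennreal t \<longleftrightarrow>
    (\<integral>\<^sup>+x\<in>Q. ennreal (h x powr p) \<partial>lebesgue) = ennreal (t powr p) * emeasure lebesgue Q"
    (is "_ \<longleftrightarrow> ?I = _ * ?m")
proof -
  have m: "?m \<noteq> 0" "?m \<noteq> top" using assms by auto
  have "Lp_mean p Q h = ennreal t \<longleftrightarrow> ?I / ?m = ennreal (t powr p)"
  proof
    assume "Lp_mean p Q h = ennreal t"
    then show "?I / ?m = ennreal (t powr p)"
      using assms by (intro epowr_inverse) (auto simp: Lp_mean_def)
  next
    assume "?I / ?m = ennreal (t powr p)"
    then show "Lp_mean p Q h = ennreal t"
      using assms by (simp add: Lp_mean_def epowr_ennreal powr_powr)
  qed
  also have "\<dots> \<longleftrightarrow> ?I = ennreal (t powr p) * ?m"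
    using ennreal_divide_mult_cancel[OF m, of ?I] mult_divide_eq_ennreal[OF m, of "ennreal (t powr p)"]
    by auto
  finally show ?thesis .
qed

lemma Lp_mean_finite_iff:
  assumes "0 < emeasure lebesgue Q" "emeasure lebesgue Q < top"
  shows "Lp_mean p Q h < top \<longleftrightarrow> (\<integral>\<^sup>+x\<in>Q. ennreal (h x powr p) \<partial>lebesgue) < top"
proof -
  have "epowr a q < top \<longleftrightarrow> a < top" for a q
    by (cases a) (auto simp: epowr_ennreal epowr_top)
  then show ?thesis
    using assms by (auto simp: Lp_mean_def ennreal_divide_eq_top_iff less_top[symmetric])
qed

lemma emeasure_disjoint_sum_le:
  assumes "countable I" "disjoint_family_on P I" "\<And>i. i \<in> I \<Longrightarrow> P i \<in> sets M"
    "\<And>i. i \<in> I \<Longrightarrow> P i \<subseteq> R" "R \<in> sets M"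
  shows "(\<integral>\<^sup>+i. emeasure M (P i) \<partial>count_space I) \<le> emeasure M R"
  using assms by (subst emeasure_UN_countable[symmetric]) (auto intro!: emeasure_mono)

text \<open>\<open>le_add_powr\<close> is applied to the mean over each \<open>P i\<close>, with t
  the mean over R. The terms t |P i| add up to at most t |R|, and t^(1-p) times the integrals of G^p
  add up to at most t^(1-p) t^p |R|, which is the same number; hence the factor 2.\<close>

lemma sum_Lp_mean_le:
  fixes R :: "(real ^ 'n) set" and G :: "real ^ 'n \<Rightarrow> real"
  assumes R: "R \<in> sets lebesgue" "0 < emeasure lebesgue R" "emeasure lebesgue R < top" and p: "1 \<le> p"
    and G[measurable]: "G \<in> borel_measurable lebesgue"
    and I: "countable I" "disjoint_family_on P I" "\<And>i. i \<in> I \<Longrightarrow> P i \<in> sets lebesgue"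
      "\<And>i. i \<in> I \<Longrightarrow> P i \<subseteq> R" "\<And>i. i \<in> I \<Longrightarrow> 0 < emeasure lebesgue (P i)"
  shows "(\<integral>\<^sup>+i. Lp_mean p (P i) G * emeasure lebesgue (P i) \<partial>count_space I)
    \<le> 2 * Lp_mean p R G * emeasure lebesgue R"
proof -
  have fin: "emeasure lebesgue (P i) < top" if "i \<in> I" for i
    using R I(4)[OF that] by (meson emeasure_mono le_less_trans)
  define N where "N = density lebesgue (\<lambda>x. ennreal (G x powr p))"
  have N: "emeasure N A = (\<integral>\<^sup>+x\<in>A. ennreal (G x powr p) \<partial>lebesgue)" if "A \<in> sets lebesgue" for A
    unfolding N_def using that by (subst emeasure_density) auto
  have [simp]: "sets N = sets lebesgue" by (simp add: N_def)
  have NP: "emeasure N (P i) \<le> emeasure N R" if "i \<in> I" for i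
    using I(4)[OF that] R by (intro emeasure_mono) auto
  consider "Lp_mean p R G = top" | "Lp_mean p R G = 0"
    | t where "Lp_mean p R G = ennreal t" "0 < t"
    by (cases "Lp_mean p R G") (auto simp: less_le)
  then show ?thesis
  proof cases
    case 1
    then show ?thesis using R by (simp add: ennreal_mult_top ennreal_top_mult)
  next
    case 2
    \<comment> \<open>A vanishing mean cannot serve as the parameter t, which has to be positive;
      here no subset of R carries any mass of G^p.\<close>
    then have "emeasure N R = 0"
      using Lp_mean_eq_ennreal_iff[of R 0 p G] R p by (simp add: N)
    then have "emeasure N (P i) = 0" if "i \<in> I" for i using NP[OF that] by simp
    then have "Lp_mean p (P i) G = 0" if "i \<in> I" for i
      using Lp_mean_eq_ennreal_iff[of "P i" 0 p G] I(3,5)[OF that] fin[OF that] p N[OF I(3)[OF that]] that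
      by simp
    then have "(\<integral>\<^sup>+i. Lp_mean p (P i) G * emeasure lebesgue (P i) \<partial>count_space I)
        = (\<integral>\<^sup>+i. 0 \<partial>count_space I)"
      by (intro nn_integral_cong) auto
    then show ?thesis by simp
  next
    case 3
    have NR: "emeasure N R = ennreal (t powr p) * emeasure lebesgue R"
      using Lp_mean_eq_ennreal_iff[of R t p G] R p 3 by (simp add: N)
    have *: "Lp_mean p (P i) G * emeasure lebesgue (P i)
        \<le> ennreal t * emeasure lebesgue (P i) + ennreal (t powr (1 - p)) * emeasure N (P i)"
      if i: "i \<in> I" for i
    proof -
      have "emeasure N (P i) < top"
        using NP[OF i] R(3) unfolding NR
        by (elim le_less_trans) (simp only: ennreal_mult_less_top ennreal_less_top simp_thms)
      then have "Lp_mean p (P i) G < top"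
        using Lp_mean_finite_iff[of "P i" p G] I(3,5)[OF i] fin[OF i] by (simp add: N)
      then obtain a where a: "Lp_mean p (P i) G = ennreal a" "0 \<le> a"
        by (cases "Lp_mean p (P i) G") auto
      then have NPi: "emeasure N (P i) = ennreal (a powr p) * emeasure lebesgue (P i)"
        using Lp_mean_eq_ennreal_iff[of "P i" a p G] I(3,5)[OF i] fin[OF i] p by (simp add: N)
      have "ennreal a \<le> ennreal t + ennreal (t powr (1 - p)) * ennreal (a powr p)"
        using le_add_powr[of a t p] a 3 p by (simp flip: ennreal_mult ennreal_plus)
      then have "ennreal a * emeasure lebesgue (P i)
          \<le> (ennreal t + ennreal (t powr (1 - p)) * ennreal (a powr p)) * emeasure lebesgue (P i)"
        by (rule mult_right_mono) simp
      then show ?thesis by (simp add: a NPi algebra_simps)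
    qed
    have "(\<integral>\<^sup>+i. Lp_mean p (P i) G * emeasure lebesgue (P i) \<partial>count_space I)
      \<le> (\<integral>\<^sup>+i. ennreal t * emeasure lebesgue (P i) + ennreal (t powr (1 - p)) * emeasure N (P i) \<partial>count_space I)"
      by (intro nn_integral_mono *) simp
    also have "\<dots> = ennreal t * (\<integral>\<^sup>+i. emeasure lebesgue (P i) \<partial>count_space I)
      + ennreal (t powr (1 - p)) * (\<integral>\<^sup>+i. emeasure N (P i) \<partial>count_space I)"
      by (simp add: nn_integral_add nn_integral_cmult)
    also have "\<dots> \<le> ennreal t * emeasure lebesgue R + ennreal (t powr (1 - p)) * emeasure N R"
      using I R by (intro add_mono mult_left_mono emeasure_disjoint_sum_le) auto
    also have "ennreal (t powr (1 - p)) * emeasure N R = ennreal t * emeasure lebesgue R"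
      using 3 by (simp add: NR flip: mult.assoc ennreal_mult powr_add)
    also have "ennreal t * emeasure lebesgue R + ennreal t * emeasure lebesgue R
        = 2 * Lp_mean p R G * emeasure lebesgue R"
      using 3 by (simp add: mult_2 distrib_right)
    finally show ?thesis .
  qed
qed

text \<open>The same linearisation, now pointwise in x; it stands in for Jensen's inequality between
  the exponents 1 and p.\<close>

lemma set_nn_integral_le_Lp_mean:
  fixes R :: "(real ^ 'n) set" and G :: "real ^ 'n \<Rightarrow> real"
  assumes R: "R \<in> sets lebesgue" "0 < emeasure lebesgue R" "emeasure lebesgue R < top" and p: "1 \<le> p"
    and G[measurable]: "G \<in> borel_measurable lebesgue" and G0: "\<And>x. 0 \<le> G x"
  shows "(\<integral>\<^sup>+x\<in>R. ennreal (G x) \<partial>lebesgue) \<le> 2 * Lp_mean p R G * emeasure lebesgue R"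
proof -
  have [measurable]: "R \<in> sets lebesgue" by fact
  consider "Lp_mean p R G = top" | "Lp_mean p R G = 0"
    | t where "Lp_mean p R G = ennreal t" "0 < t"
    by (cases "Lp_mean p R G") (auto simp: less_le)
  then show ?thesis
  proof cases
    case 1
    then show ?thesis using R by (simp add: ennreal_mult_top ennreal_top_mult)
  next
    case 2
    then have "(\<integral>\<^sup>+x\<in>R. ennreal (G x powr p) \<partial>lebesgue) = 0"
      using Lp_mean_eq_ennreal_iff[of R 0 p G] R p by simp
    then have "AE x in lebesgue. ennreal (G x powr p) * indicator R x = 0"
      by (subst (asm) nn_integral_0_iff_AE) auto
    then have "AE x in lebesgue. ennreal (G x) * indicator R x = 0"
      by (rule eventually_mono) (auto simp: indicator_def ennreal_eq_0_iff split: if_splits)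
    then have "(\<integral>\<^sup>+x\<in>R. ennreal (G x) \<partial>lebesgue) = 0"
      by (subst nn_integral_0_iff_AE) auto
    then show ?thesis by simp
  next
    case 3
    have NR: "(\<integral>\<^sup>+x\<in>R. ennreal (G x powr p) \<partial>lebesgue) = ennreal (t powr p) * emeasure lebesgue R"
      using Lp_mean_eq_ennreal_iff[of R t p G] R p 3 by simp
    have "(\<integral>\<^sup>+x\<in>R. ennreal (G x) \<partial>lebesgue)
      \<le> (\<integral>\<^sup>+x. ennreal t * indicator R x + ennreal (t powr (1 - p)) * (ennreal (G x powr p) * indicator R x) \<partial>lebesgue)"
      using 3 p G0 le_add_powr[of "G _" t p]
      by (intro nn_integral_mono) (auto simp: indicator_def simp flip: ennreal_mult ennreal_plus)
    also have "\<dots> = ennreal t * emeasure lebesgue R + ennreal (t powr (1 - p)) * (ennreal (t powr p) * emeasure lebesgue R)"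
      unfolding NR[symmetric] by (subst nn_integral_add) (auto simp: nn_integral_cmult)
    also have "ennreal (t powr (1 - p)) * (ennreal (t powr p) * emeasure lebesgue R) = ennreal t * emeasure lebesgue R"
      using 3 by (simp flip: mult.assoc ennreal_mult powr_add)
    also have "ennreal t * emeasure lebesgue R + ennreal t * emeasure lebesgue R
        = 2 * Lp_mean p R G * emeasure lebesgue R"
      using 3 by (simp add: mult_2 distrib_right)
    finally show ?thesis .
  qed
qed

section \<open>Pairing an oscillation with a function\<close>

lemma conj_exponent_ge_1: "1 < s \<Longrightarrow> 1 \<le> conj_exponent s"
proof (cases s)
  case (real x)
  assume "1 < s"
  then have "1 < x" using real by (simp add: one_ereal_def)
  then show ?thesis by (simp add: real conj_exponent_def le_divide_eq)
qed (auto simp: conj_exponent_def)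

text \<open>Hoelder's inequality on Q x Q with exponents s and s', for the functions h(x) - h(y) and
  G(x). The latter is constant in y, so its mean over Q x Q is its mean over Q. For s = \<infinity>,
  where s' = 1, the essential supremum is pulled out instead.\<close>

lemma osc_duality:
  fixes h :: "real ^ 'n \<Rightarrow> 'k::{real_normed_field, second_countable_topology}"
  assumes Q: "Q \<in> sets lebesgue" "0 < emeasure lebesgue Q" "emeasure lebesgue Q < top"
    and s: "1 < s"
    and h: "h \<in> borel_measurable lebesgue"
    and G: "G \<in> borel_measurable lebesgue" and G0: "\<And>x. 0 \<le> G x"
  shows "(\<integral>\<^sup>+y\<in>Q. (\<integral>\<^sup>+x\<in>Q. ennreal (norm (h x - h y) * G x) \<partial>lebesgue) \<partial>lebesgue)
    \<le> 2 * osc s h Q * Lp_mean (conj_exponent s) Q G * (emeasure lebesgue Q)\<^sup>2"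
proof -
  define L where "L = lebesgue_on Q"
  let ?q = "conj_exponent s" and ?m = "emeasure lebesgue Q"
  have mL: "emeasure L (space L) = ?m" using Q by (simp add: L_def emeasure_restrict_space)
  interpret L: finite_measure L
    using Q by (intro finite_measureI) (simp add: mL)
  interpret LL: pair_sigma_finite L L ..
  have [measurable]: "h \<in> borel_measurable L" "G \<in> borel_measurable L"
    using h G by (simp_all add: L_def measurable_restrict_space1)
  have int_L: "(\<integral>\<^sup>+x. F x \<partial>L) = (\<integral>\<^sup>+x\<in>Q. F x \<partial>lebesgue)" for F
    unfolding L_def using Q by (simp add: nn_integral_restrict_space)
  have m: "?m \<noteq> 0" "?m \<noteq> top" using Q by auto
  have m2: "0 < ?m\<^sup>2" "?m\<^sup>2 < top" using Q
    by (auto simp: power2_eq_square ennreal_mult_less_top ennreal_zero_less_mult_iff)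
  have "(\<integral>\<^sup>+y\<in>Q. (\<integral>\<^sup>+x\<in>Q. ennreal (norm (h x - h y) * G x) \<partial>lebesgue) \<partial>lebesgue)
      = (\<integral>\<^sup>+y. (\<integral>\<^sup>+x. ennreal (norm (h x - h y) * G x) \<partial>L) \<partial>L)"
    by (simp add: int_L)
  also have "\<dots> = (\<integral>\<^sup>+z. ennreal (norm (h (fst z) - h (snd z)) * G (fst z)) \<partial>(L \<Otimes>\<^sub>M L))"
    by (subst LL.nn_integral_snd[symmetric]) (auto simp: split_beta')
  also have "\<dots> \<le> 2 * osc s h Q * Lp_mean ?q Q G * ?m\<^sup>2"
  proof (cases "s = \<infinity>")
    case True
    have osc: "osc s h Q = esssup (L \<Otimes>\<^sub>M L) (\<lambda>z. ennreal (norm (h (fst z) - h (snd z))))"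
      by (simp add: True osc_def L_def Let_def split_beta')
    have "AE z in L \<Otimes>\<^sub>M L. ennreal (norm (h (fst z) - h (snd z))) \<le> osc s h Q"
      unfolding osc by (rule esssup_AE)
    then have "(\<integral>\<^sup>+z. ennreal (norm (h (fst z) - h (snd z)) * G (fst z)) \<partial>(L \<Otimes>\<^sub>M L))
       \<le> (\<integral>\<^sup>+z. osc s h Q * ennreal (G (fst z)) \<partial>(L \<Otimes>\<^sub>M L))"
      by (intro nn_integral_mono_AE) (auto elim!: eventually_mono simp: ennreal_mult G0 intro!: mult_right_mono)
    also have "\<dots> = osc s h Q * (\<integral>\<^sup>+z. ennreal (G (fst z)) \<partial>(L \<Otimes>\<^sub>M L))"
      by (rule nn_integral_cmult) auto
    also have "(\<integral>\<^sup>+z. ennreal (G (fst z)) \<partial>(L \<Otimes>\<^sub>M L)) = (\<integral>\<^sup>+x. ennreal (G x) \<partial>L) * ?m"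
      by (subst L.nn_integral_fst[symmetric]) (auto simp: mL nn_integral_multc)
    also have "(\<integral>\<^sup>+x. ennreal (G x) \<partial>L) = Lp_mean ?q Q G * ?m"
    proof -
      have "epowr a 1 = a" for a by (cases a) (auto simp: epowr_top epowr_ennreal)
      then have "Lp_mean ?q Q G = (\<integral>\<^sup>+x. ennreal (G x) \<partial>L) / ?m"
        by (simp add: Lp_mean_def conj_exponent_def True G0 int_L)
      then show ?thesis
        using ennreal_divide_mult_cancel[OF m, of "\<integral>\<^sup>+x. ennreal (G x) \<partial>L"] by (simp only:)
    qed
    also have "osc s h Q * (Lp_mean ?q Q G * ?m * ?m) \<le> 2 * (osc s h Q * (Lp_mean ?q Q G * ?m * ?m))"
      by (simp add: mult_2)
    finally show ?thesis by (simp add: power2_eq_square mult_ac)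
  next
    case False
    then obtain \<sigma> where \<sigma>: "s = ereal \<sigma>" "1 < \<sigma>" using s by (cases s) (auto simp: one_ereal_def)
    then have q: "?q = \<sigma> / (\<sigma> - 1)" by (simp add: conj_exponent_def)
    have pq: "1 / \<sigma> + 1 / ?q = 1" using \<sigma> unfolding q by (simp add: field_simps)
    have osc: "osc s h Q = epowr ((\<integral>\<^sup>+z. ennreal (norm (h (fst z) - h (snd z)) powr \<sigma>) \<partial>(L \<Otimes>\<^sub>M L)) / ?m\<^sup>2) (1 / \<sigma>)"
      by (simp add: \<sigma> osc_def L_def Let_def split_beta')
    have "(\<integral>\<^sup>+z. ennreal (G (fst z) powr ?q) \<partial>(L \<Otimes>\<^sub>M L)) = (\<integral>\<^sup>+x. ennreal (G x powr ?q) \<partial>L) * ?m"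
      by (subst L.nn_integral_fst[symmetric]) (auto simp: mL nn_integral_multc)
    then have mean: "Lp_mean ?q Q G = epowr ((\<integral>\<^sup>+z. ennreal (G (fst z) powr ?q) \<partial>(L \<Otimes>\<^sub>M L)) / ?m\<^sup>2) (1 / ?q)"
      using divide_mult_eq[of ?m "\<integral>\<^sup>+x. ennreal (G x powr ?q) \<partial>L" ?m] m
      by (simp only: Lp_mean_def int_L power2_eq_square infinity_ennreal_def simp_thms)
    have "(\<integral>\<^sup>+z. ennreal (norm (h (fst z) - h (snd z)) * G (fst z)) \<partial>(L \<Otimes>\<^sub>M L)) / ?m\<^sup>2
      \<le> 2 * osc s h Q * Lp_mean ?q Q G"
      unfolding osc mean using \<sigma> pq m2 G0 by (intro nn_integral_Holder) auto
    then have "(\<integral>\<^sup>+z. ennreal (norm (h (fst z) - h (snd z)) * G (fst z)) \<partial>(L \<Otimes>\<^sub>M L)) / ?m\<^sup>2 * ?m\<^sup>2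
      \<le> 2 * osc s h Q * Lp_mean ?q Q G * ?m\<^sup>2"
      by (rule mult_right_mono) simp
    then show ?thesis
      using m2 by (subst (asm) ennreal_divide_mult_cancel) auto
  qed
  finally show ?thesis .
qed

section \<open>Dyadic grids\<close>

declare emeasure_completion [simp del]

section \<open>Closed cubes and their measure\<close>

lemma mem_cube_iff: "x \<in> cube c l \<longleftrightarrow> (\<forall>i. c $ i - l / 2 \<le> x $ i \<and> x $ i \<le> c $ i + l / 2)"
  by (simp add: cube_def mem_box_cart)

lemma cube_sets [measurable]: "cube c l \<in> sets lebesgue" "cube c l \<in> sets borel"
  by (simp_all add: cube_def)

lemma emeasure_cube:
  fixes c :: "real ^ 'n"
  assumes "0 \<le> l" shows "emeasure lebesgue (cube c l) = ennreal (l ^ CARD('n))"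
proof -
  have "measure lborel (cube c l) = l ^ CARD('n)"
    using assms unfolding cube_def by (subst content_cbox_cart) (auto simp: interval_eq_empty_cart)
  then show ?thesis
    unfolding cube_def
    using emeasure_eq_ennreal_measure[of lborel "cbox (c - (\<chi> i. l / 2)) (c + (\<chi> i. l / 2))"]
      emeasure_lborel_cbox_finite[of "c - (\<chi> i. l / 2)" "c + (\<chi> i. l / 2)"]
    by (simp add: less_top emeasure_completion)
qed

lemma cube_inj:
  assumes "0 < l" "0 < l'" "cube c l = cube (c' :: real ^ 'n) l'"
  shows "c = c' \<and> l = l'"
proof -
  have "c \<in> cube c l" using assms(1) by (simp add: mem_cube_iff)
  then have "cube c l \<noteq> {}" by blast
  then have "c - (\<chi> i. l / 2) = c' - (\<chi> i. l' / 2)" "c + (\<chi> i. l / 2) = c' + (\<chi> i. l' / 2)"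
    using assms(3) unfolding cube_def eq_cbox by metis+
  then have "c $ i - l / 2 = c' $ i - l' / 2 \<and> c $ i + l / 2 = c' $ i + l' / 2" for i
    by (simp add: vec_eq_iff)
  then have "c $ i = c' $ i \<and> l = l'" for i by (smt (verit) field_sum_of_halves)
  then show ?thesis by (auto simp: vec_eq_iff)
qed

text \<open>A cell is addressed by its level, a natural number, and an integer vector. So there is a
  coarsest level, of side \<open>L\<close>, chains of ever larger cells end, and every family of
  cells is countable because its labels are. Offset and side are fixed only in the final theorem, in
  terms of the supports.\<close>

locale dyadic_grid =
  fixes a :: "real ^ 'n" and L :: real
  assumes L_pos: "0 < L"
begin

definition index :: "nat \<Rightarrow> real ^ 'n \<Rightarrow> int ^ 'n" where
  "index k x = (\<chi> i. \<lfloor>(x $ i - a $ i) * 2 ^ k / L\<rfloor>)"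

definition cell :: "nat \<times> (int ^ 'n) \<Rightarrow> (real ^ 'n) set" where
  "cell q = {x. index (fst q) x = snd q}"

definition side :: "nat \<times> (int ^ 'n) \<Rightarrow> real" where
  "side q = L / 2 ^ fst q"

definition centre :: "nat \<times> (int ^ 'n) \<Rightarrow> real ^ 'n" where
  "centre q = (\<chi> i. a $ i + side q * (snd q $ i + 1 / 2))"

definition dil :: "real \<Rightarrow> nat \<times> (int ^ 'n) \<Rightarrow> (real ^ 'n) set" where
  "dil t q = cube (centre q) (t * side q)"

section \<open>Geometry of cells and dilates\<close>

lemma side_pos [simp]: "0 < side q"
  using L_pos by (simp add: side_def)

lemma side_nonneg [simp]: "0 \<le> side q"
  using side_pos[of q] by linarith

lemma mem_cell_iff:
  "x \<in> cell q \<longleftrightarrow> (\<forall>i. a $ i + side q * snd q $ i \<le> x $ i \<and> x $ i < a $ i + side q * (snd q $ i + 1))"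
  using L_pos by (simp add: cell_def index_def vec_eq_iff floor_eq_iff side_def field_simps)

lemma cell_index: "x \<in> cell (k, index k x)"
  by (simp add: cell_def)

lemma mem_dil_iff:
  "x \<in> dil t q \<longleftrightarrow> (\<forall>i. a $ i + side q * (snd q $ i - (t - 1) / 2) \<le> x $ i
     \<and> x $ i \<le> a $ i + side q * (snd q $ i + (t + 1) / 2))"
proof -
  have "centre q $ i - t * side q / 2 = a $ i + side q * (snd q $ i - (t - 1) / 2)"
    "centre q $ i + t * side q / 2 = a $ i + side q * (snd q $ i + (t + 1) / 2)" for i
    by (simp_all add: centre_def field_simps)
  then show ?thesis by (simp add: dil_def mem_cube_iff)
qed

lemma cell_subset_dil: "1 \<le> t \<Longrightarrow> cell q \<subseteq> dil t q"
proof
  fix x assume t: "1 \<le> t" and x: "x \<in> cell q"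
  have "side q * (snd q $ i - (t - 1) / 2) \<le> side q * snd q $ i"
    "side q * (snd q $ i + 1) \<le> side q * (snd q $ i + (t + 1) / 2)" for i
    using t by (auto intro!: mult_left_mono)
  then show "x \<in> dil t q"
    using x unfolding mem_cell_iff mem_dil_iff by (smt (verit))
qed

lemma dil_sets [measurable]: "dil t q \<in> sets lebesgue"
  by (simp add: dil_def)

lemma cell_borel [measurable]: "cell q \<in> sets borel"
proof -
  have "cell q = {x \<in> space borel. \<forall>i. a $ i + side q * snd q $ i \<le> x $ i \<and> x $ i < a $ i + side q * (snd q $ i + 1)}"
    by (auto simp: mem_cell_iff)
  also have "\<dots> \<in> sets borel" by measurable
  finally show ?thesis .
qed

lemma cell_sets [measurable]: "cell q \<in> sets lebesgue"
  using cell_borel[of q] by (simp add: sets_completionI_sets)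

lemma emeasure_dil: "0 \<le> t \<Longrightarrow> emeasure lebesgue (dil t q) = ennreal ((t * side q) ^ CARD('n))"
  unfolding dil_def by (rule emeasure_cube) simp

lemma emeasure_cell: "emeasure lebesgue (cell q) = ennreal (side q ^ CARD('n))"
proof (rule antisym)
  show "emeasure lebesgue (cell q) \<le> ennreal (side q ^ CARD('n))"
    using emeasure_mono[OF cell_subset_dil[of 1 q], of lebesgue] emeasure_dil[of 1 q] by simp
next
  let ?l = "\<chi> i. a $ i + side q * snd q $ i" and ?u = "\<chi> i. a $ i + side q * (snd q $ i + 1)"
  have "box ?l ?u \<subseteq> cell q" by (simp add: subset_iff mem_box_cart mem_cell_iff less_imp_le)
  then have le: "emeasure lebesgue (box ?l ?u) \<le> emeasure lebesgue (cell q)"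
    by (intro emeasure_mono) auto
  have "measure lborel (box ?l ?u) = measure lborel (cbox ?l ?u)"
    by (simp add: measure_lborel_box_eq measure_lborel_cbox_eq)
  also have "\<dots> = side q ^ CARD('n)"
    by (subst content_cbox_cart) (auto simp: interval_eq_empty_cart algebra_simps not_less)
  finally have "emeasure lebesgue (box ?l ?u) = ennreal (side q ^ CARD('n))"
    using emeasure_eq_ennreal_measure[of lborel "box ?l ?u"] emeasure_lborel_box_finite[of ?l ?u]
    by (simp add: less_top emeasure_completion)
  then show "ennreal (side q ^ CARD('n)) \<le> emeasure lebesgue (cell q)" using le by simp
qed

lemma emeasure_dil_cell:
  "0 \<le> t \<Longrightarrow> emeasure lebesgue (dil t q) = ennreal (t ^ CARD('n)) * emeasure lebesgue (cell q)"
  by (simp add: emeasure_dil emeasure_cell power_mult_distrib ennreal_mult)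

lemma cell_pos_finite: "0 < emeasure lebesgue (cell q)" "emeasure lebesgue (cell q) < top"
  unfolding emeasure_cell by auto

lemma dil_pos_finite:
  "0 < t \<Longrightarrow> 0 < emeasure lebesgue (dil t q)" "0 < t \<Longrightarrow> emeasure lebesgue (dil t q) < top"
  by (auto simp: emeasure_dil simp del: emeasure_completion)

lemma cell_nonempty: "cell q \<noteq> {}"
  using cell_pos_finite(1)[of q] by auto

lemma is_cube_dil: "0 < t \<Longrightarrow> is_cube (dil t q)"
  unfolding is_cube_def dil_def using side_pos[of q] by (metis mult_pos_pos)

text \<open>Lets sums over labels be read as sums over a set of cubes, with no cube counted
  twice.\<close>

lemma dil_inj:
  assumes "0 < t" "dil t p = dil t q" shows "p = q"
proof -
  have "centre p = centre q \<and> t * side p = t * side q"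
    using assms by (intro cube_inj) (auto simp: dil_def)
  then have c: "centre p = centre q" and s: "side p = side q" using assms by auto
  have "(2::real) ^ fst p = 2 ^ fst q" using s L_pos by (auto simp: side_def frac_eq_eq)
  then have "fst p = fst q" by (simp add: power_inject_exp)
  moreover have "snd p = snd q"
    using c s side_pos[of q] by (auto simp: centre_def vec_eq_iff)
  ultimately show ?thesis by (simp add: prod_eq_iff)
qed

text \<open>The coarse index is a function of the fine one: dividing a real number by the integer
  2^(k-j) and rounding down amounts to integer division of its floor.\<close>

lemma index_nested:
  assumes "j \<le> k" "index k x = index k y" shows "index j x = index j y"
proof -
  have "index j x $ i = index k x $ i div 2 ^ (k - j)" for x i
  proof -
    have "(x $ i - a $ i) * 2 ^ j / L = (x $ i - a $ i) * 2 ^ k / L / of_int (2 ^ (k - j))"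
    proof -
      have "(2::real) ^ k = 2 ^ j * 2 ^ (k - j)" using assms(1) by (simp flip: power_add)
      then show ?thesis by simp
    qed
    then show ?thesis
      using floor_divide_real_eq_div[of "2 ^ (k - j)" "(x $ i - a $ i) * 2 ^ k / L"]
      by (simp only: index_def vec_lambda_beta) simp
  qed
  then show ?thesis using assms by (simp add: vec_eq_iff)
qed

lemma cell_nested:
  assumes "fst q \<le> fst p" "cell p \<inter> cell q \<noteq> {}" shows "cell p \<subseteq> cell q"
proof
  fix x assume x: "x \<in> cell p"
  obtain y where "y \<in> cell p" "y \<in> cell q" using assms(2) by blast
  then show "x \<in> cell q"
    using x index_nested[OF assms(1), of x y] by (simp add: cell_def)
qed

lemma cell_same_level:
  assumes "fst q = fst p" "cell p \<inter> cell q \<noteq> {}" shows "p = q"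
  using assms unfolding cell_def by (auto simp: prod_eq_iff)

lemma side_antimono: "fst q \<le> fst p \<Longrightarrow> side p \<le> side q"
  using L_pos by (simp add: side_def frac_le)

text \<open>The margin added on each side is (t - 1) / 2 times the side length, and the larger cell
  has the larger margin.\<close>

lemma dil_mono:
  assumes "fst q \<le> fst p" "cell p \<subseteq> cell q" "1 \<le> t" shows "dil t p \<subseteq> dil t q"
proof
  fix x assume x: "x \<in> dil t p"
  have s: "side p \<le> side q" using assms(1) by (rule side_antimono)
  have "(\<chi> i. a $ i + side p * snd p $ i) \<in> cell p"
    by (simp add: mem_cell_iff distrib_left)
  then have "(\<chi> i. a $ i + side p * snd p $ i) \<in> cell q"
    using assms(2) by blast
  then have l: "side q * snd q $ i \<le> side p * snd p $ i" "side p * snd p $ i < side q * (snd q $ i + 1)" for i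
    by (simp_all add: mem_cell_iff)
  have sq: "side q = side p * 2 ^ (fst p - fst q)"
    using assms(1) L_pos by (simp add: side_def power_diff field_simps)
  \<comment> \<open>The upper corner does not belong to the half-open cell, so containment says
    nothing about it directly. It is reached by integrality: in units of \<open>side p\<close> both
    ends are integers, and a strict inequality between integers improves by one.\<close>
  have u: "side p * (snd p $ i + 1) \<le> side q * (snd q $ i + 1)" for i
  proof -
    have "side p * snd p $ i < side p * (2 ^ (fst p - fst q) * (snd q $ i + 1))"
      using l(2)[of i] unfolding sq by (simp add: mult.assoc)
    then have "real_of_int (snd p $ i) < of_int (2 ^ (fst p - fst q) * (snd q $ i + 1))"
      using side_pos[of p] by (simp only: mult_less_cancel_left_pos)
    then have "snd p $ i + 1 \<le> 2 ^ (fst p - fst q) * (snd q $ i + 1)"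
      by linarith
    then have "real_of_int (snd p $ i + 1) \<le> of_int (2 ^ (fst p - fst q) * (snd q $ i + 1))"
      by (rule of_int_le_iff[THEN iffD2])
    then have "side p * real_of_int (snd p $ i + 1) \<le> side p * of_int (2 ^ (fst p - fst q) * (snd q $ i + 1))"
      by (intro mult_left_mono) auto
    then show ?thesis unfolding sq by (simp add: mult_ac)
  qed
  show "x \<in> dil t q" unfolding mem_dil_iff
  proof
    fix i
    have t: "(t - 1) / 2 * side p \<le> (t - 1) / 2 * side q"
      using s assms(3) by (intro mult_left_mono) auto
    have e: "\<sigma> * (z - (t - 1) / 2) = \<sigma> * z - (t - 1) / 2 * \<sigma>"
      "\<sigma> * (z + (t + 1) / 2) = \<sigma> * (z + 1) + (t - 1) / 2 * \<sigma>" for \<sigma> z :: real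
      by (simp_all add: field_simps)
    show "a $ i + side q * (snd q $ i - (t - 1) / 2) \<le> x $ i \<and> x $ i \<le> a $ i + side q * (snd q $ i + (t + 1) / 2)"
      using x[unfolded mem_dil_iff, rule_format, of i] l(1)[of i] u[of i] t
      unfolding e by simp
  qed
qed

text \<open>By nestedness the chosen point of the cell is immaterial. At level 0 the truncated
  subtraction makes a cell its own parent, which is why the measure is doubled in each direction
  only at positive levels.\<close>

definition parent :: "nat \<times> (int ^ 'n) \<Rightarrow> nat \<times> (int ^ 'n)" where
  "parent q = (fst q - 1, index (fst q - 1) (SOME x. x \<in> cell q))"

lemma cell_subset_parent: "cell q \<subseteq> cell (parent q)"
proof (rule cell_nested)
  have "(SOME x. x \<in> cell q) \<in> cell q" using cell_nonempty by (metis some_in_eq)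
  moreover have "(SOME x. x \<in> cell q) \<in> cell (parent q)"
    by (simp add: parent_def cell_index)
  ultimately show "cell q \<inter> cell (parent q) \<noteq> {}" by blast
qed (simp add: parent_def)

lemma emeasure_parent:
  assumes "0 < fst q"
  shows "emeasure lebesgue (cell (parent q)) = ennreal (2 ^ CARD('n)) * emeasure lebesgue (cell q)"
proof -
  have "side (parent q) = 2 * side q"
    using assms by (cases "fst q") (auto simp: side_def parent_def)
  then show ?thesis by (simp add: emeasure_cell power_mult_distrib ennreal_mult)
qed

text \<open>Smaller levels are larger cells. Cells of equal level are equal or disjoint, so only
  intersections with strictly coarser members have to be excluded.\<close>

definition maximal :: "(nat \<times> (int ^ 'n)) set \<Rightarrow> (nat \<times> (int ^ 'n)) set" where
  "maximal B = {p \<in> B. \<forall>q\<in>B. fst q < fst p \<longrightarrow> cell q \<inter> cell p = {}}"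

lemma maximal_disjoint: "disjoint_family_on cell (maximal B)"
  unfolding disjoint_family_on_def
proof (intro ballI impI)
  fix p q assume "p \<in> maximal B" "q \<in> maximal B" "p \<noteq> q"
  then show "cell p \<inter> cell q = {}"
    using cell_same_level[of p q] by (cases "fst p" "fst q" rule: linorder_cases) (auto simp: maximal_def)
qed

text \<open>Levels are natural numbers, so among the members of B through a given point of the cell
  one has least level. Nestedness makes it maximal and makes it contain the whole cell.\<close>

lemma maximal_cover:
  assumes "q \<in> B" obtains p where "p \<in> maximal B" "fst p \<le> fst q" "cell q \<subseteq> cell p"
proof -
  obtain x where x: "x \<in> cell q" using cell_nonempty by blast
  define p where "p = arg_min fst (\<lambda>p. p \<in> B \<and> x \<in> cell p)"
  have p: "p \<in> B" "x \<in> cell p" and min: "\<And>p'. p' \<in> B \<Longrightarrow> x \<in> cell p' \<Longrightarrow> fst p \<le> fst p'"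
    using arg_min_nat_lemma[of "\<lambda>p. p \<in> B \<and> x \<in> cell p" q fst] assms x by (auto simp: p_def)
  have "p \<in> maximal B"
    unfolding maximal_def
  proof (clarsimp simp: p simp del: split_paired_All)
    fix k z assume q': "(k, z) \<in> B" "k < fst p"
    show "cell (k, z) \<inter> cell p = {}"
    proof (rule ccontr)
      assume "\<not> ?thesis"
      then have "cell p \<subseteq> cell (k, z)" using q' by (intro cell_nested) auto
      then have "fst p \<le> k" using min[OF q'(1)] p by auto
      then show False using q' by simp
    qed
  qed
  moreover have "fst p \<le> fst q" using min assms x by simp
  moreover have "cell q \<subseteq> cell p" using \<open>fst p \<le> fst q\<close> x p by (intro cell_nested) auto
  ultimately show thesis by (rule that)
qed

lemma maximal_subset: "maximal B \<subseteq> B"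
  by (auto simp: maximal_def)

lemma UN_maximal: "(\<Union>p\<in>maximal B. cell p) = (\<Union>p\<in>B. cell p)"
proof
  show "(\<Union>p\<in>maximal B. cell p) \<subseteq> (\<Union>p\<in>B. cell p)"
    by (rule UN_mono[OF maximal_subset]) simp
  show "(\<Union>p\<in>B. cell p) \<subseteq> (\<Union>p\<in>maximal B. cell p)"
  proof (rule UN_least)
    fix q assume "q \<in> B"
    then obtain p where "p \<in> maximal B" "cell q \<subseteq> cell p" by (rule maximal_cover)
    then show "cell q \<subseteq> (\<Union>p\<in>maximal B. cell p)" by blast
  qed
qed

text \<open>Two points of a cell of level k differ by at most n L / 2^k in the l1 norm. The bound
  \<open>k0\<close> on the level serves to stay inside a prescribed cell.\<close>

lemma cell_in_open:
  assumes "open U" "x \<in> U" obtains k where "k \<ge> k0" "cell (k, index k x) \<subseteq> U"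
proof -
  obtain e where e: "0 < e" "ball x e \<subseteq> U" using assms open_contains_ball by blast
  obtain k1 where k1: "L * CARD('n) / e < 2 ^ k1" using real_arch_pow[of 2] by auto
  define k where "k = max k0 k1"
  have "L * CARD('n) / e < 2 ^ k"
    using k1 by (rule less_le_trans) (simp add: k_def power_increasing)
  then have small: "CARD('n) * side (k, index k x) < e"
    using e by (simp add: side_def field_simps)
  have "cell (k, index k x) \<subseteq> ball x e"
  proof
    fix y assume y: "y \<in> cell (k, index k x)"
    have "\<bar>(x - y) $ i\<bar> \<le> side (k, index k x)" for i
      using y[unfolded mem_cell_iff, rule_format, of i] cell_index[of x k, unfolded mem_cell_iff, rule_format, of i]
      by (auto simp add: distrib_left side_def abs_le_iff)
    then have "(\<Sum>i\<in>UNIV. \<bar>(x - y) $ i\<bar>) \<le> CARD('n) * side (k, index k x)"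
      using sum_bounded_above[of UNIV "\<lambda>i. \<bar>(x - y) $ i\<bar>" "side (k, index k x)"] by simp
    then have "norm (x - y) < e" using norm_le_l1_cart[of "x - y"] small by linarith
    then show "y \<in> ball x e" by (simp add: dist_norm)
  qed
  then show thesis using e that[of k] by (auto simp: k_def)
qed

text \<open>Cells are half-open and dilates are closed; hence the index 2, which only covers a null set.\<close>

definition neighbours :: "nat \<times> (int ^ 'n) \<Rightarrow> (nat \<times> (int ^ 'n)) set" where
  "neighbours q = {p. fst p = fst q \<and> (\<forall>i. snd p $ i \<in> {snd q $ i - 1..snd q $ i + 2})}"

text \<open>Four integers are allowed in each coordinate; this count is the origin of the factor 4^n
  in the constants.\<close>

lemma finite_neighbours: "finite (neighbours q)"
  and card_neighbours: "card (neighbours q) = 4 ^ CARD('n)"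
proof -
  have *: "neighbours q = (\<lambda>f. (fst q, \<chi> i. f i)) ` PiE UNIV (\<lambda>i. {snd q $ i - 1..snd q $ i + 2})"
  proof (intro set_eqI iffI)
    fix p assume "p \<in> neighbours q"
    then show "p \<in> (\<lambda>f. (fst q, \<chi> i. f i)) ` PiE UNIV (\<lambda>i. {snd q $ i - 1..snd q $ i + 2})"
      by (intro image_eqI[of _ _ "vec_nth (snd p)"]) (auto simp: neighbours_def prod_eq_iff vec_eq_iff)
  next
    fix p assume "p \<in> (\<lambda>f. (fst q, \<chi> i. f i)) ` PiE UNIV (\<lambda>i. {snd q $ i - 1..snd q $ i + 2})"
    then obtain f where "p = (fst q, \<chi> i. f i)" "f \<in> PiE UNIV (\<lambda>i. {snd q $ i - 1..snd q $ i + 2})" by blast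
    then show "p \<in> neighbours q" by (simp add: neighbours_def PiE_iff)
  qed
  show "finite (neighbours q)" unfolding * by (intro finite_imageI finite_PiE) auto
  show "card (neighbours q) = 4 ^ CARD('n)"
  proof -
    have "inj_on (\<lambda>f. (fst q, \<chi> i. f i)) (PiE UNIV (\<lambda>i::'n. {snd q $ i - 1..snd q $ i + 2}))"
      by (intro inj_onI ext) (simp add: vec_eq_iff)
    then show ?thesis unfolding * by (simp add: card_image card_PiE)
  qed
qed

lemma dil3_subset_neighbours: "dil 3 q \<subseteq> (\<Union>p\<in>neighbours q. cell p)"
proof
  fix x assume x: "x \<in> dil 3 q"
  define p where "p = (fst q, index (fst q) x)"
  have s: "side p = side q" by (simp add: side_def p_def)
  have xp: "x \<in> cell p" by (simp add: p_def cell_index)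
  have "snd p $ i \<in> {snd q $ i - 1..snd q $ i + 2}" for i
  proof -
    have "side q * (snd q $ i - (3 - 1) / 2) < side q * (snd p $ i + 1)"
      "side q * snd p $ i \<le> side q * (snd q $ i + (3 + 1) / 2)"
      using x[unfolded mem_dil_iff, rule_format, of i] xp[unfolded mem_cell_iff, rule_format, of i]
      unfolding s by linarith+
    then have "real_of_int (snd q $ i - 1) < of_int (snd p $ i + 1)" "real_of_int (snd p $ i) \<le> of_int (snd q $ i + 2)"
      by (simp_all add: mult_less_cancel_left_pos mult_le_cancel_left_pos)
    then show ?thesis by simp
  qed
  then have "p \<in> neighbours q" by (auto simp: neighbours_def p_def)
  then show "x \<in> (\<Union>p\<in>neighbours q. cell p)" using xp by blast
qed

text \<open>The label of q is at most 2 below and at most 1 above that of p. A concentric dilate is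
  symmetric, so two cells are added on either side, whence 5 = 1 + 2 * 2.\<close>

lemma cell_subset_neighbour_dil:
  assumes "p \<in> neighbours q" shows "cell q \<subseteq> dil 5 p"
proof
  fix x assume x: "x \<in> cell q"
  have [simp]: "side p = side q" using assms by (simp add: side_def neighbours_def)
  show "x \<in> dil 5 p" unfolding mem_dil_iff
  proof
    fix i
    have "snd q $ i - 1 \<le> snd p $ i \<and> snd p $ i \<le> snd q $ i + 2"
      using assms by (simp add: neighbours_def)
    then have "real_of_int (snd p $ i) - 2 \<le> snd q $ i" "real_of_int (snd q $ i) + 1 \<le> real_of_int (snd p $ i) + 3"
      by linarith+
    then have m: "side q * (real_of_int (snd p $ i) - 2) \<le> side q * snd q $ i"
      "side q * (real_of_int (snd q $ i) + 1) \<le> side q * (real_of_int (snd p $ i) + 3)"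
      by (simp_all only: mult_left_mono side_nonneg)
    have x': "a $ i + side q * real_of_int (snd q $ i) \<le> x $ i"
      "x $ i < a $ i + side q * (real_of_int (snd q $ i) + 1)"
      using x[unfolded mem_cell_iff, rule_format, of i] by simp_all
    have e: "(5 - 1) / 2 = (2::real)" "(5 + 1) / 2 = (3::real)" by simp_all
    have "a $ i + side q * (real_of_int (snd p $ i) - 2) \<le> x $ i" using m(1) x'(1) by linarith
    moreover have "x $ i \<le> a $ i + side q * (real_of_int (snd p $ i) + 3)" using m(2) x'(2) by linarith
    ultimately show "a $ i + side p * (snd p $ i - (5 - 1) / 2) \<le> x $ i \<and> x $ i \<le> a $ i + side p * (snd p $ i + (5 + 1) / 2)"
      by (simp add: e)
  qed
qed

end

section \<open>Operators and stopping cubes\<close>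

lemma Lp_c_iff:
  "f \<in> Lp_c p \<longleftrightarrow> f \<in> borel_measurable lebesgue \<and>
     (\<integral>\<^sup>+x. ennreal (norm (f x) powr p) \<partial>lebesgue) < top \<and> bounded {x. f x \<noteq> 0}"
  by (auto simp: Lp_c_def in_Lp_on_def lebesgue_on_UNIV_eq)

lemma Lp_c_dominated:
  fixes f g :: "real ^ 'n \<Rightarrow> 'k::real_normed_field"
  assumes f: "f \<in> Lp_c p" and g: "g \<in> borel_measurable lebesgue"
    and le: "\<And>x. norm (g x) \<le> norm (f x)" and p: "0 < p"
  shows "g \<in> Lp_c p"
proof -
  have "(\<integral>\<^sup>+x. ennreal (norm (g x) powr p) \<partial>lebesgue) \<le> (\<integral>\<^sup>+x. ennreal (norm (f x) powr p) \<partial>lebesgue)"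
    using p le by (intro nn_integral_mono ennreal_leI powr_mono2) auto
  also have "\<dots> < top" using f by (simp add: Lp_c_iff)
  finally have "(\<integral>\<^sup>+x. ennreal (norm (g x) powr p) \<partial>lebesgue) < top" .
  moreover have "{x. g x \<noteq> 0} \<subseteq> {x. f x \<noteq> 0}"
    using le by (auto simp: norm_le_zero_iff) (metis norm_le_zero_iff norm_zero)
  ultimately show ?thesis
    using f g by (auto simp: Lp_c_iff intro: bounded_subset)
qed

lemma Lp_c_indicator:
  fixes f :: "real ^ 'n \<Rightarrow> 'k::{real_normed_field, second_countable_topology}"
  assumes "f \<in> Lp_c p" "A \<in> sets lebesgue" "0 < p"
  shows "(\<lambda>y. indicator A y *\<^sub>R f y) \<in> Lp_c p"
proof (rule Lp_c_dominated[OF assms(1) _ _ assms(3)])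
  have [measurable]: "f \<in> borel_measurable lebesgue" using assms(1) by (simp add: Lp_c_iff)
  note assms(2)[measurable]
  show "(\<lambda>y. indicator A y *\<^sub>R f y) \<in> borel_measurable lebesgue" by measurable
qed (auto simp: indicator_def)

lemma Lp_c_cmult:
  fixes f :: "real ^ 'n \<Rightarrow> 'k::{real_normed_field, second_countable_topology}"
  assumes f: "f \<in> Lp_c p" and p: "0 < p"
  shows "(\<lambda>y. c * f y) \<in> Lp_c p"
proof -
  have [measurable]: "f \<in> borel_measurable lebesgue" using f by (simp add: Lp_c_iff)
  have "(\<integral>\<^sup>+x. ennreal (norm (c * f x) powr p) \<partial>lebesgue)
      = ennreal (norm c powr p) * (\<integral>\<^sup>+x. ennreal (norm (f x) powr p) \<partial>lebesgue)"
    by (subst nn_integral_cmult[symmetric]) (auto simp: norm_mult powr_mult ennreal_mult)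
  also have "\<dots> < top" using f by (simp add: Lp_c_iff ennreal_mult_less_top)
  finally have "(\<integral>\<^sup>+x. ennreal (norm (c * f x) powr p) \<partial>lebesgue) < top" .
  moreover have "(\<lambda>y. c * f y) \<in> borel_measurable lebesgue"
    by measurable
  ultimately show ?thesis
    using f by (auto simp: Lp_c_iff intro: bounded_subset)
qed

lemma Lp_c_add:
  fixes f g :: "real ^ 'n \<Rightarrow> 'k::{real_normed_field, second_countable_topology}"
  assumes f: "f \<in> Lp_c p" and g: "g \<in> Lp_c p" and p: "0 < p"
  shows "(\<lambda>y. f y + g y) \<in> Lp_c p"
proof -
  have [measurable]: "f \<in> borel_measurable lebesgue" "g \<in> borel_measurable lebesgue"
    using f g by (auto simp: Lp_c_iff)
  have *: "norm (f x + g x) powr p \<le> 2 powr p * (norm (f x) powr p + norm (g x) powr p)" for x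
  proof -
    have "norm (f x + g x) \<le> 2 * max (norm (f x)) (norm (g x))"
      using norm_triangle_ineq[of "f x" "g x"] by linarith
    then have "norm (f x + g x) powr p \<le> (2 * max (norm (f x)) (norm (g x))) powr p"
      using p by (intro powr_mono2) auto
    also have "\<dots> = 2 powr p * max (norm (f x)) (norm (g x)) powr p"
      by (simp add: powr_mult)
    also have "max (norm (f x)) (norm (g x)) powr p \<le> norm (f x) powr p + norm (g x) powr p"
      by (auto simp: max_def)
    finally show ?thesis by simp
  qed
  have "(\<integral>\<^sup>+x. ennreal (norm (f x + g x) powr p) \<partial>lebesgue)
      \<le> (\<integral>\<^sup>+x. ennreal (2 powr p) * (ennreal (norm (f x) powr p) + ennreal (norm (g x) powr p)) \<partial>lebesgue)"
    using * by (intro nn_integral_mono) (simp flip: ennreal_plus ennreal_mult)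
  also have "\<dots> = ennreal (2 powr p) * ((\<integral>\<^sup>+x. ennreal (norm (f x) powr p) \<partial>lebesgue)
      + (\<integral>\<^sup>+x. ennreal (norm (g x) powr p) \<partial>lebesgue))"
    by (simp add: nn_integral_cmult nn_integral_add)
  also have "\<dots> < top" using f g by (simp add: Lp_c_iff ennreal_mult_less_top)
  finally have "(\<integral>\<^sup>+x. ennreal (norm (f x + g x) powr p) \<partial>lebesgue) < top" .
  moreover have "bounded ({x. f x \<noteq> 0} \<union> {x. g x \<noteq> 0})" using f g by (simp add: Lp_c_iff)
  then have "bounded {x. f x + g x \<noteq> 0}" by (rule bounded_subset) auto
  ultimately show ?thesis by (simp add: Lp_c_iff)
qed

lemma Lp_c_zero: "(\<lambda>_. 0) \<in> Lp_c p"
  by (simp add: Lp_c_iff)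

lemma Lp_c_sum:
  fixes f :: "'i \<Rightarrow> real ^ 'n \<Rightarrow> 'k::{real_normed_field, second_countable_topology}"
  assumes "finite I" "\<And>i. i \<in> I \<Longrightarrow> f i \<in> Lp_c p" "0 < p"
  shows "(\<lambda>y. \<Sum>i\<in>I. f i y) \<in> Lp_c p"
  using assms by (induction I rule: finite_induct) (auto simp: Lp_c_zero Lp_c_add)

lemma Lp_c_in_Lp_on:
  fixes f :: "real ^ 'n \<Rightarrow> 'k::real_normed_field"
  assumes "f \<in> Lp_c p" "Q \<in> sets lebesgue"
  shows "in_Lp_on p Q f"
proof -
  have "(\<integral>\<^sup>+x\<in>Q. ennreal (norm (f x) powr p) \<partial>lebesgue) \<le> (\<integral>\<^sup>+x. ennreal (norm (f x) powr p) \<partial>lebesgue)"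
    by (intro nn_integral_mono) (auto simp: indicator_def)
  also have "\<dots> < top" using assms by (simp add: Lp_c_iff)
  finally show ?thesis
    using assms by (auto simp: in_Lp_on_def Lp_c_iff measurable_restrict_space1)
qed

section \<open>Sublinear operators of local weak type\<close>

locale weak_operator =
  fixes r :: real and s :: ereal
    and T :: "(real ^ 'n \<Rightarrow> 'k::{real_normed_field, banach, second_countable_topology}) \<Rightarrow> real ^ 'n \<Rightarrow> 'k"
    and \<phi>T \<phi>M :: "real \<Rightarrow> real"
  assumes r: "1 \<le> r" and rs: "ereal r < s"
    and sublinear: "sublinear_operator r T"
    and weak_T: "locally_weak_bounded r \<phi>T (\<lambda>f x. ennreal (norm (T f x)))"
    and weak_M: "locally_weak_bounded r \<phi>M (sharp_grand_maximal T s)"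
begin

lemma s_gt_1: "1 < s"
  using r rs by (metis ereal_less_eq(3) le_less_trans one_ereal_def)

abbreviation s' :: real where "s' \<equiv> conj_exponent s"

lemma s'_ge_1: "1 \<le> s'"
  by (rule conj_exponent_ge_1[OF s_gt_1])

lemma r_pos: "0 < r" using r by simp

lemma T_measurable: "f \<in> Lp_c r \<Longrightarrow> T f \<in> borel_measurable lebesgue"
  using sublinear by (simp add: sublinear_operator_def)

lemma T_add: "f \<in> Lp_c r \<Longrightarrow> g \<in> Lp_c r \<Longrightarrow> norm (T (\<lambda>y. f y + g y) x) \<le> norm (T f x) + norm (T g x)"
  using sublinear by (simp add: sublinear_operator_def)

lemma T_cmult: "f \<in> Lp_c r \<Longrightarrow> norm (T (\<lambda>y. c * f y) x) = norm c * norm (T f x)"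
  using sublinear by (simp add: sublinear_operator_def)

lemma T_diff:
  assumes "f \<in> Lp_c r" "g \<in> Lp_c r"
  shows "norm (T (\<lambda>y. f y - g y) x) \<le> norm (T f x) + norm (T g x)"
  using T_add[OF assms(1) Lp_c_cmult[OF assms(2) r_pos, of "- 1"], of x] T_cmult[OF assms(2), of "- 1" x]
  by simp

lemma T_zero: "T (\<lambda>_. 0) x = 0"
  using T_cmult[OF Lp_c_zero, of 0 x] by simp

lemma T_sum:
  assumes "finite I" "\<And>i. i \<in> I \<Longrightarrow> f i \<in> Lp_c r"
  shows "norm (T (\<lambda>y. \<Sum>i\<in>I. f i y) x) \<le> (\<Sum>i\<in>I. norm (T (f i) x))"
  using assms
proof (induction I rule: finite_induct)
  case empty
  then show ?case by (simp add: T_zero)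
next
  case (insert i I)
  then show ?case
    using T_add[of "f i" "\<lambda>y. \<Sum>i\<in>I. f i y" x] Lp_c_sum[of I f r] r_pos by fastforce
qed

lemma weak_T_bound:
  assumes Q: "is_cube Q" "Q \<in> sets lebesgue" and f: "f \<in> Lp_c r" and t: "0 < t" "t < 1"
  defines "B \<equiv> {x \<in> Q. ennreal (\<phi>T t) * Lp_mean r Q (\<lambda>y. norm (f y)) < ennreal (norm (T (\<lambda>y. indicator Q y *\<^sub>R f y) x))}"
  shows "B \<in> sets lebesgue" "emeasure lebesgue B \<le> ennreal t * emeasure lebesgue Q"
  using weak_T Q(1) Lp_c_in_Lp_on[OF f Q(2)] t unfolding B_def locally_weak_bounded_def by (auto simp: Let_def)

lemma weak_M_bound:
  assumes Q: "is_cube Q" "Q \<in> sets lebesgue" and f: "f \<in> Lp_c r" and t: "0 < t" "t < 1"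
  defines "B \<equiv> {x \<in> Q. ennreal (\<phi>M t) * Lp_mean r Q (\<lambda>y. norm (f y))
    < sharp_grand_maximal T s (\<lambda>y. indicator Q y *\<^sub>R f y) x}"
  shows "B \<in> sets lebesgue" "emeasure lebesgue B \<le> ennreal t * emeasure lebesgue Q"
  using weak_M Q(1) Lp_c_in_Lp_on[OF f Q(2)] t unfolding B_def locally_weak_bounded_def by (auto simp: Let_def)

lemma \<phi>_nonneg: "0 < t \<Longrightarrow> t < 1 \<Longrightarrow> 0 \<le> \<phi>T t" "0 < t \<Longrightarrow> t < 1 \<Longrightarrow> 0 \<le> \<phi>M t"
  using weak_T weak_M by (auto simp: locally_weak_bounded_def)

end

section \<open>Calderon--Zygmund cells of an open set\<close>

context dyadic_grid
begin

text \<open>The cells are the maximal subcells of q in which U has density above 2^-(n+1). A parent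
  is 2^n times larger, so in a maximal cell the density is at most 1/2. The assumed bound 2^-(n+3)
  keeps q itself from being selected and limits the total measure to 1/4 of q.\<close>

lemma calderon_zygmund:
  assumes U: "open U" and small: "emeasure lebesgue U \<le> ennreal (1 / 2 ^ (CARD('n) + 3)) * emeasure lebesgue (cell q)"
  obtains ch where "\<And>p. p \<in> ch \<Longrightarrow> fst q < fst p \<and> cell p \<subseteq> cell q"
    "disjoint_family_on cell ch"
    "emeasure lebesgue (\<Union>p\<in>ch. cell p) \<le> ennreal (1 / 2) * emeasure lebesgue (cell q)"
    "cell q \<inter> U \<subseteq> (\<Union>p\<in>ch. cell p)"
    "\<And>p. p \<in> ch \<Longrightarrow> emeasure lebesgue (cell p \<inter> U) \<le> ennreal (1 / 2) * emeasure lebesgue (cell p)"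
proof -
  define N where "N = CARD('n)"
  have [measurable]: "U \<in> sets lebesgue" using U by (simp add: borel_open sets_completionI_sets)
  let ?\<mu> = "emeasure lebesgue"
  define B where "B = {p. fst q \<le> fst p \<and> cell p \<subseteq> cell q \<and> ennreal (1 / 2 ^ (N + 1)) * ?\<mu> (cell p) < ?\<mu> (cell p \<inter> U)}"
  define ch where "ch = maximal B"
  have chB: "p \<in> B" if "p \<in> ch" for p using that maximal_subset by (auto simp: ch_def simp del: split_paired_All)
  \<comment> \<open>As q is not selected, every selected cell is a proper subcell; its parent still
    lies in q and was a candidate that failed.\<close>
  have qB: "q \<notin> B"
  proof
    assume "q \<in> B"
    then have "ennreal (1 / 2 ^ (N + 1)) * ?\<mu> (cell q) < ?\<mu> (cell q \<inter> U)" by (simp add: B_def)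
    also have "\<dots> \<le> ?\<mu> U" by (intro emeasure_mono) auto
    also have "\<dots> \<le> ennreal (1 / 2 ^ (N + 3)) * ?\<mu> (cell q)" using small by (simp add: N_def)
    also have "\<dots> \<le> ennreal (1 / 2 ^ (N + 1)) * ?\<mu> (cell q)"
      by (intro mult_right_mono ennreal_leI divide_left_mono power_increasing) auto
    finally show False by simp
  qed
  have lev: "fst q < fst p \<and> cell p \<subseteq> cell q" if "p \<in> ch" for p
  proof -
    have "p \<in> B" using chB that by simp
    then have p: "fst q \<le> fst p" "cell p \<subseteq> cell q" by (simp_all add: B_def)
    have "p \<noteq> q" using \<open>p \<in> B\<close> qB by metis
    have "cell p \<inter> cell q \<noteq> {}" using p(2) cell_nonempty[of p] by (simp add: Int_absorb2)
    then have "fst p \<noteq> fst q" using cell_same_level[of q p] \<open>p \<noteq> q\<close> by metis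
    then show ?thesis using p by simp
  qed
  have disj: "disjoint_family_on cell ch" unfolding ch_def by (rule maximal_disjoint)
  have cU: "countable ch" by (rule countable_subset[OF subset_UNIV]) simp
  have dU: "disjoint_family_on (\<lambda>p. cell p \<inter> U) ch"
    by (rule disjoint_family_on_bisimulation[OF disj]) blast
  have "ennreal (1 / 2 ^ (N + 1)) * ?\<mu> (\<Union>p\<in>ch. cell p) = (\<integral>\<^sup>+p. ennreal (1 / 2 ^ (N + 1)) * ?\<mu> (cell p) \<partial>count_space ch)"
    using disj cU by (subst emeasure_UN_countable) (auto simp: nn_integral_cmult)
  also have "\<dots> \<le> (\<integral>\<^sup>+p. ?\<mu> (cell p \<inter> U) \<partial>count_space ch)"
    using chB by (intro nn_integral_mono) (auto simp: B_def intro: less_imp_le)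
  also have "\<dots> \<le> ?\<mu> U"
    by (intro emeasure_disjoint_sum_le dU cU) simp_all
  also have "\<dots> \<le> ennreal (1 / 2 ^ (N + 3)) * ?\<mu> (cell q)" using small by (simp add: N_def)
  finally have "ennreal (2 ^ (N + 1)) * (ennreal (1 / 2 ^ (N + 1)) * ?\<mu> (\<Union>p\<in>ch. cell p))
      \<le> ennreal (2 ^ (N + 1)) * (ennreal (1 / 2 ^ (N + 3)) * ?\<mu> (cell q))"
    by (rule mult_left_mono) simp
  also have "ennreal (2 ^ (N + 1)) * (ennreal (1 / 2 ^ (N + 1)) * ?\<mu> (\<Union>p\<in>ch. cell p)) = ?\<mu> (\<Union>p\<in>ch. cell p)"
    by (simp flip: mult.assoc ennreal_mult)
  also have "ennreal (2 ^ (N + 1)) * (ennreal (1 / 2 ^ (N + 3)) * ?\<mu> (cell q)) = ennreal (1 / 4) * ?\<mu> (cell q)"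
    by (simp add: power_add flip: mult.assoc ennreal_mult)
  also have "\<dots> \<le> ennreal (1 / 2) * ?\<mu> (cell q)"
    by (intro mult_right_mono ennreal_leI) auto
  finally have half: "?\<mu> (\<Union>p\<in>ch. cell p) \<le> ennreal (1 / 2) * ?\<mu> (cell q)" .
  have cover: "cell q \<inter> U \<subseteq> (\<Union>p\<in>ch. cell p)"
  proof
    fix x assume x: "x \<in> cell q \<inter> U"
    \<comment> \<open>Openness of U yields a small cell of full density at every point, so the
      selected cells cover all of U in q and not just almost all of it.\<close>
    obtain k where k: "k \<ge> fst q" "cell (k, index k x) \<subseteq> U"
      using cell_in_open[OF U, of x] x by blast
    let ?p = "(k, index k x)"
    have "cell ?p \<subseteq> cell q"
      using k x cell_index[of x k] by (intro cell_nested) auto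
    moreover have "ennreal (1 / 2 ^ (N + 1)) * ?\<mu> (cell ?p) < ?\<mu> (cell ?p)"
    proof -
      have "side ?p ^ N / 2 ^ (N + 1) < side ?p ^ N / 1"
        by (intro divide_strict_left_mono one_less_power) auto
      then show ?thesis
        by (simp add: emeasure_cell N_def ennreal_less_iff flip: ennreal_mult)
    qed
    moreover have "cell ?p \<inter> U = cell ?p" using k by auto
    ultimately have "?p \<in> B" using k by (simp add: B_def)
    then show "x \<in> (\<Union>p\<in>ch. cell p)"
      unfolding ch_def UN_maximal using cell_index[of x k] by blast
  qed
  have good: "?\<mu> (cell p \<inter> U) \<le> ennreal (1 / 2) * ?\<mu> (cell p)" if p: "p \<in> ch" for p
  proof -
    have lp: "fst (parent p) < fst p" "fst q \<le> fst (parent p)" "0 < fst p"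
      using lev[OF p] by (auto simp: parent_def)
    have "cell p \<subseteq> cell (parent p)" by (rule cell_subset_parent)
    then have int: "cell (parent p) \<inter> cell p \<noteq> {}" "cell (parent p) \<inter> cell q \<noteq> {}"
      using lev[OF p] cell_nonempty[of p] by auto
    have "parent p \<notin> B" using p lp int by (auto simp: ch_def maximal_def)
    moreover have "cell (parent p) \<subseteq> cell q" using lp int by (intro cell_nested) auto
    ultimately have "?\<mu> (cell (parent p) \<inter> U) \<le> ennreal (1 / 2 ^ (N + 1)) * ?\<mu> (cell (parent p))"
      using lp by (simp add: B_def not_less)
    also have "\<dots> = ennreal (1 / 2) * ?\<mu> (cell p)"
      using lp by (simp add: emeasure_parent N_def flip: mult.assoc ennreal_mult)
    finally show ?thesis
      using emeasure_mono[of "cell p \<inter> U" "cell (parent p) \<inter> U" lebesgue] \<open>cell p \<subseteq> cell (parent p)\<close>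
      by (meson Int_mono \<open>U \<in> sets lebesgue\<close> cell_sets order_refl order_trans sets.Int)
  qed
  show thesis by (rule that[OF lev disj half cover good])
qed

end


text \<open>Integrating the pointwise bound of the indicator of the union by the sum of indicators
  treats finite and infinite index sets at once.\<close>

lemma emeasure_UN_countable_le:
  assumes I: "countable I" and P: "\<And>i. i \<in> I \<Longrightarrow> P i \<in> sets M"
  shows "emeasure M (\<Union>i\<in>I. P i) \<le> (\<integral>\<^sup>+i. emeasure M (P i) \<partial>count_space I)"
proof -
  have "emeasure M (\<Union>i\<in>I. P i) = (\<integral>\<^sup>+x. indicator (\<Union>i\<in>I. P i) x \<partial>M)"
    using I P by (intro nn_integral_indicator[symmetric] sets.countable_UN') auto
  also have "\<dots> \<le> (\<integral>\<^sup>+x. \<integral>\<^sup>+i. indicator (P i) x \<partial>count_space I \<partial>M)"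
  proof (rule nn_integral_mono)
    fix x
    show "indicator (\<Union>i\<in>I. P i) x \<le> (\<integral>\<^sup>+i. indicator (P i) x \<partial>count_space I)"
    proof (cases "x \<in> (\<Union>i\<in>I. P i)")
      case True
      then obtain i where i: "i \<in> I" "x \<in> P i" by blast
      have "indicator (P i) x \<le> (\<integral>\<^sup>+i. indicator (P i) x \<partial>count_space I)"
        using i by (intro nn_integral_ge_point)
      then show ?thesis using i True by simp
    qed simp
  qed
  also have "\<dots> = (\<integral>\<^sup>+i. \<integral>\<^sup>+x. indicator (P i) x \<partial>M \<partial>count_space I)"
    using P by (intro nn_integral_count_space_nn_integral I) auto
  also have "\<dots> = (\<integral>\<^sup>+i. emeasure M (P i) \<partial>count_space I)"
    using P by (intro nn_integral_cong nn_integral_indicator) auto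
  finally show ?thesis .
qed

section \<open>The dyadic maximal function\<close>

context dyadic_grid
begin

text \<open>The weak type (1,1) bound for the dyadic maximal function. Enlarging the maximal cells by the
  factor 5 makes every neighbour of a cell outside \<open>V\<close> a good one, which controls the mean over
  the dilate of that cell.\<close>

lemma maximal_function_bound:
  fixes f :: "real ^ 'n \<Rightarrow> real"
  assumes f[measurable]: "f \<in> borel_measurable lebesgue" and r: "1 \<le> r"
    and supp: "\<And>x. x \<notin> dil 3 q \<Longrightarrow> f x = 0"
    and A: "Lp_mean r (dil 3 q) f < top" and \<Lambda>: "1 \<le> \<Lambda>"
  obtains V where "V \<in> sets lebesgue"
    "emeasure lebesgue V \<le> ennreal (15 ^ CARD('n) / \<Lambda>) * emeasure lebesgue (cell q)"
    "\<And>p. fst q \<le> fst p \<Longrightarrow> \<not> cell p \<subseteq> V \<Longrightarrow>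
      Lp_mean r (dil 3 p) f \<le> ennreal (4 ^ CARD('n) * \<Lambda>) * Lp_mean r (dil 3 q) f"
proof -
  define N where "N = CARD('n)"
  let ?\<mu> = "emeasure lebesgue"
  obtain \<alpha> where \<alpha>: "Lp_mean r (dil 3 q) f = ennreal \<alpha>" "0 \<le> \<alpha>"
    using A by (cases "Lp_mean r (dil 3 q) f") auto
  define \<nu> where "\<nu> = density lebesgue (\<lambda>x. ennreal (f x powr r))"
  have \<nu>: "emeasure \<nu> S = (\<integral>\<^sup>+x\<in>S. ennreal (f x powr r) \<partial>lebesgue)" if "S \<in> sets lebesgue" for S
    unfolding \<nu>_def using that by (subst emeasure_density) auto
  have [simp]: "sets \<nu> = sets lebesgue" by (simp add: \<nu>_def)
  have total: "emeasure \<nu> UNIV = ennreal (\<alpha> powr r) * ?\<mu> (dil 3 q)"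
  proof -
    have "emeasure \<nu> UNIV = (\<integral>\<^sup>+x\<in>dil 3 q. ennreal (f x powr r) \<partial>lebesgue)"
      using supp r by (auto simp: \<nu> indicator_def intro!: nn_integral_cong)
    also have "\<dots> = ennreal (\<alpha> powr r) * ?\<mu> (dil 3 q)"
      using Lp_mean_eq_ennreal_iff[of "dil 3 q" \<alpha> r f] dil_pos_finite[of 3 q] r \<alpha> by simp
    finally show ?thesis .
  qed
  \<comment> \<open>The threshold for the cell averages of f^r, where \<alpha> is the mean of f over
    \<open>dil 3 q\<close>.\<close>
  define c where "c = \<Lambda> * \<alpha> powr r"
  have c0: "0 \<le> c" using \<Lambda> by (simp add: c_def)
  \<comment> \<open>All cells of the grid compete, not only those in q, because neighbours of a
    subcell of q may lie outside q.\<close>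
  define B where "B = {p. ennreal c * ?\<mu> (cell p) < emeasure \<nu> (cell p)}"
  define V where "V = (\<Union>p\<in>maximal B. dil 5 p)"
  have cnt: "countable (maximal B)" by (rule countable_subset[OF subset_UNIV]) simp
  have V: "V \<in> sets lebesgue" unfolding V_def using cnt by (intro sets.countable_UN') auto
  have "?\<mu> V \<le> (\<integral>\<^sup>+p. ?\<mu> (dil 5 p) \<partial>count_space (maximal B))"
    unfolding V_def using cnt by (intro emeasure_UN_countable_le) auto
  also have "\<dots> = ennreal (5 ^ N) * (\<integral>\<^sup>+p. ?\<mu> (cell p) \<partial>count_space (maximal B))"
    by (simp add: emeasure_dil_cell N_def nn_integral_cmult)
  also have "\<dots> \<le> ennreal (5 ^ N) * (ennreal (1 / \<Lambda>) * ?\<mu> (dil 3 q))"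
  proof (rule mult_left_mono)
    show "(\<integral>\<^sup>+p. ?\<mu> (cell p) \<partial>count_space (maximal B)) \<le> ennreal (1 / \<Lambda>) * ?\<mu> (dil 3 q)"
    \<comment> \<open>For \<alpha> = 0 the threshold c is 0 and cannot be cancelled; but then f^r
      has no mass and no cell is selected.\<close>
    proof (cases "\<alpha> = 0")
      case True
      have "p \<notin> B" for p
        using total True r emeasure_mono[of "cell p" UNIV \<nu>] by (simp add: B_def)
      then have "maximal B = {}" using maximal_subset by blast
      then show ?thesis by (simp add: nn_integral_empty)
    next
      case False
      have "ennreal c * (\<integral>\<^sup>+p. ?\<mu> (cell p) \<partial>count_space (maximal B))
          = (\<integral>\<^sup>+p. ennreal c * ?\<mu> (cell p) \<partial>count_space (maximal B))"
        by (simp add: nn_integral_cmult)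
      also have "\<dots> \<le> (\<integral>\<^sup>+p. emeasure \<nu> (cell p) \<partial>count_space (maximal B))"
      proof (rule nn_integral_mono)
        fix p assume "p \<in> space (count_space (maximal B))"
        then have "p \<in> B" using maximal_subset by simp blast
        then show "ennreal c * ?\<mu> (cell p) \<le> emeasure \<nu> (cell p)" by (simp add: B_def)
      qed
      also have "\<dots> \<le> emeasure \<nu> UNIV"
        by (intro emeasure_disjoint_sum_le maximal_disjoint cnt) simp_all
      also have "\<dots> = ennreal c * (ennreal (1 / \<Lambda>) * ?\<mu> (dil 3 q))"
        using \<Lambda> by (simp add: total c_def flip: mult.assoc ennreal_mult)
      finally show ?thesis
        using False \<Lambda> by (subst (asm) ennreal_mult_le_mult_iff) (auto simp: c_def ennreal_eq_0_iff not_le)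
    qed
  qed simp
  also have "\<dots> = ennreal (15 ^ N / \<Lambda>) * ?\<mu> (cell q)"
  proof -
    have "(5::real) ^ N * (1 / \<Lambda> * 3 ^ N) = 15 ^ N / \<Lambda>" by (simp flip: power_mult_distrib)
    then show ?thesis
      using \<Lambda> by (simp add: emeasure_dil_cell N_def flip: mult.assoc ennreal_mult)
  qed
  finally have small: "?\<mu> V \<le> ennreal (15 ^ N / \<Lambda>) * ?\<mu> (cell q)" .
  have "Lp_mean r (dil 3 p) f \<le> ennreal (4 ^ N * \<Lambda>) * Lp_mean r (dil 3 q) f"
    if p: "fst q \<le> fst p" "\<not> cell p \<subseteq> V" for p
  proof -
    have nb: "emeasure \<nu> (cell p') \<le> ennreal c * ?\<mu> (cell p)" if p': "p' \<in> neighbours p" for p'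
    proof -
      have "p' \<notin> B"
      proof
        assume "p' \<in> B"
        then obtain p'' where p'': "p'' \<in> maximal B" "fst p'' \<le> fst p'" "cell p' \<subseteq> cell p''"
          by (rule maximal_cover)
        have "cell p \<subseteq> dil 5 p''"
        proof -
          have "dil 5 p' \<subseteq> dil 5 p''" using p''(2,3) by (intro dil_mono) auto
          then show ?thesis using cell_subset_neighbour_dil[OF p'] by blast
        qed
        then show False using p(2) p''(1) by (auto simp: V_def simp del: split_paired_Ex)
      qed
      moreover have "side p' = side p" using p' by (simp add: neighbours_def side_def)
      ultimately show ?thesis by (simp add: B_def not_less emeasure_cell)
    qed
    have "emeasure \<nu> (dil 3 p) \<le> emeasure \<nu> (\<Union>p'\<in>neighbours p. cell p')"
      by (intro emeasure_mono dil3_subset_neighbours) (simp add: sets.finite_UN finite_neighbours)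
    also have "\<dots> \<le> (\<Sum>p'\<in>neighbours p. emeasure \<nu> (cell p'))"
      by (intro emeasure_subadditive_finite finite_neighbours) auto
    also have "\<dots> \<le> of_nat (card (neighbours p)) * (ennreal c * ?\<mu> (cell p))"
      using nb by (intro sum_bounded_above) auto
    also have "\<dots> = ennreal (4 ^ N * c) * ?\<mu> (cell p)"
    proof -
      have "(4::ennreal) ^ N = ennreal (4 ^ N)" by (metis ennreal_numeral ennreal_power zero_le_numeral)
      then show ?thesis using c0 by (simp add: card_neighbours N_def ennreal_mult mult.assoc)
    qed
    also have "\<dots> \<le> ennreal (4 ^ N * c) * ?\<mu> (dil 3 p)"
      by (intro mult_left_mono emeasure_mono cell_subset_dil) auto
    finally have "emeasure \<nu> (dil 3 p) / ?\<mu> (dil 3 p) \<le> ennreal (4 ^ N * c) * ?\<mu> (dil 3 p) / ?\<mu> (dil 3 p)"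
      by (rule divide_right_mono_ennreal)
    also have "\<dots> = ennreal (4 ^ N * c)"
      using dil_pos_finite[of 3 p] by (intro mult_divide_eq_ennreal) auto
    finally have "Lp_mean r (dil 3 p) f \<le> epowr (ennreal (4 ^ N * c)) (1 / r)"
      unfolding Lp_mean_def using r by (simp add: \<nu> epowr_mono)
    also have "\<dots> = ennreal ((4 ^ N * \<Lambda>) powr (1 / r) * \<alpha>)"
      using c0 r \<Lambda> \<alpha> by (simp add: epowr_ennreal c_def powr_mult powr_powr mult.assoc)
    also have "\<dots> \<le> ennreal ((4 ^ N * \<Lambda>) * \<alpha>)"
    proof (intro ennreal_leI mult_right_mono \<alpha>(2))
      have "1 * 1 \<le> 4 ^ N * \<Lambda>" using \<Lambda> by (intro mult_mono) auto
      then show "(4 ^ N * \<Lambda>) powr (1 / r) \<le> 4 ^ N * \<Lambda>"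
        using powr_mono[of "1 / r" 1 "4 ^ N * \<Lambda>"] r by simp
    qed
    also have "\<dots> = ennreal (4 ^ N * \<Lambda>) * Lp_mean r (dil 3 q) f"
      using \<alpha> \<Lambda> by (simp add: ennreal_mult)
    finally show ?thesis .
  qed
  then show thesis using that[OF V] small unfolding N_def by blast
qed

end

text \<open>Bridges closed and half-open cubes: oscillations are taken over \<open>dil 1 p\<close>,
  the pairing with g over \<open>cell p\<close>, and both have the same measure.\<close>

lemma Lp_mean_indicator:
  assumes "S \<subseteq> Q" "0 < p" "emeasure lebesgue S = emeasure lebesgue Q"
  shows "Lp_mean p Q (\<lambda>x. indicator S x * G x) = Lp_mean p S G"
proof -
  have "(\<integral>\<^sup>+x\<in>Q. ennreal ((indicator S x * G x) powr p) \<partial>lebesgue) = (\<integral>\<^sup>+x\<in>S. ennreal (G x powr p) \<partial>lebesgue)"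
    using assms by (intro nn_integral_cong) (auto simp: indicator_def)
  then show ?thesis using assms by (simp add: Lp_mean_def)
qed

lemma cancel_middle: "a \<noteq> 0 \<Longrightarrow> 1 / (d * a * b) * a = 1 / (d * b)" for a b d :: real
  by simp

text \<open>\<open>lam\<close> is the level of the two weak bounds on \<open>dil 3 q\<close> and
  \<Lambda> the height for the maximal function. For each of the m + 1 functions the weak bounds
  lose 2 * 3^n * \<open>lam\<close> of the cell and the maximal function loses 15^n / \<Lambda>;
  both numbers are 2^-(n+5) / (m + 1). The bound 1/4 is for the weak estimate of T on the dilate of
  a stopping cell.\<close>

lemma stopping_constants:
  fixes lam \<Lambda> :: real and m N :: nat
  assumes lam: "lam = 1 / ((real m + 1) * 3 ^ N * 2 ^ (N + 6))"
    and \<Lambda>: "\<Lambda> = (real m + 1) * 15 ^ N * 2 ^ (N + 5)"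
  shows "0 < lam" "lam < 1" "lam * 3 ^ N \<le> 1 / 4" "1 \<le> \<Lambda>"
proof -
  have 1: "1 \<le> (real m + 1) * 3 ^ N" using mult_mono[of 1 "real m + 1" 1 "3 ^ N"] by simp
  have 2: "(64::real) \<le> 2 ^ (N + 6)" by (simp add: power_add)
  have 3: "64 \<le> (real m + 1) * 3 ^ N * 2 ^ (N + 6)"
    using mult_mono[OF 1 2] by simp
  show "0 < lam" unfolding lam by simp
  show "lam < 1" unfolding lam using 3 by (subst divide_less_eq_1_pos) auto
  have "lam * 3 ^ N = 1 / ((real m + 1) * 2 ^ (N + 6))"
    unfolding lam by (rule cancel_middle) simp_all
  also have "\<dots> \<le> 1 / 64"
    using mult_mono[of 1 "real m + 1" 64 "2 ^ (N + 6)"] 2 by (intro divide_left_mono) auto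
  finally show "lam * 3 ^ N \<le> 1 / 4" by simp
  have "1 * 1 * 1 \<le> (real m + 1) * 15 ^ N * 2 ^ (N + 5)"
    by (intro mult_mono one_le_power) auto
  then show "1 \<le> \<Lambda>" unfolding \<Lambda> by simp
qed

section \<open>Stopping cells and the estimate on each of them\<close>

locale sparse_setup = dyadic_grid a L + weak_operator r s T \<phi>T \<phi>M
  for a :: "real ^ 'n" and L r s
    and T :: "(real ^ 'n \<Rightarrow> 'k::{real_normed_field, banach, second_countable_topology}) \<Rightarrow> real ^ 'n \<Rightarrow> 'k"
    and \<phi>T \<phi>M
begin

text \<open>For y in Y, |h(x)| is at most |h(y)| <= \<kappa> plus |h(x) - h(y)|. The oscillation is
  a mean in both variables, so no single y gives a bound; the inequality is averaged over Y, which
  fills at least a quarter of the cell. The 8 is this 4 times the 2 of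
  \<open>osc_duality\<close>.\<close>

lemma integral_le_osc:
  fixes h :: "real ^ 'n \<Rightarrow> 'k"
  assumes h[measurable]: "h \<in> borel_measurable lebesgue"
    and G[measurable]: "G \<in> borel_measurable lebesgue" and G0: "\<And>x. 0 \<le> G x"
    and Y: "Y \<in> sets lebesgue" "Y \<subseteq> cell p" "emeasure lebesgue (cell p) \<le> 4 * emeasure lebesgue Y"
    and \<kappa>: "\<And>y. y \<in> Y \<Longrightarrow> ennreal (norm (h y)) \<le> \<kappa>"
    and osc: "osc s h (dil 1 p) \<le> \<omega>"
  shows "(\<integral>\<^sup>+x\<in>cell p. ennreal (norm (h x) * G x) \<partial>lebesgue)
    \<le> 8 * \<omega> * (Lp_mean s' (cell p) G * emeasure lebesgue (cell p))
      + \<kappa> * (\<integral>\<^sup>+x\<in>cell p. ennreal (G x) \<partial>lebesgue)"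
    (is "?I \<le> 8 * \<omega> * (?\<tau> * ?\<mu>) + \<kappa> * ?J")
proof -
  let ?W = "dil 1 p" and ?G = "\<lambda>x. indicator (cell p) x * G x"
  define D where "D y = (\<integral>\<^sup>+x\<in>?W. ennreal (norm (h x - h y) * ?G x) \<partial>lebesgue)" for y
  have \<mu>W: "emeasure lebesgue ?W = ?\<mu>" by (simp add: emeasure_dil_cell)
  have sub: "cell p \<subseteq> ?W" by (rule cell_subset_dil) simp
  have Y0: "emeasure lebesgue Y \<noteq> 0" using Y(3) cell_pos_finite(1)[of p] by auto
  have Yfin: "emeasure lebesgue Y \<noteq> top"
    using emeasure_mono[OF Y(2), of lebesgue] cell_pos_finite(2)[of p] by (auto simp: top_unique)
  have D: "?I \<le> \<kappa> * ?J + D y" if "y \<in> Y" for y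
  proof -
    have "?I \<le> (\<integral>\<^sup>+x. \<kappa> * (ennreal (G x) * indicator (cell p) x) + ennreal (norm (h x - h y) * ?G x) * indicator ?W x \<partial>lebesgue)"
    proof (rule nn_integral_mono)
      fix x
      show "ennreal (norm (h x) * G x) * indicator (cell p) x
        \<le> \<kappa> * (ennreal (G x) * indicator (cell p) x) + ennreal (norm (h x - h y) * ?G x) * indicator ?W x"
      proof (cases "x \<in> cell p")
        case True
        have "norm (h x) * G x \<le> norm (h y) * G x + norm (h x - h y) * G x"
          using norm_triangle_sub[of "h x" "h y"] G0[of x] by (simp add: mult_right_mono flip: distrib_right)
        then have "ennreal (norm (h x) * G x) \<le> ennreal (norm (h y)) * ennreal (G x) + ennreal (norm (h x - h y) * G x)"
          using G0[of x] by (simp flip: ennreal_mult ennreal_plus)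
        also have "\<dots> \<le> \<kappa> * ennreal (G x) + ennreal (norm (h x - h y) * G x)"
          by (intro add_mono mult_right_mono \<kappa>[OF that]) auto
        finally show ?thesis using True sub by auto
      qed simp
    qed
    also have "\<dots> = \<kappa> * ?J + D y"
      unfolding D_def by (subst nn_integral_add) (auto simp: nn_integral_cmult)
    finally show ?thesis .
  qed
  show ?thesis
  \<comment> \<open>This term is subtracted below and has to be finite; if it is infinite, the bound
    is void.\<close>
  proof (cases "\<kappa> * ?J = top")
    case False
    have "(?I - \<kappa> * ?J) * emeasure lebesgue Y = (\<integral>\<^sup>+y. (?I - \<kappa> * ?J) * indicator Y y \<partial>lebesgue)"
      using Y(1) by (simp add: nn_integral_cmult_indicator)
    also have "\<dots> \<le> (\<integral>\<^sup>+y\<in>?W. D y \<partial>lebesgue)"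
    proof (rule nn_integral_mono)
      fix y
      show "(?I - \<kappa> * ?J) * indicator Y y \<le> D y * indicator ?W y"
        using D[of y] Y(2) sub False by (auto simp: indicator_def ennreal_minus_le_iff)
    qed
    also have "\<dots> \<le> 2 * osc s h ?W * Lp_mean s' ?W ?G * (emeasure lebesgue ?W)\<^sup>2"
      unfolding D_def using dil_pos_finite[of 1 p] s_gt_1 G0
      by (intro osc_duality) auto
    also have "\<dots> = 2 * osc s h ?W * (?\<tau> * ?\<mu>) * ?\<mu>"
      using Lp_mean_indicator[OF sub, of s' G] s'_ge_1 by (simp add: \<mu>W power2_eq_square mult.assoc)
    also have "\<dots> \<le> 2 * \<omega> * (?\<tau> * ?\<mu>) * (4 * emeasure lebesgue Y)"
      by (intro mult_mono osc Y(3)) auto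
    also have "\<dots> = (8 * \<omega> * (?\<tau> * ?\<mu>)) * emeasure lebesgue Y"
      by (simp add: mult_ac)
    finally have "emeasure lebesgue Y * (?I - \<kappa> * ?J) \<le> emeasure lebesgue Y * (8 * \<omega> * (?\<tau> * ?\<mu>))"
      by (simp add: mult.commute)
    then have "?I - \<kappa> * ?J \<le> 8 * \<omega> * (?\<tau> * ?\<mu>)"
      using Y0 Yfin by (simp add: ennreal_mult_le_mult_iff)
    then show ?thesis using False by (simp add: ennreal_minus_le_iff add.commute)
  qed simp
qed


lemma lebesgue_outer_open_le:
  assumes "S \<in> sets lebesgue" "0 < e"
  obtains U where "open U" "S \<subseteq> U" "emeasure lebesgue U \<le> emeasure lebesgue S + ennreal e"
proof -
  obtain U where U: "open U" "S \<subseteq> U" "U - S \<in> lmeasurable" "emeasure lebesgue (U - S) < ennreal e"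
    using sets_lebesgue_outer_open[OF assms] by metis
  have "emeasure lebesgue U = emeasure lebesgue (S \<union> (U - S))" using U(2) by (simp add: Un_absorb1)
  also have "\<dots> \<le> emeasure lebesgue S + emeasure lebesgue (U - S)"
    using assms(1) U(3) by (intro emeasure_subadditive) (auto simp: fmeasurable_def)
  also have "\<dots> \<le> emeasure lebesgue S + ennreal e" using U(4) by (intro add_left_mono) simp
  finally show thesis using U that by blast
qed

text \<open>The closed cube \<open>dil 1 p\<close> contains x and has \<open>dil 3 p\<close> as its
  threefold dilate, so it competes in the supremum.\<close>

lemma sharp_grand_maximal_ge_osc:
  assumes "x \<in> cell p"
  shows "osc s (T (\<lambda>y. indicator (- dil 3 p) y *\<^sub>R f y)) (dil 1 p) \<le> sharp_grand_maximal T s f x"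
proof -
  have "(centre p, side p) \<in> {(c, l). 0 < l \<and> x \<in> cube c l}"
    using cell_subset_dil[of 1 p] assms by (auto simp: dil_def)
  then show ?thesis
    unfolding sharp_grand_maximal_def dil_def by (rule SUP_upper2) simp
qed

context
  fixes q :: "nat \<times> (int ^ 'n)" and m :: nat and lam \<Lambda> :: real
  assumes lam: "lam = 1 / ((real m + 1) * 3 ^ CARD('n) * 2 ^ (CARD('n) + 6))"
    and \<Lambda>: "\<Lambda> = (real m + 1) * 15 ^ CARD('n) * 2 ^ (CARD('n) + 5)"
begin

lemmas lam_bounds = stopping_constants[OF lam \<Lambda>]

text \<open>The weak bounds concern the restriction of f to \<open>dil 3 q\<close>. This set is only
  used for f supported there, so the restriction is not written.\<close>

definition bad :: "(real ^ 'n \<Rightarrow> 'k) \<Rightarrow> (real ^ 'n) set" where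
  "bad f = {x \<in> dil 3 q. ennreal (\<phi>T lam) * Lp_mean r (dil 3 q) (\<lambda>y. norm (f y)) < ennreal (norm (T f x))}
     \<union> {x \<in> dil 3 q. ennreal (\<phi>M lam) * Lp_mean r (dil 3 q) (\<lambda>y. norm (f y)) < sharp_grand_maximal T s f x}"

lemma exceptional_set:
  assumes f: "f \<in> Lp_c r" and supp: "\<And>x. x \<notin> dil 3 q \<Longrightarrow> f x = 0"
  obtains \<Omega> where "\<Omega> \<in> sets lebesgue" "bad f \<subseteq> \<Omega>"
    "emeasure lebesgue \<Omega> \<le> ennreal (1 / ((real m + 1) * 2 ^ (CARD('n) + 4))) * emeasure lebesgue (cell q)"
    "\<And>p. fst q \<le> fst p \<Longrightarrow> \<not> cell p \<subseteq> \<Omega> \<Longrightarrow> Lp_mean r (dil 3 p) (\<lambda>y. norm (f y))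
        \<le> ennreal (4 ^ CARD('n) * \<Lambda>) * Lp_mean r (dil 3 q) (\<lambda>y. norm (f y))"
proof -
  let ?\<mu> = "emeasure lebesgue"
  have f0: "(\<lambda>y. indicator (dil 3 q) y *\<^sub>R f y) = f" using supp by (auto simp: indicator_def)
  have Q3: "is_cube (dil 3 q)" "dil 3 q \<in> sets lebesgue" by (auto simp: is_cube_dil)
  have \<mu>3: "?\<mu> (dil 3 q) = ennreal (3 ^ CARD('n)) * ?\<mu> (cell q)" by (simp add: emeasure_dil_cell)
  have [measurable]: "f \<in> borel_measurable lebesgue" using f by (simp add: Lp_c_iff)
  have fin: "Lp_mean r (dil 3 q) (\<lambda>y. norm (f y)) < top"
    using Lp_c_in_Lp_on[OF f Q3(2)] dil_pos_finite[of 3 q] by (simp add: Lp_mean_finite_iff in_Lp_on_def)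
  note wT = weak_T_bound[OF Q3 f lam_bounds(1,2), unfolded f0]
  note wM = weak_M_bound[OF Q3 f lam_bounds(1,2), unfolded f0]
  have bad: "bad f \<in> sets lebesgue" unfolding bad_def using wT(1) wM(1) by (rule sets.Un)
  have bad_le: "?\<mu> (bad f) \<le> ennreal (1 / ((real m + 1) * 2 ^ (CARD('n) + 5))) * ?\<mu> (cell q)"
  proof -
    have "?\<mu> (bad f) \<le> ennreal lam * ?\<mu> (dil 3 q) + ennreal lam * ?\<mu> (dil 3 q)"
      unfolding bad_def using wT wM by (intro order_trans[OF emeasure_subadditive] add_mono)
    also have "ennreal lam * ?\<mu> (dil 3 q) = ennreal (lam * 3 ^ CARD('n)) * ?\<mu> (cell q)"
      using lam_bounds(1) by (simp add: \<mu>3 ennreal_mult mult.assoc)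
    also have "\<dots> + \<dots> = ennreal (lam * 3 ^ CARD('n) + lam * 3 ^ CARD('n)) * ?\<mu> (cell q)"
      using lam_bounds(1) by (subst ennreal_plus) (simp_all add: distrib_right)
    also have "lam * 3 ^ CARD('n) + lam * 3 ^ CARD('n) = 1 / ((real m + 1) * 2 ^ (CARD('n) + 5))"
    proof -
      have "lam * 3 ^ CARD('n) = 1 / ((real m + 1) * 2 ^ (CARD('n) + 6))"
        unfolding lam by (rule cancel_middle) simp
      also have "\<dots> = 1 / ((real m + 1) * 2 ^ (CARD('n) + 5)) / 2" by (simp add: power_add)
      finally show ?thesis by simp
    qed
    finally show ?thesis .
  qed
  obtain V where V: "V \<in> sets lebesgue"
    "?\<mu> V \<le> ennreal (15 ^ CARD('n) / \<Lambda>) * ?\<mu> (cell q)"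
    "\<And>p. fst q \<le> fst p \<Longrightarrow> \<not> cell p \<subseteq> V \<Longrightarrow>
      Lp_mean r (dil 3 p) (\<lambda>y. norm (f y)) \<le> ennreal (4 ^ CARD('n) * \<Lambda>) * Lp_mean r (dil 3 q) (\<lambda>y. norm (f y))"
    by (rule maximal_function_bound[of "\<lambda>y. norm (f y)" r q \<Lambda>])
       (use r supp fin lam_bounds(4) in auto)
  have "15 ^ CARD('n) / \<Lambda> = 1 / ((real m + 1) * 2 ^ (CARD('n) + 5))"
    using cancel_middle[of "15 ^ CARD('n)" "real m + 1" "2 ^ (CARD('n) + 5)"] unfolding \<Lambda> by simp
  then have "?\<mu> (bad f \<union> V) \<le> ennreal (1 / ((real m + 1) * 2 ^ (CARD('n) + 5))) * ?\<mu> (cell q)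
      + ennreal (1 / ((real m + 1) * 2 ^ (CARD('n) + 5))) * ?\<mu> (cell q)"
    using bad bad_le V(1,2) by (intro order_trans[OF emeasure_subadditive] add_mono) auto
  also have "\<dots> = ennreal (1 / ((real m + 1) * 2 ^ (CARD('n) + 4))) * ?\<mu> (cell q)"
  proof -
    have "1 / ((real m + 1) * 2 ^ (CARD('n) + 5)) + 1 / ((real m + 1) * 2 ^ (CARD('n) + 5))
        = 1 / ((real m + 1) * 2 ^ (CARD('n) + 4))"
    proof -
      have "1 / ((real m + 1) * 2 ^ (CARD('n) + 5)) = 1 / ((real m + 1) * 2 ^ (CARD('n) + 4)) / 2"
        by (simp add: power_add)
      then show ?thesis by simp
    qed
    then show ?thesis
      by (subst distrib_right[symmetric], subst ennreal_plus[symmetric]) simp_all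
  qed
  finally have le: "?\<mu> (bad f \<union> V) \<le> ennreal (1 / ((real m + 1) * 2 ^ (CARD('n) + 4))) * ?\<mu> (cell q)" .
  show thesis
  proof (rule that[of "bad f \<union> V", OF _ _ le])
    show "bad f \<union> V \<in> sets lebesgue" using bad V(1) by (rule sets.Un)
    fix p assume "fst q \<le> fst p" "\<not> cell p \<subseteq> bad f \<union> V"
    then show "Lp_mean r (dil 3 p) (\<lambda>y. norm (f y)) \<le> ennreal (4 ^ CARD('n) * \<Lambda>) * Lp_mean r (dil 3 q) (\<lambda>y. norm (f y))"
      by (intro V(3)) auto
  qed simp
qed

text \<open>The part of f outside 3p is f minus its restriction to 3p. On p, the values of T f are
  bounded off \<open>bad f\<close>, and those of T of the restriction are bounded off a quarter of p
  by the weak estimate on 3p, whose mean is compared with the one over 3q. At most half of p lies in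
  U, so a quarter of p remains for \<open>integral_le_osc\<close>.\<close>

lemma stopping_cell:
  assumes f: "f \<in> Lp_c r"
    and U: "U \<in> sets lebesgue" "bad f \<subseteq> U"
    and avg: "\<not> cell p \<subseteq> U \<Longrightarrow> Lp_mean r (dil 3 p) (\<lambda>y. norm (f y))
        \<le> ennreal (4 ^ CARD('n) * \<Lambda>) * Lp_mean r (dil 3 q) (\<lambda>y. norm (f y))"
    and p: "cell p \<subseteq> cell q" "emeasure lebesgue (cell p \<inter> U) \<le> ennreal (1 / 2) * emeasure lebesgue (cell p)"
    and G[measurable]: "G \<in> borel_measurable lebesgue" and G0: "\<And>x. 0 \<le> G x"
  shows "(\<integral>\<^sup>+x\<in>cell p. ennreal (norm (T (\<lambda>y. indicator (- dil 3 p) y *\<^sub>R f y) x) * G x) \<partial>lebesgue)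
    \<le> ennreal (8 * \<phi>M lam + 2 * (\<phi>T lam + 4 ^ CARD('n) * \<Lambda> * \<phi>T lam)) * Lp_mean r (dil 3 q) (\<lambda>y. norm (f y))
      * (Lp_mean s' (cell p) G * emeasure lebesgue (cell p))"
proof -
  let ?\<mu> = "emeasure lebesgue"
  define A where "A = Lp_mean r (dil 3 q) (\<lambda>y. norm (f y))"
  define h where "h = T (\<lambda>y. indicator (- dil 3 p) y *\<^sub>R f y)"
  define f3 where "f3 = (\<lambda>y. indicator (dil 3 p) y *\<^sub>R f y)"
  note U(1)[measurable]
  have P3: "is_cube (dil 3 p)" "dil 3 p \<in> sets lebesgue" by (auto simp: is_cube_dil)
  have f3: "f3 \<in> Lp_c r" unfolding f3_def using f P3(2) r_pos by (rule Lp_c_indicator)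
  have h_le: "norm (h y) \<le> norm (T f y) + norm (T f3 y)" for y
  proof -
    have "(\<lambda>y. indicator (- dil 3 p) y *\<^sub>R f y) = (\<lambda>y. f y - f3 y)"
      by (auto simp: f3_def indicator_def)
    then show ?thesis unfolding h_def using T_diff[OF f f3] by simp
  qed
  have h[measurable]: "h \<in> borel_measurable lebesgue"
    using sets.compl_sets[OF dil_sets[of 3 p]] unfolding h_def
    by (intro T_measurable Lp_c_indicator f r_pos) (simp add: Compl_eq_Diff_UNIV)
  define B where "B = {x \<in> dil 3 p. ennreal (\<phi>T lam) * Lp_mean r (dil 3 p) (\<lambda>y. norm (f y)) < ennreal (norm (T f3 x))}"
  have B[measurable]: "B \<in> sets lebesgue" and B_le: "?\<mu> B \<le> ennreal lam * ?\<mu> (dil 3 p)"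
    using weak_T_bound[OF P3 f lam_bounds(1,2)] by (simp_all add: B_def f3_def)
  define Y where "Y = cell p - U - B"
  have Y_sets: "Y \<in> sets lebesgue" by (simp add: Y_def)
  have "?\<mu> (cell p) \<le> 4 * ?\<mu> Y"
  proof -
    have "cell p \<subseteq> Y \<union> ((cell p \<inter> U) \<union> B)" by (auto simp: Y_def)
    then have "?\<mu> (cell p) \<le> ?\<mu> (Y \<union> ((cell p \<inter> U) \<union> B))" by (intro emeasure_mono) (auto simp: Y_sets)
    also have "\<dots> \<le> ?\<mu> Y + (?\<mu> (cell p \<inter> U) + ?\<mu> B)"
      using Y_sets by (intro order_trans[OF emeasure_subadditive] add_left_mono emeasure_subadditive) auto
    also have "\<dots> \<le> ?\<mu> Y + (ennreal (1 / 2) * ?\<mu> (cell p) + ennreal (1 / 4) * ?\<mu> (cell p))"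
    proof (intro add_left_mono add_mono p(2))
      have "?\<mu> B \<le> ennreal (lam * 3 ^ CARD('n)) * ?\<mu> (cell p)"
        using B_le lam_bounds(1) by (simp add: emeasure_dil_cell ennreal_mult mult.assoc)
      also have "\<dots> \<le> ennreal (1 / 4) * ?\<mu> (cell p)"
        using lam_bounds(3) by (intro mult_right_mono ennreal_leI) auto
      finally show "?\<mu> B \<le> ennreal (1 / 4) * ?\<mu> (cell p)" .
    qed
    finally have *: "?\<mu> (cell p) \<le> ?\<mu> Y + (ennreal (1 / 2) * ?\<mu> (cell p) + ennreal (1 / 4) * ?\<mu> (cell p))" .
    have "?\<mu> Y < top" using cell_pos_finite(2)[of p] emeasure_mono[of Y "cell p" lebesgue]
      by (auto simp: Y_def intro: le_less_trans)
    then obtain y where y: "?\<mu> Y = ennreal y" "0 \<le> y" by (cases "?\<mu> Y") auto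
    obtain v where v: "?\<mu> (cell p) = ennreal v" "0 \<le> v" by (rule that[OF emeasure_cell]) simp
    have "ennreal (1 / 2) * ennreal v = ennreal (1 / 2 * v)" "ennreal (1 / 4) * ennreal v = ennreal (1 / 4 * v)"
      using v by (intro ennreal_mult[symmetric]; simp)+
    then have "ennreal v \<le> ennreal y + (ennreal (1 / 2 * v) + ennreal (1 / 4 * v))"
      using *[unfolded y(1) v(1)] by (simp only:)
    also have "\<dots> = ennreal (y + (1 / 2 * v + 1 / 4 * v))"
      using y(2) v(2) by (subst ennreal_plus[symmetric]; simp)+
    finally have "v \<le> y + (1 / 2 * v + 1 / 4 * v)"
      using y(2) v(2) by (subst (asm) ennreal_le_iff) auto
    then have "v \<le> 4 * y" by simp
    then have "ennreal v \<le> ennreal (4 * y)" by (rule ennreal_leI)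
    also have "\<dots> = 4 * ennreal y" by (subst ennreal_mult) (use y in auto)
    finally show ?thesis using y v by simp
  qed
  note Y = Y_sets _ this
  \<comment> \<open>A good point serves twice: it shows that p is not contained in U, as
    \<open>avg\<close> demands, and the sharp maximal function at this point bounds the oscillation
    over p.\<close>
  have "Y \<noteq> {}" using Y(3) cell_pos_finite(1)[of p] by auto
  then obtain y0 where y0: "y0 \<in> Y" by blast
  then have "\<not> cell p \<subseteq> U" by (auto simp: Y_def)
  note avg = avg[OF this, folded A_def]
  have q3: "cell p \<subseteq> dil 3 q" using p(1) cell_subset_dil[of 3 q] by simp
  have not_bad: "ennreal (norm (T f y)) \<le> ennreal (\<phi>T lam) * A" "sharp_grand_maximal T s f y \<le> ennreal (\<phi>M lam) * A"
    if "y \<in> Y" for y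
  proof -
    have "y \<notin> bad f" "y \<in> dil 3 q" using that U(2) q3 by (auto simp: Y_def)
    then show "ennreal (norm (T f y)) \<le> ennreal (\<phi>T lam) * A" "sharp_grand_maximal T s f y \<le> ennreal (\<phi>M lam) * A"
      by (auto simp: bad_def A_def not_less)
  qed
  have \<phi>: "0 \<le> \<phi>T lam" "0 \<le> \<phi>M lam" using \<phi>_nonneg lam_bounds by auto
  define \<kappa> where "\<kappa> = ennreal (\<phi>T lam + 4 ^ CARD('n) * \<Lambda> * \<phi>T lam) * A"
  have \<kappa>: "ennreal (norm (h y)) \<le> \<kappa>" if y: "y \<in> Y" for y
  proof -
    have "y \<in> dil 3 p" "y \<notin> B" using y cell_subset_dil[of 3 p] by (auto simp: Y_def)
    then have "ennreal (norm (T f3 y)) \<le> ennreal (\<phi>T lam) * Lp_mean r (dil 3 p) (\<lambda>y. norm (f y))"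
      by (auto simp: B_def not_less)
    also have "\<dots> \<le> ennreal (\<phi>T lam) * (ennreal (4 ^ CARD('n) * \<Lambda>) * A)" by (intro mult_left_mono avg) simp
    finally have "ennreal (norm (T f y)) + ennreal (norm (T f3 y))
      \<le> ennreal (\<phi>T lam) * A + ennreal (\<phi>T lam) * (ennreal (4 ^ CARD('n) * \<Lambda>) * A)"
      by (intro add_mono not_bad[OF y])
    also have "\<dots> = \<kappa>"
      using \<phi> lam_bounds(4) by (simp add: \<kappa>_def ennreal_mult algebra_simps)
    finally show ?thesis using ennreal_leI[OF h_le[of y]] by simp
  qed
  have osc: "osc s h (dil 1 p) \<le> ennreal (\<phi>M lam) * A"
    using sharp_grand_maximal_ge_osc[of y0 p f] not_bad(2)[OF y0] y0 unfolding h_def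
    by (auto simp: Y_def intro: order_trans)
  have "(\<integral>\<^sup>+x\<in>cell p. ennreal (norm (h x) * G x) \<partial>lebesgue)
    \<le> 8 * (ennreal (\<phi>M lam) * A) * (Lp_mean s' (cell p) G * ?\<mu> (cell p))
      + \<kappa> * (\<integral>\<^sup>+x\<in>cell p. ennreal (G x) \<partial>lebesgue)"
    by (rule integral_le_osc[OF h G G0 Y_sets _ Y(3) \<kappa> osc]) (auto simp: Y_def)
  also have "\<dots> \<le> 8 * (ennreal (\<phi>M lam) * A) * (Lp_mean s' (cell p) G * ?\<mu> (cell p))
      + \<kappa> * (2 * Lp_mean s' (cell p) G * ?\<mu> (cell p))"
    using cell_pos_finite[of p] s'_ge_1 G0
    by (intro add_left_mono mult_left_mono set_nn_integral_le_Lp_mean) auto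
  also have "\<dots> = ennreal (8 * \<phi>M lam + 2 * (\<phi>T lam + 4 ^ CARD('n) * \<Lambda> * \<phi>T lam)) * A
      * (Lp_mean s' (cell p) G * ?\<mu> (cell p))"
    using \<phi> lam_bounds(4) by (simp add: \<kappa>_def ennreal_mult ennreal_plus algebra_simps)
  finally show ?thesis by (simp add: h_def A_def)
qed


text \<open>U contains the exceptional sets of all m + 1 functions, so one family of cells serves
  every k. The family is also independent of G, which will be a different function for each
  k.\<close>

proposition stopping_family:
  assumes F: "\<And>k. k \<le> m \<Longrightarrow> F k \<in> Lp_c r" and supp: "\<And>k x. k \<le> m \<Longrightarrow> x \<notin> dil 3 q \<Longrightarrow> F k x = 0"
  obtains ch where "\<And>p. p \<in> ch \<Longrightarrow> fst q < fst p \<and> cell p \<subseteq> cell q"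
    "disjoint_family_on cell ch"
    "emeasure lebesgue (\<Union>p\<in>ch. cell p) \<le> ennreal (1 / 2) * emeasure lebesgue (cell q)"
    "\<And>k (G :: real ^ 'n \<Rightarrow> real). k \<le> m \<Longrightarrow> G \<in> borel_measurable lebesgue \<Longrightarrow> (\<And>x. 0 \<le> G x) \<Longrightarrow>
      (\<integral>\<^sup>+x\<in>cell q - (\<Union>p\<in>ch. cell p). ennreal (norm (T (F k) x) * G x) \<partial>lebesgue)
      + (\<integral>\<^sup>+p. (\<integral>\<^sup>+x\<in>cell p. ennreal (norm (T (\<lambda>y. indicator (- dil 3 p) y *\<^sub>R F k y) x) * G x) \<partial>lebesgue) \<partial>count_space ch)
      \<le> ennreal (4 ^ (CARD('n) + 2) * \<Lambda> * (\<phi>T lam + \<phi>M lam)) * (Lp_mean r (dil 3 q) (\<lambda>y. norm (F k y))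
        * Lp_mean s' (dil 3 q) G * emeasure lebesgue (dil 3 q))"
proof -
  let ?\<mu> = "emeasure lebesgue"
  define N where "N = CARD('n)"
  define A where "A k = Lp_mean r (dil 3 q) (\<lambda>y. norm (F k y))" for k
  define c where "c = 1 / ((real m + 1) * 2 ^ (N + 4))"
  have "\<exists>\<Omega>. \<Omega> \<in> sets lebesgue \<and> bad (F k) \<subseteq> \<Omega> \<and> ?\<mu> \<Omega> \<le> ennreal c * ?\<mu> (cell q) \<and>
      (\<forall>p. fst q \<le> fst p \<longrightarrow> \<not> cell p \<subseteq> \<Omega> \<longrightarrow> Lp_mean r (dil 3 p) (\<lambda>y. norm (F k y)) \<le> ennreal (4 ^ N * \<Lambda>) * A k)"
    if k: "k \<in> {..m}" for k
  proof -
    have kF: "F k \<in> Lp_c r" "\<And>x. x \<notin> dil 3 q \<Longrightarrow> F k x = 0" using F supp k by auto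
    show ?thesis
    proof (rule exceptional_set[OF kF])
      fix \<Omega> assume "\<Omega> \<in> sets lebesgue" "bad (F k) \<subseteq> \<Omega>"
        "?\<mu> \<Omega> \<le> ennreal (1 / ((real m + 1) * 2 ^ (CARD('n) + 4))) * ?\<mu> (cell q)"
        "\<And>p. fst q \<le> fst p \<Longrightarrow> \<not> cell p \<subseteq> \<Omega> \<Longrightarrow> Lp_mean r (dil 3 p) (\<lambda>y. norm (F k y))
          \<le> ennreal (4 ^ CARD('n) * \<Lambda>) * Lp_mean r (dil 3 q) (\<lambda>y. norm (F k y))"
      then show ?thesis
        unfolding c_def N_def A_def by (intro exI[of _ \<Omega>] conjI allI impI)
    qed
  qed
  then obtain \<Omega> where \<Omega>: "\<And>k. k \<in> {..m} \<Longrightarrow> \<Omega> k \<in> sets lebesgue \<and> bad (F k) \<subseteq> \<Omega> k \<and> ?\<mu> (\<Omega> k) \<le> ennreal c * ?\<mu> (cell q) \<and>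
      (\<forall>p. fst q \<le> fst p \<longrightarrow> \<not> cell p \<subseteq> \<Omega> k \<longrightarrow> Lp_mean r (dil 3 p) (\<lambda>y. norm (F k y)) \<le> ennreal (4 ^ N * \<Lambda>) * A k)"
    by metis
  have \<Omega>_sets: "(\<Union>k\<le>m. \<Omega> k) \<in> sets lebesgue" using \<Omega> by (intro sets.finite_UN) auto
  have "?\<mu> (\<Union>k\<le>m. \<Omega> k) \<le> (\<Sum>k\<le>m. ?\<mu> (\<Omega> k))" using \<Omega> by (intro emeasure_subadditive_finite) auto
  also have "\<dots> \<le> of_nat (card {..m}) * (ennreal c * ?\<mu> (cell q))" using \<Omega> by (intro sum_bounded_above) auto
  also have "\<dots> = ennreal (1 / 2 ^ (N + 4)) * ?\<mu> (cell q)"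
  proof -
    have "of_nat (card {..m}) * (ennreal c * ?\<mu> (cell q)) = ennreal (real m + 1) * (ennreal c * ?\<mu> (cell q))"
      by (simp add: ennreal_of_nat_eq_real_of_nat add.commute)
    also have "\<dots> = ennreal ((real m + 1) * c) * ?\<mu> (cell q)"
      by (subst ennreal_mult) (simp_all add: c_def mult.assoc)
    also have "(real m + 1) * c = 1 / 2 ^ (N + 4)" by (simp add: c_def)
    finally show ?thesis .
  qed
  finally have \<Omega>_le: "?\<mu> (\<Union>k\<le>m. \<Omega> k) \<le> ennreal (1 / 2 ^ (N + 4)) * ?\<mu> (cell q)" .
  \<comment> \<open>The error allowed equals the bound already obtained, so passing to an open set
    turns 2^-(n+4) into 2^-(n+3).\<close>
  obtain U where U: "open U" "(\<Union>k\<le>m. \<Omega> k) \<subseteq> U"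
    and U_le: "?\<mu> U \<le> ?\<mu> (\<Union>k\<le>m. \<Omega> k) + ennreal (1 / 2 ^ (N + 4) * side q ^ N)"
    by (rule lebesgue_outer_open_le[OF \<Omega>_sets, of "1 / 2 ^ (N + 4) * side q ^ N"]) auto
  have U_sets: "U \<in> sets lebesgue" using U(1) by (simp add: borel_open sets_completionI_sets)
  have "?\<mu> U \<le> ennreal (1 / 2 ^ (N + 4)) * ?\<mu> (cell q) + ennreal (1 / 2 ^ (N + 4) * side q ^ N)"
    using U_le \<Omega>_le by (meson add_right_mono order_trans)
  also have "ennreal (1 / 2 ^ (N + 4) * side q ^ N) = ennreal (1 / 2 ^ (N + 4)) * ?\<mu> (cell q)"
    by (subst ennreal_mult) (simp_all add: emeasure_cell N_def)
  also have "ennreal (1 / 2 ^ (N + 4)) * ?\<mu> (cell q) + ennreal (1 / 2 ^ (N + 4)) * ?\<mu> (cell q)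
      = ennreal (1 / 2 ^ (N + 3)) * ?\<mu> (cell q)"
    by (subst distrib_right[symmetric], subst ennreal_plus[symmetric]) (simp_all add: power_add mult.commute)
  finally have U_small: "?\<mu> U \<le> ennreal (1 / 2 ^ (CARD('n) + 3)) * ?\<mu> (cell q)" by (simp add: N_def)
  obtain ch where ch: "\<And>p. p \<in> ch \<Longrightarrow> fst q < fst p \<and> cell p \<subseteq> cell q"
    "disjoint_family_on cell ch"
    "?\<mu> (\<Union>p\<in>ch. cell p) \<le> ennreal (1 / 2) * ?\<mu> (cell q)"
    "cell q \<inter> U \<subseteq> (\<Union>p\<in>ch. cell p)"
    "\<And>p. p \<in> ch \<Longrightarrow> ?\<mu> (cell p \<inter> U) \<le> ennreal (1 / 2) * ?\<mu> (cell p)"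
    by (rule calderon_zygmund[OF U(1) U_small]) blast
  have cnt: "countable ch" by (rule countable_subset[OF subset_UNIV]) simp
  have UN_sets: "(\<Union>p\<in>ch. cell p) \<in> sets lebesgue" using cnt by (intro sets.countable_UN') auto
  have \<phi>: "0 \<le> \<phi>T lam" "0 \<le> \<phi>M lam" using \<phi>_nonneg lam_bounds by auto
  have q3: "cell q \<subseteq> dil 3 q" by (rule cell_subset_dil) simp
  show thesis
  proof (rule that[OF ch(1-3)])
    fix k and G :: "real ^ 'n \<Rightarrow> real" assume k: "k \<le> m" and G[measurable]: "G \<in> borel_measurable lebesgue" and G0: "\<And>x. 0 \<le> G x"
    have \<Omega>U: "bad (F k) \<subseteq> U" "\<Omega> k \<subseteq> U" using \<Omega>[of k] U(2) k by auto
    let ?X = "Lp_mean s' (dil 3 q) G * ?\<mu> (dil 3 q)"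
    have "(\<integral>\<^sup>+x\<in>cell q - (\<Union>p\<in>ch. cell p). ennreal (norm (T (F k) x) * G x) \<partial>lebesgue)
      \<le> (\<integral>\<^sup>+x. (ennreal (\<phi>T lam) * A k) * (ennreal (G x) * indicator (dil 3 q) x) \<partial>lebesgue)"
    proof (rule nn_integral_mono)
      fix x
      show "ennreal (norm (T (F k) x) * G x) * indicator (cell q - (\<Union>p\<in>ch. cell p)) x
        \<le> ennreal (\<phi>T lam) * A k * (ennreal (G x) * indicator (dil 3 q) x)"
      proof (cases "x \<in> cell q - (\<Union>p\<in>ch. cell p)")
        case True
        then have "x \<notin> bad (F k)" "x \<in> dil 3 q" using ch(4) \<Omega>U q3 by auto
        then have "ennreal (norm (T (F k) x)) \<le> ennreal (\<phi>T lam) * A k"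
          by (auto simp: bad_def A_def not_less)
        then show ?thesis using True \<open>x \<in> dil 3 q\<close> G0[of x]
          by (simp add: ennreal_mult mult_right_mono)
      qed simp
    qed
    also have "\<dots> = (ennreal (\<phi>T lam) * A k) * (\<integral>\<^sup>+x\<in>dil 3 q. ennreal (G x) \<partial>lebesgue)"
      by (simp add: nn_integral_cmult)
    also have "\<dots> \<le> (ennreal (\<phi>T lam) * A k) * (2 * Lp_mean s' (dil 3 q) G * ?\<mu> (dil 3 q))"
      using dil_pos_finite[of 3 q] s'_ge_1 G0 by (intro mult_left_mono set_nn_integral_le_Lp_mean) auto
    also have "\<dots> = ennreal (2 * \<phi>T lam) * (A k * ?X)"
      using \<phi> by (simp add: ennreal_mult mult_ac)
    finally have E: "(\<integral>\<^sup>+x\<in>cell q - (\<Union>p\<in>ch. cell p). ennreal (norm (T (F k) x) * G x) \<partial>lebesgue)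
      \<le> ennreal (2 * \<phi>T lam) * (A k * ?X)" .
    define d where "d = 8 * \<phi>M lam + 2 * (\<phi>T lam + 4 ^ CARD('n) * \<Lambda> * \<phi>T lam)"
    have d0: "0 \<le> d" using \<phi> lam_bounds(4) by (simp add: d_def)
    have "(\<integral>\<^sup>+p. (\<integral>\<^sup>+x\<in>cell p. ennreal (norm (T (\<lambda>y. indicator (- dil 3 p) y *\<^sub>R F k y) x) * G x) \<partial>lebesgue) \<partial>count_space ch)
      \<le> (\<integral>\<^sup>+p. (ennreal d * A k) * (Lp_mean s' (cell p) G * ?\<mu> (cell p)) \<partial>count_space ch)"
    proof (rule nn_integral_mono)
      fix p assume "p \<in> space (count_space ch)"
      then have p: "p \<in> ch" by simp
      have "Lp_mean r (dil 3 p) (\<lambda>y. norm (F k y)) \<le> ennreal (4 ^ CARD('n) * \<Lambda>) * A k" if "\<not> cell p \<subseteq> U"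
        using \<Omega>[of k] k that \<Omega>U(2) ch(1)[OF p] unfolding N_def by (meson atMost_iff less_imp_le order_trans)
      then show "(\<integral>\<^sup>+x\<in>cell p. ennreal (norm (T (\<lambda>y. indicator (- dil 3 p) y *\<^sub>R F k y) x) * G x) \<partial>lebesgue)
        \<le> (ennreal d * A k) * (Lp_mean s' (cell p) G * ?\<mu> (cell p))"
        using stopping_cell[OF F[OF k] U_sets \<Omega>U(1) _ _ ch(5)[OF p] G G0] ch(1)[OF p]
        unfolding d_def A_def by blast
    qed
    also have "\<dots> = (ennreal d * A k) * (\<integral>\<^sup>+p. Lp_mean s' (cell p) G * ?\<mu> (cell p) \<partial>count_space ch)"
      by (simp add: nn_integral_cmult)
    also have "\<dots> \<le> (ennreal d * A k) * (2 * Lp_mean s' (dil 3 q) G * ?\<mu> (dil 3 q))"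
    proof (intro mult_left_mono sum_Lp_mean_le)
      fix p assume "p \<in> ch"
      then show "cell p \<subseteq> dil 3 q" using ch(1) q3 by blast
    qed (use dil_pos_finite[of 3 q] s'_ge_1 cnt ch(2) cell_pos_finite in auto)
    also have "\<dots> = ennreal (2 * d) * (A k * ?X)"
      using d0 by (simp add: ennreal_mult mult_ac)
    finally have "(\<integral>\<^sup>+x\<in>cell q - (\<Union>p\<in>ch. cell p). ennreal (norm (T (F k) x) * G x) \<partial>lebesgue)
      + (\<integral>\<^sup>+p. (\<integral>\<^sup>+x\<in>cell p. ennreal (norm (T (\<lambda>y. indicator (- dil 3 p) y *\<^sub>R F k y) x) * G x) \<partial>lebesgue) \<partial>count_space ch)
      \<le> ennreal (2 * \<phi>T lam) * (A k * ?X) + ennreal (2 * d) * (A k * ?X)"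
      by (intro add_mono E)
    also have "\<dots> = ennreal (2 * \<phi>T lam + 2 * d) * (A k * ?X)"
      using \<phi> d0 by (simp add: ennreal_plus distrib_right)
    also have "\<dots> \<le> ennreal (4 ^ (CARD('n) + 2) * \<Lambda> * (\<phi>T lam + \<phi>M lam)) * (A k * ?X)"
    proof (intro mult_right_mono ennreal_leI)
      \<comment> \<open>With t and u the values of \<phi>T and \<phi>M at \<open>lam\<close>, the
        constant to be bounded is 6 t + 4 e t + 16 u; as e >= 1, it is at most 16 e (t + u).\<close>
      define e where "e = 4 ^ CARD('n) * \<Lambda>"
      have "1 * 1 \<le> e" unfolding e_def using lam_bounds(4) by (intro mult_mono) auto
      then have "\<phi>T lam \<le> e * \<phi>T lam" "\<phi>M lam \<le> e * \<phi>M lam"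
        using \<phi> mult_right_mono[of 1 e] by fastforce+
      moreover have "2 * t + 2 * (8 * u + 2 * (t + x)) \<le> 16 * x + 16 * y"
        if "t \<le> x" "u \<le> y" "0 \<le> t" "0 \<le> u" for t u x y :: real
      proof -
        have "6 * t \<le> 6 * x" "16 * u \<le> 16 * y" "0 \<le> 6 * x" using that by auto
        then show ?thesis by (simp add: algebra_simps)
      qed
      ultimately have "2 * \<phi>T lam + 2 * (8 * \<phi>M lam + 2 * (\<phi>T lam + e * \<phi>T lam)) \<le> 16 * (e * \<phi>T lam) + 16 * (e * \<phi>M lam)"
        using \<phi> by blast
      also have "\<dots> = 4 ^ (CARD('n) + 2) * \<Lambda> * (\<phi>T lam + \<phi>M lam)"
        by (simp add: e_def power_add algebra_simps)
      finally show "2 * \<phi>T lam + 2 * d \<le> 4 ^ (CARD('n) + 2) * \<Lambda> * (\<phi>T lam + \<phi>M lam)"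
        by (simp add: d_def e_def)
    qed simp
    finally show "(\<integral>\<^sup>+x\<in>cell q - (\<Union>p\<in>ch. cell p). ennreal (norm (T (F k) x) * G x) \<partial>lebesgue)
      + (\<integral>\<^sup>+p. (\<integral>\<^sup>+x\<in>cell p. ennreal (norm (T (\<lambda>y. indicator (- dil 3 p) y *\<^sub>R F k y) x) * G x) \<partial>lebesgue) \<partial>count_space ch)
      \<le> ennreal (4 ^ (CARD('n) + 2) * \<Lambda> * (\<phi>T lam + \<phi>M lam)) * (Lp_mean r (dil 3 q) (\<lambda>y. norm (F k y))
        * Lp_mean s' (dil 3 q) G * ?\<mu> (dil 3 q))"
      by (simp add: A_def mult.assoc)
  qed
qed

end

end

section \<open>The sparse tree\<close>

context dyadic_grid
begin

primrec generation :: "(nat \<times> (int ^ 'n) \<Rightarrow> (nat \<times> (int ^ 'n)) set) \<Rightarrow> nat \<times> (int ^ 'n) \<Rightarrow> nat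
    \<Rightarrow> (nat \<times> (int ^ 'n)) set" where
  "generation ch q 0 = {q}"
| "generation ch q (Suc n) = (\<Union>p\<in>generation ch q n. ch p)"

text \<open>E q is q without the next generation. The unions of the generations are nested and each
  generation is a disjoint family, so these sets are pairwise disjoint; since the children fill at
  most half of q, at least half of q is kept.\<close>

proposition sparse_tree:
  fixes \<Phi> :: "nat \<times> (int ^ 'n) \<Rightarrow> real ^ 'n \<Rightarrow> ennreal"
  assumes sub: "\<And>p q. p \<in> ch q \<Longrightarrow> fst q < fst p \<and> cell p \<subseteq> cell q"
    and disj: "\<And>q. disjoint_family_on cell (ch q)"
    and half: "\<And>q. emeasure lebesgue (\<Union>p\<in>ch q. cell p) \<le> ennreal (1 / 2) * emeasure lebesgue (cell q)"
    and stop: "\<And>q x. x \<in> cell q \<Longrightarrow> x \<notin> (\<Union>p\<in>ch q. cell p) \<Longrightarrow> \<Phi> q x \<le> u q x"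
    and pass: "\<And>q p x. p \<in> ch q \<Longrightarrow> x \<in> cell p \<Longrightarrow> \<Phi> q x \<le> u q x + \<Phi> p x"
  obtains S E where "disjoint_family_on E S"
    "\<And>q. q \<in> S \<Longrightarrow> E q \<in> sets lebesgue \<and> E q \<subseteq> cell q \<and> ennreal (1 / 2) * emeasure lebesgue (cell q) \<le> emeasure lebesgue (E q)"
    "AE x in lebesgue. x \<in> cell q0 \<longrightarrow> \<Phi> q0 x \<le> (\<integral>\<^sup>+q. u q x * indicator (cell q) x \<partial>count_space S)"
proof -
  let ?\<mu> = "emeasure lebesgue"
  define gen where "gen = generation ch q0"
  have gen_0: "gen 0 = {q0}" and gen_Suc: "gen (Suc n) = (\<Union>p\<in>gen n. ch p)" for n
    by (simp_all add: gen_def)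
  define S where "S = (\<Union>n. gen n)"
  define U where "U n = (\<Union>q\<in>gen n. cell q)" for n
  have cnt: "countable I" for I :: "(nat \<times> (int ^ 'n)) set" by (rule countable_subset[OF subset_UNIV]) simp
  have UN_sets: "(\<Union>p\<in>I. cell p) \<in> sets lebesgue" for I by (intro sets.countable_UN' cnt) auto
  have U_sets[measurable]: "U n \<in> sets lebesgue" for n unfolding U_def by (rule UN_sets)
  have gen_disj: "disjoint_family_on cell (gen n)" for n
  proof (induction n)
    case 0
    then show ?case by (simp add: gen_0 disjoint_family_on_def)
  next
    case (Suc n)
    show ?case
      unfolding disjoint_family_on_def
    proof (intro ballI impI)
      fix p p' assume "p \<in> gen (Suc n)" "p' \<in> gen (Suc n)" and ne: "p \<noteq> p'"
      then obtain q q' where q: "q \<in> gen n" "p \<in> ch q" "q' \<in> gen n" "p' \<in> ch q'"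
        by (simp only: gen_Suc) blast
      show "cell p \<inter> cell p' = {}"
      proof (cases "q = q'")
        case True
        then show ?thesis using disj[of q] q ne by (simp add: disjoint_family_onD)
      next
        case False
        then have "cell q \<inter> cell q' = {}" using Suc q by (simp add: disjoint_family_onD)
        then show ?thesis using sub[OF q(2)] sub[OF q(4)] by blast
      qed
    qed
  qed
  have U_ch: "cell q \<inter> U (Suc n) = (\<Union>p\<in>ch q. cell p)" if q: "q \<in> gen n" for q n
  proof
    show "(\<Union>p\<in>ch q. cell p) \<subseteq> cell q \<inter> U (Suc n)"
      using sub q unfolding U_def gen_Suc by blast
    show "cell q \<inter> U (Suc n) \<subseteq> (\<Union>p\<in>ch q. cell p)"
    proof
      fix x assume x: "x \<in> cell q \<inter> U (Suc n)"
      then obtain q' p where p: "q' \<in> gen n" "p \<in> ch q'" "x \<in> cell p"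
        unfolding U_def gen_Suc by blast
      have "q = q'"
      proof (rule ccontr)
        assume "q \<noteq> q'"
        then have "cell q \<inter> cell q' = {}" using gen_disj[of n] q p by (simp add: disjoint_family_onD)
        then show False using x p sub[OF p(2)] by blast
      qed
      then show "x \<in> (\<Union>p\<in>ch q. cell p)" using p by blast
    qed
  qed
  have U_decreasing: "U (Suc n) \<subseteq> U n" for n
  proof
    fix x assume "x \<in> U (Suc n)"
    then obtain q p where "q \<in> gen n" "p \<in> ch q" "x \<in> cell p"
      unfolding U_def gen_Suc by blast
    then show "x \<in> U n" using sub unfolding U_def by blast
  qed
  have U_antimono: "U n \<subseteq> U k" if "k \<le> n" for k n
    using U_decreasing that by (rule lift_Suc_antimono_le)
  have \<mu>U: "?\<mu> (U n) \<le> ennreal ((1 / 2) ^ n) * ?\<mu> (cell q0)" for n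
  proof (induction n)
    case 0
    then show ?case by (simp add: U_def gen_0)
  next
    case (Suc n)
    have "U (Suc n) = (\<Union>q\<in>gen n. \<Union>p\<in>ch q. cell p)" unfolding U_def gen_Suc by blast
    then have "?\<mu> (U (Suc n)) \<le> (\<integral>\<^sup>+q. ?\<mu> (\<Union>p\<in>ch q. cell p) \<partial>count_space (gen n))"
      using emeasure_UN_countable_le[OF cnt, of "gen n" "\<lambda>q. \<Union>p\<in>ch q. cell p" lebesgue] UN_sets by simp
    also have "\<dots> \<le> (\<integral>\<^sup>+q. ennreal (1 / 2) * ?\<mu> (cell q) \<partial>count_space (gen n))"
      by (intro nn_integral_mono half)
    also have "\<dots> = ennreal (1 / 2) * (\<integral>\<^sup>+q. ?\<mu> (cell q) \<partial>count_space (gen n))"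
      by (intro nn_integral_cmult) simp
    also have "\<dots> \<le> ennreal (1 / 2) * ?\<mu> (U n)"
      by (intro mult_left_mono emeasure_disjoint_sum_le cnt gen_disj) (auto simp: U_def UN_sets)
    also have "\<dots> \<le> ennreal (1 / 2) * (ennreal ((1 / 2) ^ n) * ?\<mu> (cell q0))"
      by (intro mult_left_mono Suc) simp
    also have "\<dots> = ennreal ((1 / 2) ^ Suc n) * ?\<mu> (cell q0)"
      by (subst mult.assoc[symmetric], subst ennreal_mult[symmetric]) simp_all
    finally show ?case .
  qed
  have null: "(\<Inter>n. U n) \<in> null_sets lebesgue"
  proof -
    have "(\<lambda>n. ennreal ((1 / 2) ^ n) * ?\<mu> (cell q0)) \<longlonglongrightarrow> ennreal 0 * ?\<mu> (cell q0)"
      using cell_pos_finite(2)[of q0]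
      by (intro tendsto_mult_ennreal tendsto_const tendsto_ennrealI LIMSEQ_power_zero) auto
    moreover have "?\<mu> (\<Inter>n. U n) \<le> ennreal ((1 / 2) ^ n) * ?\<mu> (cell q0)" for n
      by (rule order_trans[OF emeasure_mono \<mu>U]) auto
    ultimately have "?\<mu> (\<Inter>n. U n) \<le> ennreal 0 * ?\<mu> (cell q0)"
      by (intro LIMSEQ_le_const) auto
    then show ?thesis by (auto intro!: null_setsI)
  qed
  \<comment> \<open>The least generation is taken, which fixes one without a discussion of
    uniqueness.\<close>
  define lev where "lev q = (LEAST n. q \<in> gen n)" for q
  have lev: "q \<in> gen (lev q)" if "q \<in> S" for q
    using that unfolding S_def lev_def by (auto intro: LeastI)
  define E where "E q = cell q - U (Suc (lev q))" for q
  have "disjoint_family_on E S"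
    unfolding disjoint_family_on_def
  proof (intro ballI impI)
    fix p q assume p: "p \<in> S" and q: "q \<in> S" and ne: "p \<noteq> q"
    have *: "E p' \<inter> E q' = {}" if "p' \<in> S" "q' \<in> S" "lev p' < lev q'" for p' q'
    proof -
      have "E q' \<subseteq> U (lev q')" using lev[OF that(2)] by (auto simp: E_def U_def)
      also have "\<dots> \<subseteq> U (Suc (lev p'))" using that(3) by (intro U_antimono) simp
      finally show ?thesis by (auto simp: E_def)
    qed
    show "E p \<inter> E q = {}"
    proof (cases "lev p = lev q")
      case True
      then have "cell p \<inter> cell q = {}"
        using lev[OF p] lev[OF q] ne gen_disj[of "lev q"] by (simp add: disjoint_family_onD)
      then show ?thesis by (auto simp: E_def)
    next
      case False
      then show ?thesis using *[OF p q] *[OF q p] by (cases "lev p < lev q") auto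
    qed
  qed
  moreover have "E q \<in> sets lebesgue \<and> E q \<subseteq> cell q \<and> ennreal (1 / 2) * ?\<mu> (cell q) \<le> ?\<mu> (E q)" if q: "q \<in> S" for q
  proof -
    have Es: "E q \<in> sets lebesgue" by (simp add: E_def)
    \<comment> \<open>Inside q the next generation consists of the children of q only, by
      \<open>U_ch\<close>.\<close>
    have "cell q = E q \<union> (\<Union>p\<in>ch q. cell p)"
      using U_ch[OF lev[OF q]] by (auto simp: E_def simp del: split_paired_Ex)
    then have "?\<mu> (cell q) \<le> ?\<mu> (E q) + ?\<mu> (\<Union>p\<in>ch q. cell p)"
      using Es UN_sets by (metis emeasure_subadditive)
    also have "\<dots> \<le> ?\<mu> (E q) + ennreal (1 / 2) * ?\<mu> (cell q)" by (intro add_left_mono half)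
    finally have *: "?\<mu> (cell q) \<le> ?\<mu> (E q) + ennreal (1 / 2) * ?\<mu> (cell q)" .
    have "?\<mu> (E q) < top" using cell_pos_finite(2)[of q] emeasure_mono[of "E q" "cell q" lebesgue]
      by (auto simp: E_def intro: le_less_trans)
    then obtain e where e: "?\<mu> (E q) = ennreal e" "0 \<le> e" by (cases "?\<mu> (E q)") auto
    obtain v where v: "?\<mu> (cell q) = ennreal v" "0 \<le> v" by (rule that[OF emeasure_cell]) simp
    have h: "ennreal (1 / 2) * ennreal v = ennreal (1 / 2 * v)"
      using v by (intro ennreal_mult[symmetric]) auto
    have "ennreal v \<le> ennreal (e + 1 / 2 * v)"
      using *[unfolded e(1) v(1) h] e(2) v(2) by (subst ennreal_plus) auto
    then have "v \<le> e + 1 / 2 * v" using e(2) v(2) by (subst (asm) ennreal_le_iff) auto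
    then have "ennreal (1 / 2 * v) \<le> ennreal e" by (intro ennreal_leI) simp
    then have "ennreal (1 / 2) * ?\<mu> (cell q) \<le> ?\<mu> (E q)" by (simp only: e(1) v(1) h)
    then show ?thesis using Es by (auto simp: E_def)
  qed
  moreover have "AE x in lebesgue. x \<in> cell q0 \<longrightarrow> \<Phi> q0 x \<le> (\<integral>\<^sup>+q. u q x * indicator (cell q) x \<partial>count_space S)"
    using AE_not_in[OF null]
  proof (rule eventually_mono, intro impI)
    fix x assume "x \<notin> (\<Inter>n. U n)" and x0: "x \<in> cell q0"
    then obtain j where j: "x \<notin> U (0 + j)" by auto
    let ?w = "\<lambda>p. u p x * indicator (cell p) x"
    \<comment> \<open>The sum is restricted to levels from that of q on. A child has a strictly
      larger level, so its sum omits q, and the term of q can be added without being counted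
      twice.\<close>
    have "\<Phi> q x \<le> (\<integral>\<^sup>+p. ?w p * indicator {p. fst q \<le> fst p} p \<partial>count_space S)"
      if "q \<in> gen n" "x \<in> cell q" "x \<notin> U (n + j)" for q n
      using that
    proof (induction j arbitrary: n q)
      \<comment> \<open>Vacuous: x lies in q, which belongs to generation n, while x avoids U
        n.\<close>
      case 0
      then show ?case by (auto simp: U_def)
    next
      case (Suc j)
      have qS: "q \<in> S" using Suc.prems by (auto simp: S_def)
      show ?case
      proof (cases "x \<in> (\<Union>p\<in>ch q. cell p)")
        case False
        have "\<Phi> q x \<le> ?w q * indicator {p. fst q \<le> fst p} q" using stop[OF Suc.prems(2) False] Suc.prems by simp
        also have "\<dots> \<le> (\<integral>\<^sup>+p. ?w p * indicator {p. fst q \<le> fst p} p \<partial>count_space S)"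
          by (rule nn_integral_ge_point[OF qS])
        finally show ?thesis .
      next
        case True
        then obtain p where p: "p \<in> ch q" "x \<in> cell p" by blast
        have "p \<in> gen (Suc n)" using p Suc.prems unfolding gen_Suc by blast
        then have IH: "\<Phi> p x \<le> (\<integral>\<^sup>+p'. ?w p' * indicator {p'. fst p \<le> fst p'} p' \<partial>count_space S)"
          using Suc.IH[of p "Suc n"] p Suc.prems by simp
        have lt: "fst q < fst p" using sub[OF p(1)] by simp
        have "\<Phi> q x \<le> u q x + \<Phi> p x" by (rule pass[OF p])
        also have "u q x = (\<integral>\<^sup>+p'. ?w p' * indicator {q} p' \<partial>count_space S)"
          using qS Suc.prems by (subst nn_integral_indicator_singleton) auto
        also have "\<dots> + \<Phi> p x \<le> \<dots> + (\<integral>\<^sup>+p'. ?w p' * indicator {p'. fst p \<le> fst p'} p' \<partial>count_space S)"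
          by (intro add_left_mono IH)
        also have "\<dots> = (\<integral>\<^sup>+p'. ?w p' * indicator {q} p' + ?w p' * indicator {p'. fst p \<le> fst p'} p' \<partial>count_space S)"
          by (subst nn_integral_add) auto
        also have "\<dots> \<le> (\<integral>\<^sup>+p'. ?w p' * indicator {p. fst q \<le> fst p} p' \<partial>count_space S)"
        proof (rule nn_integral_mono)
          fix p'
          show "?w p' * indicator {q} p' + ?w p' * indicator {p'. fst p \<le> fst p'} p' \<le> ?w p' * indicator {p. fst q \<le> fst p} p'"
            using lt by (cases "p' = q"; cases "fst p \<le> fst p'") auto
        qed
        finally show ?thesis .
      qed
    qed
    from this[of q0 0] have "\<Phi> q0 x \<le> (\<integral>\<^sup>+p. ?w p * indicator {p. fst q0 \<le> fst p} p \<partial>count_space S)"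
      using x0 j by (simp add: gen_0)
    also have "\<dots> \<le> (\<integral>\<^sup>+p. ?w p \<partial>count_space S)"
      by (intro nn_integral_mono) (auto simp: indicator_def)
    finally show "\<Phi> q0 x \<le> (\<integral>\<^sup>+q. u q x * indicator (cell q) x \<partial>count_space S)" .
  qed
  ultimately show thesis using that by blast
qed

end

section \<open>Mixed means and the local commutator\<close>

lemma borel_measurable_nn_integral_count_space:
  assumes I: "countable I" and f: "\<And>i. i \<in> I \<Longrightarrow> f i \<in> borel_measurable M"
  shows "(\<lambda>x. \<integral>\<^sup>+i. f i x \<partial>count_space I) \<in> borel_measurable M"
proof (cases "finite I")
  case True
  then show ?thesis using f by (simp add: nn_integral_count_space_finite)
next
  case False
  have "(\<integral>\<^sup>+i. f i x \<partial>count_space I) = (\<Sum>n. f (from_nat_into I n) x)" for x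
    using nn_integral_bij_count_space[OF bij_betw_from_nat_into[OF I False], of "\<lambda>i. f i x"]
    by (simp add: nn_integral_count_space_nat)
  moreover have "f (from_nat_into I n) \<in> borel_measurable M" for n
    using False by (intro f from_nat_into) auto
  ultimately show ?thesis by simp
qed

text \<open>The sparse form is an unordered sum. Every partial sum along an enumeration of I is
  among the finite sums whose supremum is \<open>infsum\<close>.\<close>

lemma nn_integral_count_space_le_infsum:
  fixes f :: "'a \<Rightarrow> ennreal"
  assumes I: "countable I"
  shows "(\<integral>\<^sup>+i. f i \<partial>count_space I) \<le> infsum f I"
proof (cases "finite I")
  case True
  then show ?thesis by (simp add: nn_integral_count_space_finite)
next
  case False
  have bij: "bij_betw (from_nat_into I) UNIV I" by (rule bij_betw_from_nat_into[OF I False])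
  have "(\<integral>\<^sup>+i. f i \<partial>count_space I) = (SUP n. \<Sum>k<n. f (from_nat_into I k))"
    using nn_integral_bij_count_space[OF bij, of f]
    by (simp add: nn_integral_count_space_nat suminf_eq_SUP)
  also have "\<dots> \<le> infsum f I"
  proof (rule SUP_least)
    fix n
    have "inj_on (from_nat_into I) {..<n}" using bij by (auto simp: bij_betw_def inj_on_def)
    then have "(\<Sum>k<n. f (from_nat_into I k)) = sum f (from_nat_into I ` {..<n})"
      by (simp add: sum.reindex)
    also have "\<dots> \<le> (SUP F\<in>{F. finite F \<and> F \<subseteq> I}. sum f F)"
      using bij by (intro SUP_upper) (auto simp: bij_betw_def)
    also have "\<dots> = infsum f I" by (intro nonneg_infsum_complete[symmetric]) simp
    finally show "(\<Sum>k<n. f (from_nat_into I k)) \<le> infsum f I" .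
  qed
  finally show ?thesis .
qed

section \<open>Weighted means and their interpolation\<close>

lemma Lp_mean_eq_0_iff:
  fixes h :: "real ^ 'n \<Rightarrow> real"
  assumes [measurable]: "Q \<in> sets lebesgue" "h \<in> borel_measurable lebesgue"
    and Q: "emeasure lebesgue Q < top"
  shows "Lp_mean p Q h = 0 \<longleftrightarrow> (AE x in lebesgue. x \<in> Q \<longrightarrow> h x = 0)"
proof -
  have "Lp_mean p Q h = 0 \<longleftrightarrow> (\<integral>\<^sup>+x\<in>Q. ennreal (h x powr p) \<partial>lebesgue) = 0"
    using Q by (auto simp: Lp_mean_def epowr_eq_0_iff)
  also have "\<dots> \<longleftrightarrow> (AE x in lebesgue. ennreal (h x powr p) * indicator Q x = 0)"
    by (intro nn_integral_0_iff_AE) simp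
  also have "\<dots> \<longleftrightarrow> (AE x in lebesgue. x \<in> Q \<longrightarrow> h x = 0)"
    by (intro eventually_subst always_eventually allI) (auto simp: indicator_def)
  finally show ?thesis .
qed

lemma Lp_mean_cmult:
  fixes h :: "real ^ 'n \<Rightarrow> real"
  assumes c: "0 < c" and p: "0 < p" and h: "\<And>x. 0 \<le> h x"
    and [measurable]: "Q \<in> sets lebesgue" "h \<in> borel_measurable lebesgue"
  shows "Lp_mean p Q (\<lambda>x. c * h x) = ennreal c * Lp_mean p Q h"
proof -
  have "(\<integral>\<^sup>+x\<in>Q. ennreal ((c * h x) powr p) \<partial>lebesgue)
      = (\<integral>\<^sup>+x. ennreal (c powr p) * (ennreal (h x powr p) * indicator Q x) \<partial>lebesgue)"
    using c h by (intro nn_integral_cong) (auto simp: powr_mult indicator_def ennreal_mult)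
  also have "\<dots> = ennreal (c powr p) * (\<integral>\<^sup>+x\<in>Q. ennreal (h x powr p) \<partial>lebesgue)"
    by (intro nn_integral_cmult) simp
  finally show ?thesis
    using c p by (simp add: Lp_mean_def epowr_mult powr_powr flip: ennreal_times_divide)
qed

text \<open>Minkowski's inequality up to a factor 2, from (u + v)^p <= 2^p (u^p + v^p) and the
  subadditivity of the power 1 / p.\<close>

lemma Lp_mean_add_le:
  fixes u v :: "real ^ 'n \<Rightarrow> real"
  assumes p: "1 \<le> p" and u: "\<And>x. 0 \<le> u x" and v: "\<And>x. 0 \<le> v x"
    and [measurable]: "Q \<in> sets lebesgue" "u \<in> borel_measurable lebesgue" "v \<in> borel_measurable lebesgue"
  shows "Lp_mean p Q (\<lambda>x. u x + v x) \<le> 2 * (Lp_mean p Q u + Lp_mean p Q v)"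
proof -
  let ?I = "\<lambda>h. \<integral>\<^sup>+x\<in>Q. ennreal (h x powr p) \<partial>lebesgue" and ?\<mu> = "emeasure lebesgue Q"
  have *: "(u x + v x) powr p \<le> 2 powr p * (u x powr p + v x powr p)" for x
  proof -
    have "(u x + v x) powr p \<le> (2 * max (u x) (v x)) powr p"
      using p u[of x] v[of x] by (intro powr_mono2) auto
    also have "\<dots> = 2 powr p * max (u x) (v x) powr p"
      using u[of x] v[of x] by (simp add: powr_mult max_def)
    also have "max (u x) (v x) powr p \<le> u x powr p + v x powr p"
      by (auto simp: max_def)
    finally show ?thesis by simp
  qed
  have "?I (\<lambda>x. u x + v x) \<le> (\<integral>\<^sup>+x. ennreal (2 powr p) * (ennreal (u x powr p) * indicator Q x + ennreal (v x powr p) * indicator Q x) \<partial>lebesgue)"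
    using * by (intro nn_integral_mono) (auto simp: indicator_def simp flip: ennreal_plus ennreal_mult)
  also have "\<dots> = ennreal (2 powr p) * (?I u + ?I v)"
    by (simp add: nn_integral_cmult nn_integral_add)
  finally have "?I (\<lambda>x. u x + v x) / ?\<mu> \<le> ennreal (2 powr p) * (?I u + ?I v) / ?\<mu>"
    by (rule divide_right_mono_ennreal)
  also have "\<dots> = ennreal (2 powr p) * (?I u / ?\<mu> + ?I v / ?\<mu>)"
    by (simp add: ennreal_times_divide[symmetric] add_divide_distrib_ennreal)
  finally have "Lp_mean p Q (\<lambda>x. u x + v x) \<le> epowr (ennreal (2 powr p) * (?I u / ?\<mu> + ?I v / ?\<mu>)) (1 / p)"
    unfolding Lp_mean_def using p by (intro epowr_mono) auto
  also have "\<dots> = 2 * epowr (?I u / ?\<mu> + ?I v / ?\<mu>) (1 / p)"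
    using p by (simp add: epowr_mult powr_powr)
  also have "\<dots> \<le> 2 * (Lp_mean p Q u + Lp_mean p Q v)"
    unfolding Lp_mean_def using p by (intro mult_left_mono epowr_add_le) auto
  finally show ?thesis .
qed

text \<open>Where \<beta> > t, the missing factor \<beta>^(m-k) is at least t^(m-k).\<close>

lemma power_interpolation:
  fixes \<beta> t :: real
  assumes "0 \<le> \<beta>" "0 < t" "k \<le> m"
  shows "\<beta> ^ k \<le> t ^ k + \<beta> ^ m / t ^ (m - k)"
proof (cases "\<beta> \<le> t")
  case True
  then have "\<beta> ^ k \<le> t ^ k" using assms by (intro power_mono)
  then show ?thesis using assms by (simp add: add_increasing2)
next
  case False
  then have "t ^ (m - k) * \<beta> ^ k \<le> \<beta> ^ (m - k) * \<beta> ^ k"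
    using assms by (intro mult_right_mono power_mono) auto
  also have "\<dots> = \<beta> ^ m" using assms by (simp flip: power_add)
  finally have "\<beta> ^ k \<le> \<beta> ^ m / t ^ (m - k)" using assms by (simp add: field_simps)
  then show ?thesis using assms by (simp add: add_increasing)
qed

lemma Lp_mean_interpolation:
  fixes \<beta> f :: "real ^ 'n \<Rightarrow> real"
  assumes p: "1 \<le> p" and t: "0 < t" and k: "k \<le> m" and \<beta>: "\<And>x. 0 \<le> \<beta> x" and f: "\<And>x. 0 \<le> f x"
    and [measurable]: "Q \<in> sets lebesgue" "\<beta> \<in> borel_measurable lebesgue" "f \<in> borel_measurable lebesgue"
  shows "Lp_mean p Q (\<lambda>x. \<beta> x ^ k * f x)
    \<le> 2 * (ennreal (t ^ k) * Lp_mean p Q f + ennreal (1 / t ^ (m - k)) * Lp_mean p Q (\<lambda>x. \<beta> x ^ m * f x))"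
proof -
  have "\<beta> x ^ k * f x \<le> t ^ k * f x + 1 / t ^ (m - k) * (\<beta> x ^ m * f x)" for x
    using mult_right_mono[OF power_interpolation[OF \<beta>[of x] t k] f[of x]] by (simp add: distrib_right)
  then have "Lp_mean p Q (\<lambda>x. \<beta> x ^ k * f x)
    \<le> Lp_mean p Q (\<lambda>x. t ^ k * f x + 1 / t ^ (m - k) * (\<beta> x ^ m * f x))"
    using p \<beta> f by (intro Lp_mean_mono) auto
  also have "\<dots> \<le> 2 * (Lp_mean p Q (\<lambda>x. t ^ k * f x) + Lp_mean p Q (\<lambda>x. 1 / t ^ (m - k) * (\<beta> x ^ m * f x)))"
    using p \<beta> f t by (intro Lp_mean_add_le) (auto intro!: mult_nonneg_nonneg)
  also have "\<dots> = 2 * (ennreal (t ^ k) * Lp_mean p Q f + ennreal (1 / t ^ (m - k)) * Lp_mean p Q (\<lambda>x. \<beta> x ^ m * f x))"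
    using p \<beta> f t by (subst (1 2) Lp_mean_cmult) auto
  finally show ?thesis .
qed

text \<open>The parameter \<open>t\<close> of the interpolation is chosen so that the two extreme terms of the
  product both equal the geometric mean of the two middle ones.\<close>

lemma mixed_means_le:
  fixes \<beta> f g :: "real ^ 'n \<Rightarrow> real"
  assumes p: "1 \<le> p" "1 \<le> q" and k: "k \<le> m" and \<beta>: "\<And>x. 0 \<le> \<beta> x"
    and f: "\<And>x. 0 \<le> f x" and g: "\<And>x. 0 \<le> g x" and Q: "emeasure lebesgue Q < top"
    and meas[measurable]: "Q \<in> sets lebesgue" "\<beta> \<in> borel_measurable lebesgue"
      "f \<in> borel_measurable lebesgue" "g \<in> borel_measurable lebesgue"
  shows "Lp_mean p Q (\<lambda>x. \<beta> x ^ k * f x) * Lp_mean q Q (\<lambda>x. \<beta> x ^ (m - k) * g x)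
    \<le> 16 * (Lp_mean p Q (\<lambda>x. \<beta> x ^ m * f x) * Lp_mean q Q g + Lp_mean p Q f * Lp_mean q Q (\<lambda>x. \<beta> x ^ m * g x))"
proof -
  let ?X = "\<lambda>k. Lp_mean p Q (\<lambda>x. \<beta> x ^ k * f x)" and ?Y = "\<lambda>k. Lp_mean q Q (\<lambda>x. \<beta> x ^ k * g x)"
  let ?X' = "Lp_mean p Q f" and ?Y' = "Lp_mean q Q g"
  have one: "x \<le> 16 * x" for x :: ennreal
    using mult_right_mono[of 1 16 x] by simp
  consider "k = 0" | "k = m" | "0 < k" "k < m" using k by linarith
  then have "?X k * ?Y (m - k) \<le> 16 * (?X m * ?Y' + ?X' * ?Y m)"
  proof cases
    case 1
    then show ?thesis using one[of "?X m * ?Y' + ?X' * ?Y m"] by (auto intro: order_trans[rotated] add_increasing)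
  next
    case 2
    then show ?thesis using one[of "?X m * ?Y' + ?X' * ?Y m"] by (auto intro: order_trans[rotated] add_increasing2)
  next
    case 3
    \<comment> \<open>If \<beta>^i h has mean zero, then \<beta> or h vanishes at almost every point
      of Q, and so does \<beta>^j h for j > 0. This is used with j = k and j = m - k, both positive
      in this case.\<close>
    have zero: "Lp_mean p' Q (\<lambda>x. \<beta> x ^ j * h x) = 0"
      if "0 < j" "Lp_mean p' Q (\<lambda>x. \<beta> x ^ i * h x) = 0" and [measurable]: "h \<in> borel_measurable lebesgue"
      for p' i j h
    proof -
      have "AE x in lebesgue. x \<in> Q \<longrightarrow> \<beta> x ^ i * h x = 0"
        using that Q by (subst (asm) Lp_mean_eq_0_iff) auto
      then have "AE x in lebesgue. x \<in> Q \<longrightarrow> \<beta> x ^ j * h x = 0"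
        using that(1) by (rule_tac eventually_mono) auto
      then show ?thesis using Q by (subst Lp_mean_eq_0_iff) auto
    qed
    consider "?X' = 0 \<or> ?X m = 0 \<or> ?Y' = 0 \<or> ?Y m = 0"
      | "?X' \<noteq> 0" "?X m \<noteq> 0" "?Y' \<noteq> 0" "?Y m \<noteq> 0" "?X' = top \<or> ?X m = top \<or> ?Y' = top \<or> ?Y m = top"
      | "?X' \<noteq> 0" "?X m \<noteq> 0" "?Y' \<noteq> 0" "?Y m \<noteq> 0" "?X' \<noteq> top" "?X m \<noteq> top" "?Y' \<noteq> top" "?Y m \<noteq> top"
      by blast
    then show ?thesis
    proof cases
      case 1
      then have "?X k = 0 \<or> ?Y (m - k) = 0"
        using zero[of k p 0 f] zero[of k p m f] zero[of "m - k" q 0 g] zero[of "m - k" q m g] 3 meas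
        by auto
      then show ?thesis by auto
    next
      case 2
      \<comment> \<open>No factor vanishes any more, so an infinite one makes the sum
        infinite.\<close>
      then have "?X m * ?Y' + ?X' * ?Y m = top"
        by (auto simp: ennreal_mult_eq_top_iff)
      moreover have "16 * (top :: ennreal) = top" by (simp add: ennreal_mult_top)
      ultimately show ?thesis by (simp only: top_greatest)
    next
      case 3: 3
      define x0 x1 y0 y1 where "x0 = enn2real ?X'" and "x1 = enn2real (?X m)"
        and "y0 = enn2real ?Y'" and "y1 = enn2real (?Y m)"
      have pos: "0 < x0" "0 < x1" "0 < y0" "0 < y1"
        using 3 by (simp_all add: x0_def x1_def y0_def y1_def enn2real_positive_iff less_top zero_less_iff_neq_zero)
      have X: "?X' = ennreal x0" "?X m = ennreal x1" "?Y' = ennreal y0" "?Y m = ennreal y1"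
        using 3 by (simp_all add: x0_def x1_def y0_def y1_def less_top)
      define a where "a = x1 * y0 + x0 * y1"
      define t where "t = ((x1 * y1) / (x0 * y0)) powr (1 / (2 * real m))"
      have t: "0 < t" unfolding t_def using pos by simp
      have nonneg: "0 \<le> t ^ j" "0 \<le> 1 / t ^ j" "0 \<le> x0" "0 \<le> x1" "0 \<le> y0" "0 \<le> y1" "0 \<le> (2::real)" for j
        using t pos by auto
      note to_ennreal = ennreal_mult ennreal_plus mult_nonneg_nonneg add_nonneg_nonneg nonneg ennreal_numeral
      have m: "0 < m" using \<open>k < m\<close> by simp
      have tm: "t ^ m = sqrt ((x1 * y1) / (x0 * y0))"
        using t pos m by (simp add: t_def powr_realpow[symmetric] powr_powr powr_half_sqrt)
      have sq: "t ^ m * (x0 * y0) \<le> a" "1 / t ^ m * (x1 * y1) \<le> a"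
      proof -
        have "(t ^ m * (x0 * y0))\<^sup>2 = (x1 * y0) * (x0 * y1)" "(1 / t ^ m * (x1 * y1))\<^sup>2 = (x1 * y0) * (x0 * y1)"
          unfolding power_mult_distrib power_divide tm using pos
          by (simp_all add: power2_eq_square)
        moreover have "(x1 * y0) * (x0 * y1) \<le> a\<^sup>2"
          using pos by (simp add: a_def power2_eq_square algebra_simps add_pos_pos less_imp_le)
        moreover have "0 \<le> a" using pos by (simp add: a_def less_imp_le)
        ultimately show "t ^ m * (x0 * y0) \<le> a" "1 / t ^ m * (x1 * y1) \<le> a"
          by (auto intro: power2_le_imp_le)
      qed
      have "?X k \<le> 2 * (ennreal (t ^ k) * ?X' + ennreal (1 / t ^ (m - k)) * ?X m)"
        by (intro Lp_mean_interpolation p t k \<beta> f meas)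
      also have "\<dots> = ennreal (2 * (t ^ k * x0 + 1 / t ^ (m - k) * x1))"
        by (simp only: X to_ennreal)
      finally have Xk: "?X k \<le> ennreal (2 * (t ^ k * x0 + 1 / t ^ (m - k) * x1))" .
      have "?Y (m - k) \<le> 2 * (ennreal (t ^ (m - k)) * ?Y' + ennreal (1 / t ^ (m - (m - k))) * ?Y m)"
        by (intro Lp_mean_interpolation p t \<beta> g meas) simp
      also have "\<dots> = ennreal (2 * (t ^ (m - k) * y0 + 1 / t ^ k * y1))"
        using k by (simp only: X to_ennreal diff_diff_cancel)
      finally have Yk: "?Y (m - k) \<le> ennreal (2 * (t ^ (m - k) * y0 + 1 / t ^ k * y1))" .
      have "?X k * ?Y (m - k) \<le> ennreal (2 * (t ^ k * x0 + 1 / t ^ (m - k) * x1))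
          * ennreal (2 * (t ^ (m - k) * y0 + 1 / t ^ k * y1))"
        by (intro mult_mono Xk Yk) auto
      also have "\<dots> = ennreal (2 * (t ^ k * x0 + 1 / t ^ (m - k) * x1) * (2 * (t ^ (m - k) * y0 + 1 / t ^ k * y1)))"
        using t pos by (subst ennreal_mult) auto
      also have "\<dots> \<le> ennreal (16 * a)"
      proof (rule ennreal_leI)
        have tk: "t ^ m = t ^ k * t ^ (m - k)" using k by (simp flip: power_add)
        \<comment> \<open>In the two cross terms the powers of t cancel, so together they are
          exactly a.\<close>
        have "2 * (t ^ k * x0 + 1 / t ^ (m - k) * x1) * (2 * (t ^ (m - k) * y0 + 1 / t ^ k * y1))
          = 4 * (t ^ m * (x0 * y0) + a + 1 / t ^ m * (x1 * y1))"
          unfolding tk a_def using t by (simp add: field_simps)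
        also have "\<dots> \<le> 4 * (a + a + a)" using sq by (intro mult_left_mono add_mono) auto
        also have "\<dots> \<le> 16 * a" using pos by (simp add: a_def)
        finally show "2 * (t ^ k * x0 + 1 / t ^ (m - k) * x1) * (2 * (t ^ (m - k) * y0 + 1 / t ^ k * y1)) \<le> 16 * a" .
      qed
      also have "\<dots> = 16 * (?X m * ?Y' + ?X' * ?Y m)"
        unfolding X a_def using pos by (simp add: ennreal_mult ennreal_plus)
      finally show ?thesis .
    qed
  qed
  then show ?thesis .
qed

section \<open>Expansion of the commutator on one cube\<close>

context weak_operator
begin

lemma T_linear_combination:
  assumes "finite I" "\<And>i. i \<in> I \<Longrightarrow> H i \<in> Lp_c r"
  shows "norm (T (\<lambda>y. \<Sum>i\<in>I. c i * H i y) x) \<le> (\<Sum>i\<in>I. norm (c i) * norm (T (H i) x))"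
proof -
  have "norm (T (\<lambda>y. \<Sum>i\<in>I. c i * H i y) x) \<le> (\<Sum>i\<in>I. norm (T (\<lambda>y. c i * H i y) x))"
    by (intro T_sum assms Lp_c_cmult r_pos)
  also have "\<dots> = (\<Sum>i\<in>I. norm (c i) * norm (T (H i) x))"
    using assms by (intro sum.cong) (auto simp: T_cmult)
  finally show ?thesis .
qed

end

text \<open>A binomial expansion gives a linear combination of the b^j f with j <= k. The constant c
  may be any number, in particular a value b(x).\<close>

lemma Lp_c_shifted_power:
  fixes b f :: "real ^ 'n \<Rightarrow> 'k::{real_normed_field, second_countable_topology}"
  assumes p: "0 < p" and b: "\<And>k. k \<le> m \<Longrightarrow> (\<lambda>y. b y ^ k * f y) \<in> Lp_c p" and k: "k \<le> m"
  shows "(\<lambda>y. (c - b y) ^ k * f y) \<in> Lp_c p"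
proof -
  have "(c - b y) ^ k * f y = (\<Sum>j\<le>k. (of_nat (k choose j) * (-1) ^ j * c ^ (k - j)) * (b y ^ j * f y))" for y
  proof -
    have "(c - b y) ^ k = (\<Sum>j\<le>k. of_nat (k choose j) * (- b y) ^ j * c ^ (k - j))"
      using binomial_ring[of "- b y" c k] by (simp add: add.commute)
    also have "\<dots> * f y = (\<Sum>j\<le>k. (of_nat (k choose j) * (-1) ^ j * c ^ (k - j)) * (b y ^ j * f y))"
      unfolding sum_distrib_right by (intro sum.cong) (auto simp: power_minus[of "b y"])
    finally show ?thesis .
  qed
  then show ?thesis
    using k p by (simp only:) (intro Lp_c_sum Lp_c_cmult b; simp)
qed


context sparse_setup
begin

definition local_commutator :: "nat \<Rightarrow> (real ^ 'n \<Rightarrow> 'k) \<Rightarrow> (real ^ 'n \<Rightarrow> 'k) \<Rightarrow> nat \<times> (int ^ 'n)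
    \<Rightarrow> real ^ 'n \<Rightarrow> ennreal" where
  "local_commutator m b f q x = ennreal (norm (T (\<lambda>y. indicator (dil 3 q) y *\<^sub>R ((b x - b y) ^ m * f y)) x))"

text \<open>The bound produced by expanding the commutator around c: k powers of b - c stay with f
  inside T, the other m - k fall on g.\<close>

definition mixed_form :: "nat \<Rightarrow> (real ^ 'n \<Rightarrow> 'k) \<Rightarrow> (real ^ 'n \<Rightarrow> 'k) \<Rightarrow> (real ^ 'n \<Rightarrow> 'k)
    \<Rightarrow> nat \<times> (int ^ 'n) \<Rightarrow> 'k \<Rightarrow> ennreal" where
  "mixed_form m b f g q c = (\<Sum>k\<le>m. ennreal (real (m choose k)) *
     (Lp_mean r (dil 3 q) (\<lambda>y. norm (b y - c) ^ k * norm (f y))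
      * Lp_mean s' (dil 3 q) (\<lambda>y. norm (b y - c) ^ (m - k) * norm (g y)) * emeasure lebesgue (dil 3 q)))"

text \<open>An existence claim for one q and any c, so that choice can later produce all children
  and all u, with c depending on q. Here u(x) is the sum over k of a binomial coefficient times
  |b(x) - c|^(m-k) times the error for F k: on the stopped part of q this error is T (F k), on a
  child p it is T of the part of F k outside 3p.\<close>

lemma commutator_step:
  fixes m :: nat and lam \<Lambda> :: real and b f g :: "real ^ 'n \<Rightarrow> 'k"
    and q :: "nat \<times> (int ^ 'n)" and c :: 'k
  assumes lam: "lam = 1 / ((real m + 1) * 3 ^ CARD('n) * 2 ^ (CARD('n) + 6))"
    and \<Lambda>: "\<Lambda> = (real m + 1) * 15 ^ CARD('n) * 2 ^ (CARD('n) + 5)"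
    and b: "b \<in> borel_measurable lebesgue" and g: "g \<in> borel_measurable lebesgue"
    and bf: "\<And>k. k \<le> m \<Longrightarrow> (\<lambda>y. b y ^ k * f y) \<in> Lp_c r"
  shows "\<exists>ch u. (\<forall>p\<in>ch. fst q < fst p \<and> cell p \<subseteq> cell q) \<and> disjoint_family_on cell ch \<and>
    emeasure lebesgue (\<Union>p\<in>ch. cell p) \<le> ennreal (1 / 2) * emeasure lebesgue (cell q) \<and>
    (\<forall>x\<in>cell q - (\<Union>p\<in>ch. cell p). local_commutator m b f q x \<le> u x) \<and>
    (\<forall>p\<in>ch. \<forall>x\<in>cell p. local_commutator m b f q x \<le> u x + local_commutator m b f p x) \<and>
    u \<in> borel_measurable lebesgue \<and>
    (\<integral>\<^sup>+x. u x * ennreal (norm (g x)) \<partial>lebesgue)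
      \<le> ennreal (4 ^ (CARD('n) + 2) * \<Lambda> * (\<phi>T lam + \<phi>M lam)) * mixed_form m b f g q c"
proof -
  note b[measurable] g[measurable]
  define F where "F k = (\<lambda>y. indicator (dil 3 q) y *\<^sub>R ((c - b y) ^ k * f y))" for k
  have F: "F k \<in> Lp_c r" if "k \<le> m" for k
    unfolding F_def using that by (intro Lp_c_indicator Lp_c_shifted_power[of r m] bf r_pos) auto
  have F_supp: "F k x = 0" if "x \<notin> dil 3 q" for k x using that by (simp add: F_def)
  define Fp where "Fp k p = (\<lambda>y. indicator (- dil 3 p) y *\<^sub>R F k y)" for k p
  have compl: "- dil 3 p \<in> sets lebesgue" for p
    using sets.compl_sets[OF dil_sets[of 3 p]] by (simp add: Compl_eq_Diff_UNIV)
  have Fp: "Fp k p \<in> Lp_c r" if "k \<le> m" for k p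
    unfolding Fp_def using that compl by (intro Lp_c_indicator F r_pos)
  obtain ch where ch: "\<And>p. p \<in> ch \<Longrightarrow> fst q < fst p \<and> cell p \<subseteq> cell q"
    "disjoint_family_on cell ch"
    "emeasure lebesgue (\<Union>p\<in>ch. cell p) \<le> ennreal (1 / 2) * emeasure lebesgue (cell q)"
    and est: "\<And>k (G :: real ^ 'n \<Rightarrow> real). k \<le> m \<Longrightarrow> G \<in> borel_measurable lebesgue \<Longrightarrow> (\<And>x. 0 \<le> G x) \<Longrightarrow>
      (\<integral>\<^sup>+x\<in>cell q - (\<Union>p\<in>ch. cell p). ennreal (norm (T (F k) x) * G x) \<partial>lebesgue)
      + (\<integral>\<^sup>+p. (\<integral>\<^sup>+x\<in>cell p. ennreal (norm (T (Fp k p) x) * G x) \<partial>lebesgue) \<partial>count_space ch)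
      \<le> ennreal (4 ^ (CARD('n) + 2) * \<Lambda> * (\<phi>T lam + \<phi>M lam)) * (Lp_mean r (dil 3 q) (\<lambda>y. norm (F k y))
        * Lp_mean s' (dil 3 q) G * emeasure lebesgue (dil 3 q))"
    unfolding Fp_def by (rule stopping_family[OF lam \<Lambda> F F_supp]) blast+
  have cnt: "countable ch" by (rule countable_subset[OF subset_UNIV]) simp
  define E where "E = cell q - (\<Union>p\<in>ch. cell p)"
  have E[measurable]: "E \<in> sets lebesgue"
    unfolding E_def using cnt by (intro sets.Diff sets.countable_UN') auto
  define w where "w k x = ennreal (norm (T (F k) x)) * indicator E x
    + (\<integral>\<^sup>+p. ennreal (norm (T (Fp k p) x)) * indicator (cell p) x \<partial>count_space ch)" for k x
  define \<gamma> where "\<gamma> k x = real (m choose k) * norm (b x - c) ^ (m - k)" for k x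
  define u where "u x = (\<Sum>k\<le>m. ennreal (\<gamma> k x) * w k x)" for x
  have TF[measurable]: "T (F k) \<in> borel_measurable lebesgue" if "k \<le> m" for k
    by (intro T_measurable F that)
  have TFp[measurable]: "T (Fp k p) \<in> borel_measurable lebesgue" if "k \<le> m" for k p
    by (intro T_measurable Fp that)
  have count_meas: "(\<lambda>x. \<integral>\<^sup>+p. ennreal (norm (T (Fp k p) x)) * indicator (cell p) x \<partial>count_space ch) \<in> borel_measurable lebesgue"
    if "k \<le> m" for k
  proof (intro borel_measurable_nn_integral_count_space cnt)
    fix p
    have "T (Fp k p) \<in> borel_measurable lebesgue" by (rule TFp[OF that])
    then show "(\<lambda>x. ennreal (norm (T (Fp k p) x)) * indicator (cell p) x) \<in> borel_measurable lebesgue"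
      by simp
  qed
  have w_meas: "w k \<in> borel_measurable lebesgue" if "k \<le> m" for k
    unfolding w_def[abs_def] using TF[OF that] count_meas[OF that] by measurable
  have u_meas: "u \<in> borel_measurable lebesgue"
    unfolding u_def[abs_def] \<gamma>_def using w_meas by (intro borel_measurable_sum borel_measurable_times_ennreal) auto
  define h where "h x = (\<lambda>y. indicator (dil 3 q) y *\<^sub>R ((b x - b y) ^ m * f y))" for x
  \<comment> \<open>Coefficients of the m-th power of (c - b(y)) + (b(x) - c). For fixed x they are
    constants, so T with its pointwise homogeneity releases them.\<close>
  define coef where "coef x k = of_nat (m choose k) * (b x - c) ^ (m - k)" for x k
  have norm_coef: "norm (coef x k) = \<gamma> k x" for x k
    by (simp add: coef_def \<gamma>_def norm_mult norm_power)
  have h_eq: "h x y = (\<Sum>k\<le>m. coef x k * F k y)" for x y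
  proof -
    have "(b x - b y) ^ m = (\<Sum>k\<le>m. of_nat (m choose k) * (c - b y) ^ k * (b x - c) ^ (m - k))"
      using binomial_ring[of "c - b y" "b x - c" m] by simp
    then have "h x y = (\<Sum>k\<le>m. indicator (dil 3 q) y *\<^sub>R (of_nat (m choose k) * (c - b y) ^ k * (b x - c) ^ (m - k) * f y))"
      by (simp add: h_def sum_distrib_right scaleR_sum_right)
    also have "\<dots> = (\<Sum>k\<le>m. coef x k * F k y)"
      by (intro sum.cong) (auto simp: coef_def F_def mult_ac)
    finally show ?thesis .
  qed
  have h_Lp: "h x \<in> Lp_c r" for x
    unfolding h_def by (intro Lp_c_indicator Lp_c_shifted_power[of r m] bf r_pos) auto
  have stop: "local_commutator m b f q x \<le> u x" if "x \<in> E" for x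
  proof -
    have "norm (T (h x) x) \<le> (\<Sum>k\<le>m. norm (coef x k) * norm (T (F k) x))"
      using T_linear_combination[of "{..m}" F "coef x" x] F by (simp add: h_eq[abs_def])
    then have "local_commutator m b f q x \<le> ennreal (\<Sum>k\<le>m. \<gamma> k x * norm (T (F k) x))"
      unfolding local_commutator_def h_def norm_coef by (rule ennreal_leI)
    also have "\<dots> = (\<Sum>k\<le>m. ennreal (\<gamma> k x) * ennreal (norm (T (F k) x)))"
      by (subst sum_ennreal[symmetric]) (auto simp: \<gamma>_def ennreal_mult)
    also have "\<dots> \<le> u x"
      unfolding u_def w_def using that by (intro sum_mono mult_left_mono) auto
    finally show ?thesis .
  qed
  have pass: "local_commutator m b f q x \<le> u x + local_commutator m b f p x" if p: "p \<in> ch" "x \<in> cell p" for p x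
  proof -
    have sub: "dil 3 p \<subseteq> dil 3 q" using ch(1)[OF p(1)] by (intro dil_mono) auto
    \<comment> \<open>As \<open>dil 3 p\<close> lies in \<open>dil 3 q\<close>, the inner part is
      exactly the argument of the commutator localised to p; the outer part is again a combination
      of functions independent of x.\<close>
    define h1 h2 where "h1 = (\<lambda>y. indicator (dil 3 p) y *\<^sub>R h x y)" and "h2 = (\<lambda>y. indicator (- dil 3 p) y *\<^sub>R h x y)"
    have h12: "h1 \<in> Lp_c r" "h2 \<in> Lp_c r" unfolding h1_def h2_def
      by (intro Lp_c_indicator h_Lp r_pos compl dil_sets)+
    have "h x = (\<lambda>y. h2 y + h1 y)" by (auto simp: h1_def h2_def indicator_def)
    then have "norm (T (h x) x) \<le> norm (T h2 x) + norm (T h1 x)"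
      using T_add[OF h12(2,1), of x] by simp
    also have "h2 = (\<lambda>y. \<Sum>k\<le>m. coef x k * Fp k p y)"
      by (auto simp: h2_def h_eq Fp_def scaleR_sum_right intro!: sum.cong)
    also have "norm (T \<dots> x) \<le> (\<Sum>k\<le>m. norm (coef x k) * norm (T (Fp k p) x))"
      using Fp by (intro T_linear_combination) auto
    also have "h1 = (\<lambda>y. indicator (dil 3 p) y *\<^sub>R ((b x - b y) ^ m * f y))"
    proof
      fix y
      show "h1 y = indicator (dil 3 p) y *\<^sub>R ((b x - b y) ^ m * f y)"
        using sub by (cases "y \<in> dil 3 p") (auto simp: h1_def h_def)
    qed
    finally have "local_commutator m b f q x \<le> ennreal ((\<Sum>k\<le>m. \<gamma> k x * norm (T (Fp k p) x))
        + norm (T (\<lambda>y. indicator (dil 3 p) y *\<^sub>R ((b x - b y) ^ m * f y)) x))"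
      unfolding local_commutator_def h_def norm_coef by (intro ennreal_leI) simp
    also have "\<dots> = (\<Sum>k\<le>m. ennreal (\<gamma> k x) * ennreal (norm (T (Fp k p) x))) + local_commutator m b f p x"
      unfolding local_commutator_def
      by (subst ennreal_plus) (auto simp: \<gamma>_def ennreal_mult sum_nonneg simp flip: sum_ennreal)
    also have "(\<Sum>k\<le>m. ennreal (\<gamma> k x) * ennreal (norm (T (Fp k p) x))) \<le> u x"
      unfolding u_def
    proof (intro sum_mono mult_left_mono)
      fix k
      have "ennreal (norm (T (Fp k p) x)) = ennreal (norm (T (Fp k p) x)) * indicator (cell p) x"
        using p by simp
      also have "\<dots> \<le> (\<integral>\<^sup>+p. ennreal (norm (T (Fp k p) x)) * indicator (cell p) x \<partial>count_space ch)"
        by (rule nn_integral_ge_point[OF p(1)])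
      also have "\<dots> \<le> w k x" by (simp add: w_def)
      finally show "ennreal (norm (T (Fp k p) x)) \<le> w k x" .
    qed simp
    finally show ?thesis by (simp add: add_right_mono)
  qed
  define K where "K = ennreal (4 ^ (CARD('n) + 2) * \<Lambda> * (\<phi>T lam + \<phi>M lam))"
  have "(\<integral>\<^sup>+x. u x * ennreal (norm (g x)) \<partial>lebesgue)
    = (\<integral>\<^sup>+x. (\<Sum>k\<le>m. ennreal (real (m choose k)) * (w k x * ennreal (norm (b x - c) ^ (m - k) * norm (g x)))) \<partial>lebesgue)"
    by (intro nn_integral_cong) (simp add: u_def \<gamma>_def sum_distrib_left sum_distrib_right ennreal_mult mult_ac)
  also have "\<dots> = (\<Sum>k\<le>m. ennreal (real (m choose k)) * (\<integral>\<^sup>+x. w k x * ennreal (norm (b x - c) ^ (m - k) * norm (g x)) \<partial>lebesgue))"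
    using w_meas by (subst nn_integral_sum) (auto intro!: sum.cong nn_integral_cmult)
  also have "\<dots> \<le> (\<Sum>k\<le>m. ennreal (real (m choose k)) * (K * (Lp_mean r (dil 3 q) (\<lambda>y. norm (b y - c) ^ k * norm (f y))
      * Lp_mean s' (dil 3 q) (\<lambda>y. norm (b y - c) ^ (m - k) * norm (g y)) * emeasure lebesgue (dil 3 q))))"
  proof (intro sum_mono mult_left_mono)
    fix k assume "k \<in> {..m}"
    then have k: "k \<le> m" by simp
    note TF[OF k, measurable] TFp[OF k, measurable] count_meas[OF k, measurable]
    define G where "G x = norm (b x - c) ^ (m - k) * norm (g x)" for x
    have G[measurable]: "G \<in> borel_measurable lebesgue" and G0: "0 \<le> G x" for x
      by (auto simp: G_def[abs_def] G_def)
    have "(\<integral>\<^sup>+x. w k x * ennreal (G x) \<partial>lebesgue)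
      = (\<integral>\<^sup>+x. ennreal (norm (T (F k) x) * G x) * indicator E x
        + (\<integral>\<^sup>+p. ennreal (norm (T (Fp k p) x) * G x) * indicator (cell p) x \<partial>count_space ch) \<partial>lebesgue)"
      by (intro nn_integral_cong)
        (simp add: w_def distrib_left distrib_right G0 ennreal_mult mult_ac nn_integral_cmult)
    also have "\<dots> = (\<integral>\<^sup>+x\<in>E. ennreal (norm (T (F k) x) * G x) \<partial>lebesgue)
        + (\<integral>\<^sup>+x. \<integral>\<^sup>+p. ennreal (norm (T (Fp k p) x) * G x) * indicator (cell p) x \<partial>count_space ch \<partial>lebesgue)"
      by (intro nn_integral_add borel_measurable_nn_integral_count_space cnt) measurable
    also have "(\<integral>\<^sup>+x. \<integral>\<^sup>+p. ennreal (norm (T (Fp k p) x) * G x) * indicator (cell p) x \<partial>count_space ch \<partial>lebesgue)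
      = (\<integral>\<^sup>+p. (\<integral>\<^sup>+x\<in>cell p. ennreal (norm (T (Fp k p) x) * G x) \<partial>lebesgue) \<partial>count_space ch)"
      by (intro nn_integral_count_space_nn_integral cnt) measurable
    also have "(\<integral>\<^sup>+x\<in>E. ennreal (norm (T (F k) x) * G x) \<partial>lebesgue) + \<dots>
      \<le> K * (Lp_mean r (dil 3 q) (\<lambda>y. norm (F k y)) * Lp_mean s' (dil 3 q) G * emeasure lebesgue (dil 3 q))"
      unfolding K_def E_def by (rule est[OF k G G0])
    also have "Lp_mean r (dil 3 q) (\<lambda>y. norm (F k y)) = Lp_mean r (dil 3 q) (\<lambda>y. norm (b y - c) ^ k * norm (f y))"
      by (intro Lp_mean_cong) (simp add: F_def norm_mult norm_power norm_minus_commute)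
    finally show "(\<integral>\<^sup>+x. w k x * ennreal (norm (b x - c) ^ (m - k) * norm (g x)) \<partial>lebesgue)
      \<le> K * (Lp_mean r (dil 3 q) (\<lambda>y. norm (b y - c) ^ k * norm (f y))
      * Lp_mean s' (dil 3 q) (\<lambda>y. norm (b y - c) ^ (m - k) * norm (g y)) * emeasure lebesgue (dil 3 q))"
      by (simp add: G_def[abs_def])
  qed simp
  also have "\<dots> = K * mixed_form m b f g q c"
    by (simp add: mixed_form_def sum_distrib_left mult_ac)
  finally have int: "(\<integral>\<^sup>+x. u x * ennreal (norm (g x)) \<partial>lebesgue) \<le> K * mixed_form m b f g q c" .
  show ?thesis
    using ch stop pass u_meas int unfolding E_def K_def by (intro exI[of _ ch] exI[of _ u]) blast
qed

end

section \<open>Sparse domination\<close>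

context sparse_setup
begin

text \<open>Interpolation bounds each of the m + 1 terms by the same pair of extreme ones, and the
  binomial coefficients add up to 2^m.\<close>

lemma mixed_form_le:
  fixes m :: nat and b f g :: "real ^ 'n \<Rightarrow> 'k" and c :: 'k
  assumes [measurable]: "b \<in> borel_measurable lebesgue" "f \<in> borel_measurable lebesgue" "g \<in> borel_measurable lebesgue"
  shows "mixed_form m b f g q c \<le> ennreal (16 * 2 ^ m) *
    (Lp_mean r (dil 3 q) (\<lambda>x. norm (b x - c) ^ m * norm (f x)) * Lp_mean s' (dil 3 q) (\<lambda>x. norm (g x)) * emeasure lebesgue (dil 3 q)
     + Lp_mean r (dil 3 q) (\<lambda>x. norm (f x)) * Lp_mean s' (dil 3 q) (\<lambda>x. norm (b x - c) ^ m * norm (g x)) * emeasure lebesgue (dil 3 q))"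
    (is "_ \<le> _ * (?A * ?\<mu> + ?B * ?\<mu>)")
proof -
  have "mixed_form m b f g q c \<le> (\<Sum>k\<le>m. ennreal (real (m choose k)) * (16 * (?A + ?B) * ?\<mu>))"
    unfolding mixed_form_def using r s'_ge_1 dil_pos_finite[of 3 q]
    by (intro sum_mono mult_left_mono mult_right_mono mixed_means_le) auto
  also have "\<dots> = (\<Sum>k\<le>m. ennreal (real (m choose k))) * (16 * (?A + ?B) * ?\<mu>)"
    by (simp only: sum_distrib_right)
  also have "(\<Sum>k\<le>m. ennreal (real (m choose k))) = ennreal (2 ^ m)"
  proof -
    have "(\<Sum>k\<le>m. ennreal (real (m choose k))) = ennreal (real (\<Sum>k\<le>m. m choose k))"
      by (subst sum_ennreal) auto
    then show ?thesis by (simp add: choose_row_sum)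
  qed
  also have "ennreal (2 ^ m) * (16 * (?A + ?B) * ?\<mu>) = ennreal (16 * 2 ^ m) * (?A * ?\<mu> + ?B * ?\<mu>)"
    by (subst ennreal_mult) (simp_all add: algebra_simps)
  finally show ?thesis .
qed

lemma sparse_domination:
  fixes m :: nat and b f g :: "real ^ 'n \<Rightarrow> 'k"
  assumes lam: "lam = 1 / ((real m + 1) * 3 ^ CARD('n) * 2 ^ (CARD('n) + 6))"
    and \<Lambda>: "\<Lambda> = (real m + 1) * 15 ^ CARD('n) * 2 ^ (CARD('n) + 5)"
    and b: "b \<in> borel_measurable lebesgue" and g: "g \<in> borel_measurable lebesgue"
    and bf: "\<And>k. k \<le> m \<Longrightarrow> (\<lambda>y. b y ^ k * f y) \<in> Lp_c r"
  obtains \<S> where "sparse_cubes (1 / (2 * 3 ^ CARD('n))) \<S>"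
    "(\<integral>\<^sup>+x\<in>cell q0. local_commutator m b f q0 x * ennreal (norm (g x)) \<partial>lebesgue)
      \<le> ennreal (16 * 2 ^ m * 4 ^ (CARD('n) + 2) * \<Lambda> * (\<phi>T lam + \<phi>M lam)) * sparse_form m r s \<S> b f g"
proof -
  note b[measurable] g[measurable]
  have f[measurable]: "f \<in> borel_measurable lebesgue" using bf[of 0] by (simp add: Lp_c_iff)
  define K where "K = 4 ^ (CARD('n) + 2) * \<Lambda> * (\<phi>T lam + \<phi>M lam)"
  have "0 < lam" "lam < 1" "1 \<le> \<Lambda>" using lam_bounds[OF lam \<Lambda>] by auto
  then have K0: "0 \<le> K" using \<phi>_nonneg[of lam] by (simp add: K_def)
  \<comment> \<open>The mean is taken over the dilate, which is the cube that enters the sparse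
    family, and not over the cell.\<close>
  let ?c = "\<lambda>q. mean b (dil 3 q)" and ?\<mu> = "emeasure lebesgue"
  have "\<forall>q. \<exists>ch u. (\<forall>p\<in>ch. fst q < fst p \<and> cell p \<subseteq> cell q) \<and> disjoint_family_on cell ch \<and>
    ?\<mu> (\<Union>p\<in>ch. cell p) \<le> ennreal (1 / 2) * ?\<mu> (cell q) \<and>
    (\<forall>x\<in>cell q - (\<Union>p\<in>ch. cell p). local_commutator m b f q x \<le> u x) \<and>
    (\<forall>p\<in>ch. \<forall>x\<in>cell p. local_commutator m b f q x \<le> u x + local_commutator m b f p x) \<and>
    u \<in> borel_measurable lebesgue \<and>
    (\<integral>\<^sup>+x. u x * ennreal (norm (g x)) \<partial>lebesgue) \<le> ennreal K * mixed_form m b f g q (?c q)"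
    unfolding K_def by (intro allI commutator_step[OF lam \<Lambda> b g bf])
  then obtain ch u where
    step: "\<And>q. (\<forall>p\<in>ch q. fst q < fst p \<and> cell p \<subseteq> cell q) \<and> disjoint_family_on cell (ch q) \<and>
    ?\<mu> (\<Union>p\<in>ch q. cell p) \<le> ennreal (1 / 2) * ?\<mu> (cell q) \<and>
    (\<forall>x\<in>cell q - (\<Union>p\<in>ch q. cell p). local_commutator m b f q x \<le> u q x) \<and>
    (\<forall>p\<in>ch q. \<forall>x\<in>cell p. local_commutator m b f q x \<le> u q x + local_commutator m b f p x) \<and>
    u q \<in> borel_measurable lebesgue \<and>
    (\<integral>\<^sup>+x. u q x * ennreal (norm (g x)) \<partial>lebesgue) \<le> ennreal K * mixed_form m b f g q (?c q)"
    unfolding choice_iff by blast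
  have u[measurable]: "u q \<in> borel_measurable lebesgue" for q using step[of q] by (elim conjE)
  have tree: "fst q < fst p \<and> cell p \<subseteq> cell q" if "p \<in> ch q" for p q using step[of q] that by blast
  have tree_disj: "disjoint_family_on cell (ch q)" for q using step[of q] by (elim conjE)
  have tree_half: "?\<mu> (\<Union>p\<in>ch q. cell p) \<le> ennreal (1 / 2) * ?\<mu> (cell q)" for q using step[of q] by (elim conjE)
  have stop: "local_commutator m b f q x \<le> u q x" if "x \<in> cell q" "x \<notin> (\<Union>p\<in>ch q. cell p)" for q x
    using step[of q] that by blast
  have pass: "local_commutator m b f q x \<le> u q x + local_commutator m b f p x" if "p \<in> ch q" "x \<in> cell p" for q p x
    using step[of q] that by blast
  have "\<exists>S E. disjoint_family_on E S \<and>
    (\<forall>q\<in>S. E q \<in> sets lebesgue \<and> E q \<subseteq> cell q \<and> ennreal (1 / 2) * ?\<mu> (cell q) \<le> ?\<mu> (E q)) \<and>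
    (AE x in lebesgue. x \<in> cell q0 \<longrightarrow> local_commutator m b f q0 x \<le> (\<integral>\<^sup>+q. u q x * indicator (cell q) x \<partial>count_space S))"
  proof (rule sparse_tree[of ch "local_commutator m b f" u q0, OF tree tree_disj tree_half stop pass])
    fix S E
    assume "disjoint_family_on E S"
      "\<And>q. q \<in> S \<Longrightarrow> E q \<in> sets lebesgue \<and> E q \<subseteq> cell q \<and> ennreal (1 / 2) * ?\<mu> (cell q) \<le> ?\<mu> (E q)"
      "AE x in lebesgue. x \<in> cell q0 \<longrightarrow> local_commutator m b f q0 x \<le> (\<integral>\<^sup>+q. u q x * indicator (cell q) x \<partial>count_space S)"
    then show ?thesis by (intro exI[of _ S] exI[of _ E]) blast
  qed
  then obtain S E where E: "disjoint_family_on E S"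
    "\<And>q. q \<in> S \<Longrightarrow> E q \<in> sets lebesgue \<and> E q \<subseteq> cell q \<and> ennreal (1 / 2) * ?\<mu> (cell q) \<le> ?\<mu> (E q)"
    and AE: "AE x in lebesgue. x \<in> cell q0 \<longrightarrow> local_commutator m b f q0 x \<le> (\<integral>\<^sup>+q. u q x * indicator (cell q) x \<partial>count_space S)"
    by blast
  have cnt: "countable S" by (rule countable_subset[OF subset_UNIV]) simp
  have inj: "inj_on (dil 3) S" by (rule inj_onI) (rule dil_inj[of 3], auto)
  define A where "A Q = Lp_mean r Q (\<lambda>x. norm (b x - mean b Q) ^ m * norm (f x))
    * Lp_mean s' Q (\<lambda>x. norm (g x)) * ?\<mu> Q" for Q
  define B where "B Q = Lp_mean r Q (\<lambda>x. norm (f x))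
    * Lp_mean s' Q (\<lambda>x. norm (b x - mean b Q) ^ m * norm (g x)) * ?\<mu> Q" for Q
  let ?\<S> = "dil 3 ` S"
  have sparse: "sparse_cubes (1 / (2 * 3 ^ CARD('n))) ?\<S>"
    unfolding sparse_cubes_def
  \<comment> \<open>The disjoint sets of the tree are transported along the bijection from cells to
    dilates. Each fills at least half of its cell, which has 3^-n of the measure of the
    dilate.\<close>
  proof (intro conjI ballI exI[of _ "\<lambda>Q. E (the_inv_into S (dil 3) Q)"])
    show "is_cube Q" if "Q \<in> ?\<S>" for Q using that is_cube_dil[of 3] by auto
    have inv: "the_inv_into S (dil 3) (dil 3 q) = q" if "q \<in> S" for q
      using the_inv_into_f_f[OF inj that] .
    show "disjoint_family_on (\<lambda>Q. E (the_inv_into S (dil 3) Q)) ?\<S>"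
      unfolding disjoint_family_on_def
    proof (intro ballI impI)
      fix Q Q' assume "Q \<in> ?\<S>" "Q' \<in> ?\<S>" "Q \<noteq> Q'"
      then obtain q q' where "q \<in> S" "q' \<in> S" "Q = dil 3 q" "Q' = dil 3 q'" "q \<noteq> q'" by blast
      then show "E (the_inv_into S (dil 3) Q) \<inter> E (the_inv_into S (dil 3) Q') = {}"
        using disjoint_family_onD[OF E(1), of q q'] by (simp add: inv)
    qed
    fix Q assume "Q \<in> ?\<S>"
    then obtain q where q: "q \<in> S" "Q = dil 3 q" by blast
    have Eq: "E q \<in> sets lebesgue" "E q \<subseteq> cell q" "ennreal (1 / 2) * ?\<mu> (cell q) \<le> ?\<mu> (E q)"
      using E(2)[OF q(1)] by auto
    have "ennreal (1 / (2 * 3 ^ CARD('n))) * ?\<mu> Q = ennreal (1 / (2 * 3 ^ CARD('n)) * 3 ^ CARD('n)) * ?\<mu> (cell q)"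
      by (subst ennreal_mult) (simp_all add: q emeasure_dil_cell mult.assoc)
    also have "1 / (2 * 3 ^ CARD('n)) * 3 ^ CARD('n) = (1 / 2 :: real)" by simp
    finally have "ennreal (1 / (2 * 3 ^ CARD('n))) * ?\<mu> Q \<le> ?\<mu> (E q)" using Eq(3) by (simp only:)
    then show "ennreal (1 / (2 * 3 ^ CARD('n))) * ?\<mu> Q \<le> ?\<mu> (E (the_inv_into S (dil 3) Q))"
      by (simp add: q inv)
    show "E (the_inv_into S (dil 3) Q) \<in> sets lebesgue" using q Eq by (simp add: inv)
    show "E (the_inv_into S (dil 3) Q) \<subseteq> Q" using q Eq cell_subset_dil[of 3 q] by (simp add: inv)
  qed
  have "(\<integral>\<^sup>+x\<in>cell q0. local_commutator m b f q0 x * ennreal (norm (g x)) \<partial>lebesgue)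
    \<le> (\<integral>\<^sup>+x. \<integral>\<^sup>+q. u q x * indicator (cell q) x * ennreal (norm (g x)) \<partial>count_space S \<partial>lebesgue)"
    using AE
  proof (intro nn_integral_mono_AE, elim eventually_mono)
    fix x assume *: "x \<in> cell q0 \<longrightarrow> local_commutator m b f q0 x \<le> (\<integral>\<^sup>+q. u q x * indicator (cell q) x \<partial>count_space S)"
    have "local_commutator m b f q0 x * ennreal (norm (g x)) * indicator (cell q0) x
      \<le> (\<integral>\<^sup>+q. u q x * indicator (cell q) x \<partial>count_space S) * ennreal (norm (g x))"
      using * by (cases "x \<in> cell q0") (auto intro: mult_right_mono)
    also have "\<dots> = (\<integral>\<^sup>+q. u q x * indicator (cell q) x * ennreal (norm (g x)) \<partial>count_space S)"
      by (rule nn_integral_multc[symmetric]) simp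
    finally show "local_commutator m b f q0 x * ennreal (norm (g x)) * indicator (cell q0) x
      \<le> (\<integral>\<^sup>+q. u q x * indicator (cell q) x * ennreal (norm (g x)) \<partial>count_space S)" .
  qed
  also have "\<dots> = (\<integral>\<^sup>+q. \<integral>\<^sup>+x. u q x * indicator (cell q) x * ennreal (norm (g x)) \<partial>lebesgue \<partial>count_space S)"
    by (intro nn_integral_count_space_nn_integral cnt) simp
  also have "\<dots> \<le> (\<integral>\<^sup>+q. ennreal (16 * 2 ^ m * K) * (A (dil 3 q) + B (dil 3 q)) \<partial>count_space S)"
  proof (rule nn_integral_mono)
    fix q
    have "(\<integral>\<^sup>+x. u q x * indicator (cell q) x * ennreal (norm (g x)) \<partial>lebesgue)
      \<le> (\<integral>\<^sup>+x. u q x * ennreal (norm (g x)) \<partial>lebesgue)"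
      by (intro nn_integral_mono) (auto simp: indicator_def)
    also have "\<dots> \<le> ennreal K * mixed_form m b f g q (?c q)" using step[of q] by (elim conjE)
    also have "\<dots> \<le> ennreal K * (ennreal (16 * 2 ^ m) * (A (dil 3 q) + B (dil 3 q)))"
      unfolding A_def B_def by (intro mult_left_mono mixed_form_le b f g) simp
    also have "\<dots> = ennreal (16 * 2 ^ m * K) * (A (dil 3 q) + B (dil 3 q))"
      using K0 by (subst mult.assoc[symmetric], subst ennreal_mult[symmetric]) (simp_all add: mult.commute)
    finally show "(\<integral>\<^sup>+x. u q x * indicator (cell q) x * ennreal (norm (g x)) \<partial>lebesgue)
      \<le> ennreal (16 * 2 ^ m * K) * (A (dil 3 q) + B (dil 3 q))" .
  qed
  also have "\<dots> = ennreal (16 * 2 ^ m * K) * ((\<integral>\<^sup>+q. A (dil 3 q) \<partial>count_space S) + (\<integral>\<^sup>+q. B (dil 3 q) \<partial>count_space S))"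
    by (simp add: nn_integral_cmult nn_integral_add)
  also have "\<dots> \<le> ennreal (16 * 2 ^ m * K) * (infsum (\<lambda>q. A (dil 3 q)) S + infsum (\<lambda>q. B (dil 3 q)) S)"
    by (intro mult_left_mono add_mono nn_integral_count_space_le_infsum cnt) simp
  also have "infsum (\<lambda>q. A (dil 3 q)) S + infsum (\<lambda>q. B (dil 3 q)) S = sparse_form m r s ?\<S> b f g"
    unfolding sparse_form_def A_def B_def by (simp add: infsum_reindex[OF inj] o_def)
  also have "16 * 2 ^ m * K = 16 * 2 ^ m * 4 ^ (CARD('n) + 2) * \<Lambda> * (\<phi>T lam + \<phi>M lam)"
    by (simp add: K_def)
  finally have "(\<integral>\<^sup>+x\<in>cell q0. local_commutator m b f q0 x * ennreal (norm (g x)) \<partial>lebesgue)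
      \<le> ennreal (16 * 2 ^ m * 4 ^ (CARD('n) + 2) * \<Lambda> * (\<phi>T lam + \<phi>M lam)) * sparse_form m r s ?\<S> b f g" .
  then show thesis by (rule that[OF sparse])
qed

end

section \<open>Integrability of f times powers of b\<close>

lemma in_L1_loc_measurable:
  fixes b :: "real ^ 'n \<Rightarrow> 'k::{real_normed_field, banach, second_countable_topology}"
  assumes "in_L1_loc b" shows "b \<in> borel_measurable lebesgue"
proof (rule borel_measurable_LIMSEQ_metric)
  show "(\<lambda>x. indicator (cball 0 (real n)) x *\<^sub>R b x) \<in> borel_measurable lebesgue" for n
    using assms unfolding in_L1_loc_def set_integrable_def
    by (intro borel_measurable_integrable) (use compact_cball in blast)
  fix x :: "real ^ 'n"
  obtain n0 :: nat where n0: "norm x \<le> real n0" using real_arch_simple by blast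
  have "\<forall>\<^sub>F n in sequentially. indicator (cball 0 (real n)) x *\<^sub>R b x = b x"
    using eventually_ge_at_top[of n0]
  proof (rule eventually_mono)
    fix n assume "n0 \<le> n"
    then have "norm x \<le> real n" using n0 by linarith
    then show "indicator (cball 0 (real n)) x *\<^sub>R b x = b x" by simp
  qed
  then show "(\<lambda>n. indicator (cball 0 (real n)) x *\<^sub>R b x) \<longlonglongrightarrow> b x"
    by (rule tendsto_eventually)
qed

lemma in_Linf_c_Lp_c:
  fixes f :: "real ^ 'n \<Rightarrow> 'k::real_normed_field"
  assumes f: "in_Linf_c f" and p: "0 < p"
  shows "f \<in> Lp_c p"
proof -
  obtain M where M: "\<And>x. norm (f x) \<le> M"
    using f by (auto simp: in_Linf_c_def bounded_iff)
  obtain R where R: "\<And>x. f x \<noteq> 0 \<Longrightarrow> norm x \<le> R"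
    using f by (auto simp: in_Linf_c_def bounded_iff)
  have "(\<integral>\<^sup>+x. ennreal (norm (f x) powr p) \<partial>lebesgue) \<le> (\<integral>\<^sup>+x. ennreal (M powr p) * indicator (cball (0 :: real ^ 'n) R) x \<partial>lebesgue)"
  proof (rule nn_integral_mono)
    fix x
    show "ennreal (norm (f x) powr p) \<le> ennreal (M powr p) * indicator (cball 0 R) x"
      using M[of x] R[of x] p by (cases "f x = 0") (auto intro!: ennreal_leI powr_mono2)
  qed
  also have "\<dots> = ennreal (M powr p) * emeasure lebesgue (cball (0 :: real ^ 'n) R)"
    by (intro nn_integral_cmult_indicator) simp
  also have "\<dots> < top"
    using emeasure_bounded_finite[of "cball (0 :: real ^ 'n) R"]
    by (simp add: ennreal_mult_less_top emeasure_completion)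
  finally show ?thesis using f by (simp add: Lp_c_iff in_Linf_c_def)
qed

text \<open>Since |b|^k <= 1 + |b|^m, the function is dominated by |f| + |b^m f|.\<close>

lemma Lp_c_lower_power:
  fixes b f :: "real ^ 'n \<Rightarrow> 'k::{real_normed_field, second_countable_topology}"
  assumes f: "f \<in> Lp_c p" and bf: "(\<lambda>y. b y ^ m * f y) \<in> Lp_c p"
    and b[measurable]: "b \<in> borel_measurable lebesgue" and p: "0 < p" and k: "k \<le> m"
  shows "(\<lambda>y. b y ^ k * f y) \<in> Lp_c p"
proof -
  have [measurable]: "f \<in> borel_measurable lebesgue" using f by (simp add: Lp_c_iff)
  \<comment> \<open>Norms are embedded by \<open>of_real\<close>, because
    \<open>Lp_c_dominated\<close> compares functions with values in the same field.\<close>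
  define F1 F2 :: "real ^ 'n \<Rightarrow> 'k" where "F1 y = of_real (norm (f y))" and "F2 y = of_real (norm (b y ^ m * f y))" for y
  have "F1 \<in> Lp_c p" using p by (intro Lp_c_dominated[OF f]) (auto simp: F1_def[abs_def])
  moreover have "F2 \<in> Lp_c p" using p by (intro Lp_c_dominated[OF bf]) (auto simp: F2_def[abs_def])
  ultimately have "(\<lambda>y. F1 y + F2 y) \<in> Lp_c p" using p by (intro Lp_c_add)
  then show ?thesis
  proof (rule Lp_c_dominated)
    fix y
    have "norm (b y) ^ k \<le> 1 + norm (b y) ^ m"
      using power_interpolation[of "norm (b y)" 1 k m] k by simp
    then have "norm (b y) ^ k * norm (f y) \<le> (1 + norm (b y) ^ m) * norm (f y)"
      by (rule mult_right_mono) simp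
    also have "\<dots> = norm (F1 y + F2 y)"
      unfolding F1_def F2_def of_real_add[symmetric] norm_of_real by (simp add: norm_mult norm_power distrib_right)
    finally show "norm (b y ^ k * f y) \<le> norm (F1 y + F2 y)" by (simp add: norm_mult norm_power)
  qed (use p in auto)
qed

text \<open>Shifting back: -c - (b - c) = -b, and the m-th power of -b has the norm of b^m.\<close>

lemma Lp_c_unshift:
  fixes b f :: "real ^ 'n \<Rightarrow> 'k::{real_normed_field, second_countable_topology}"
  assumes f: "f \<in> Lp_c p" and bf: "(\<lambda>y. (b y - c) ^ m * f y) \<in> Lp_c p"
    and b[measurable]: "b \<in> borel_measurable lebesgue" and p: "0 < p"
  shows "(\<lambda>y. b y ^ m * f y) \<in> Lp_c p"
proof -
  have [measurable]: "f \<in> borel_measurable lebesgue" using f by (simp add: Lp_c_iff)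
  have "(\<lambda>y. (- c - (b y - c)) ^ m * f y) \<in> Lp_c p"
    using p by (intro Lp_c_shifted_power[where m = m] Lp_c_lower_power[OF f bf]) auto
  then show ?thesis
    by (rule Lp_c_dominated) (use p in \<open>auto simp: norm_mult norm_power\<close>)
qed

theorem theorem3p2:
  fixes m :: nat
  shows "\<exists>C lam :: real. C > 1 \<and> 0 < lam \<and> lam < 1 \<and>
    (\<forall>(r :: real) (s :: ereal)
      (T :: (real ^ 'n \<Rightarrow> 'k::{real_normed_field, banach, second_countable_topology})
              \<Rightarrow> real ^ 'n \<Rightarrow> 'k)
      (\<phi>T :: real \<Rightarrow> real) (\<phi>M :: real \<Rightarrow> real).
      1 \<le> r \<longrightarrow> ereal r < s \<longrightarrow>
      sublinear_operator r T \<longrightarrow>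
      locally_weak_bounded r \<phi>T (\<lambda>f x. ennreal (norm (T f x))) \<longrightarrow>
      locally_weak_bounded r \<phi>M (sharp_grand_maximal T s) \<longrightarrow>
      (\<forall>(f :: real ^ 'n \<Rightarrow> 'k) (g :: real ^ 'n \<Rightarrow> 'k) (b :: real ^ 'n \<Rightarrow> 'k).
        in_Linf_c f \<longrightarrow> in_Linf_c g \<longrightarrow> in_L1_loc b \<longrightarrow>
        (\<exists>\<S>. sparse_cubes (1 / (2 * 3 ^ CARD('n))) \<S> \<and>
          bounded_by
            (\<integral>\<^sup>+x. ennreal (norm (commutator T b m f x) * norm (g x)) \<partial>lebesgue)
            (C * (\<phi>T lam + \<phi>M lam))
            (sparse_form m r s \<S> b f g))))"
proof -
  define lam :: real where "lam = 1 / ((real m + 1) * 3 ^ CARD('n) * 2 ^ (CARD('n) + 6))"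
  define \<Lambda> :: real where "\<Lambda> = (real m + 1) * 15 ^ CARD('n) * 2 ^ (CARD('n) + 5)"
  \<comment> \<open>16 comes from the interpolation of means, 2^m from the binomial coefficients,
    the rest from the stopping estimate.\<close>
  define C :: real where "C = 16 * 2 ^ m * 4 ^ (CARD('n) + 2) * \<Lambda>"
  note bounds = stopping_constants[OF lam_def \<Lambda>_def]
  have "1 < C"
  proof -
    have "1 * 1 * 1 \<le> 2 ^ m * 4 ^ (CARD('n) + 2) * \<Lambda>"
      using bounds(4) by (intro mult_mono one_le_power) auto
    then show ?thesis by (simp add: C_def)
  qed
  moreover have "\<exists>\<S>. sparse_cubes (1 / (2 * 3 ^ CARD('n))) \<S> \<and>
      bounded_by (\<integral>\<^sup>+x. ennreal (norm (commutator T b m f x) * norm (g x)) \<partial>lebesgue)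
        (C * (\<phi>T lam + \<phi>M lam)) (sparse_form m r s \<S> b f g)"
    if r: "1 \<le> r" and rs: "ereal r < s" and T: "sublinear_operator r T"
      and wT: "locally_weak_bounded r \<phi>T (\<lambda>f x. ennreal (norm (T f x)))"
      and wM: "locally_weak_bounded r \<phi>M (sharp_grand_maximal T s)"
      and f: "in_Linf_c f" and g: "in_Linf_c g" and b: "in_L1_loc b"
    for r s and T :: "(real ^ 'n \<Rightarrow> 'k) \<Rightarrow> real ^ 'n \<Rightarrow> 'k" and \<phi>T \<phi>M :: "real \<Rightarrow> real" and f g b :: "real ^ 'n \<Rightarrow> 'k"
  proof -
    have r0: "0 < r" using r by simp
    have b_meas[measurable]: "b \<in> borel_measurable lebesgue" by (rule in_L1_loc_measurable[OF b])
    have [measurable]: "f \<in> borel_measurable lebesgue" and g_meas[measurable]: "g \<in> borel_measurable lebesgue"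
      using f g by (auto simp: in_Linf_c_def)
    have f_Lp: "f \<in> Lp_c r" by (rule in_Linf_c_Lp_c[OF f r0])
    obtain R where R: "0 < R" "\<And>x. f x \<noteq> 0 \<or> g x \<noteq> 0 \<Longrightarrow> norm x < R"
    proof -
      have "bounded ({x. f x \<noteq> 0} \<union> {x. g x \<noteq> 0})" using f g by (simp add: in_Linf_c_def)
      then obtain R where "0 < R" "\<forall>x\<in>{x. f x \<noteq> 0} \<union> {x. g x \<noteq> 0}. norm x < R"
        unfolding bounded_pos_less by blast
      then show thesis by (intro that[of R]) auto
    qed
    \<comment> \<open>With this offset and side the cell labelled (0, 0) is the half-open cube [-R,
      R)^n. It contains the open ball of radius R, which is why R strictly exceeds the
      norms.\<close>
    interpret sparse_setup "\<chi> i. - R" "2 * R" r s T \<phi>T \<phi>M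
      by unfold_locales (use R r rs T wT wM in auto)
    define q0 :: "nat \<times> (int ^ 'n)" where "q0 = (0, 0)"
    have ball: "x \<in> cell q0" if "norm x < R" for x
      using component_le_norm_cart[of x] that
      by (auto simp: mem_cell_iff q0_def side_def abs_le_iff) (smt (verit))+
    have supp: "x \<in> cell q0" if "f x \<noteq> 0 \<or> g x \<noteq> 0" for x using ball R(2) that by blast
    show ?thesis
    \<comment> \<open>This case is split off because an infinite mean of f times a zero mean of g is
      0, so the form would not be infinite where it has to be below.\<close>
    proof (cases "AE x in lebesgue. g x = 0")
      case True
      have "(\<integral>\<^sup>+x. ennreal (norm (commutator T b m f x) * norm (g x)) \<partial>lebesgue) = (\<integral>\<^sup>+x. 0 \<partial>(lebesgue :: (real ^ 'n) measure))"
        using True by (intro nn_integral_cong_AE) (auto elim!: eventually_mono)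
      then have "bounded_by (\<integral>\<^sup>+x. ennreal (norm (commutator T b m f x) * norm (g x)) \<partial>lebesgue)
        (C * (\<phi>T lam + \<phi>M lam)) (sparse_form m r s {} b f g)"
        by (simp add: bounded_by_def)
      moreover have "sparse_cubes (1 / (2 * 3 ^ CARD('n))) ({} :: (real ^ 'n) set set)"
        by (simp add: sparse_cubes_def disjoint_family_on_def)
      ultimately show ?thesis by blast
    next
      case g0: False
      show ?thesis
      proof (cases "(\<lambda>y. b y ^ m * f y) \<in> Lp_c r")
        case True
        have bf: "(\<lambda>y. b y ^ k * f y) \<in> Lp_c r" if "k \<le> m" for k
          by (rule Lp_c_lower_power[OF f_Lp True b_meas r0 that])
        obtain \<S> where S: "sparse_cubes (1 / (2 * 3 ^ CARD('n))) \<S>"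
          "(\<integral>\<^sup>+x\<in>cell q0. local_commutator m b f q0 x * ennreal (norm (g x)) \<partial>lebesgue)
            \<le> ennreal (16 * 2 ^ m * 4 ^ (CARD('n) + 2) * \<Lambda> * (\<phi>T lam + \<phi>M lam)) * sparse_form m r s \<S> b f g"
          by (rule sparse_domination[OF lam_def \<Lambda>_def b_meas g_meas bf])
        \<comment> \<open>Cutting off to \<open>dil 3 q0\<close> changes nothing because f is
          supported in \<open>cell q0\<close>.\<close>
        have loc: "ennreal (norm (commutator T b m f x)) = local_commutator m b f q0 x" for x
        proof -
          have "indicator (dil 3 q0) y *\<^sub>R ((b x - b y) ^ m * f y) = (b x - b y) ^ m * f y" for y
            using supp[of y] cell_subset_dil[of 3 q0] by (cases "f y = 0") auto
          then show ?thesis by (simp add: commutator_def local_commutator_def)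
        qed
        have "(\<integral>\<^sup>+x. ennreal (norm (commutator T b m f x) * norm (g x)) \<partial>lebesgue)
          = (\<integral>\<^sup>+x\<in>cell q0. local_commutator m b f q0 x * ennreal (norm (g x)) \<partial>lebesgue)"
        proof (intro nn_integral_cong)
          fix x
          show "ennreal (norm (commutator T b m f x) * norm (g x))
            = local_commutator m b f q0 x * ennreal (norm (g x)) * indicator (cell q0) x"
            using supp[of x] by (cases "g x = 0") (auto simp: ennreal_mult loc)
        qed
        with S show ?thesis unfolding bounded_by_def C_def by auto
      next
        case False
        \<comment> \<open>One closed cube around both supports gives an infinite form. Its weighted
          mean of f is infinite, since subtracting a constant from b cannot bring b^m f into L^r,
          and its mean of g is nonzero. By \<open>bounded_by\<close> the claim is then void.\<close>
        define Q where "Q = dil 1 q0"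
        have Q: "Q \<in> sets lebesgue" "0 < emeasure lebesgue Q" "emeasure lebesgue Q < top" "is_cube Q"
          and cell_Q: "cell q0 \<subseteq> Q"
          using dil_pos_finite[of 1 q0] cell_subset_dil[of 1 q0] is_cube_dil[of 1 q0] by (auto simp: Q_def)
        have "Lp_mean r Q (\<lambda>x. norm (b x - mean b Q) ^ m * norm (f x)) = top"
        proof (rule ccontr)
          assume "Lp_mean r Q (\<lambda>x. norm (b x - mean b Q) ^ m * norm (f x)) \<noteq> top"
          then have "(\<integral>\<^sup>+x\<in>Q. ennreal ((norm (b x - mean b Q) ^ m * norm (f x)) powr r) \<partial>lebesgue) < top"
            using Lp_mean_finite_iff[of Q r] Q by (simp add: less_top)
          also have "(\<integral>\<^sup>+x\<in>Q. ennreal ((norm (b x - mean b Q) ^ m * norm (f x)) powr r) \<partial>lebesgue)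
            = (\<integral>\<^sup>+x. ennreal (norm ((b x - mean b Q) ^ m * f x) powr r) \<partial>lebesgue)"
          proof (intro nn_integral_cong)
            fix x
            show "ennreal ((norm (b x - mean b Q) ^ m * norm (f x)) powr r) * indicator Q x
              = ennreal (norm ((b x - mean b Q) ^ m * f x) powr r)"
              using supp[of x] cell_Q by (cases "f x = 0") (auto simp: norm_mult norm_power)
          qed
          finally have fin: "(\<integral>\<^sup>+x. ennreal (norm ((b x - mean b Q) ^ m * f x) powr r) \<partial>lebesgue) < top" .
          have "bounded {x. f x \<noteq> 0}" using f by (simp add: in_Linf_c_def)
          then have "bounded {x. (b x - mean b Q) ^ m * f x \<noteq> 0}" by (rule bounded_subset) auto
          with fin have "(\<lambda>y. (b y - mean b Q) ^ m * f y) \<in> Lp_c r" by (simp add: Lp_c_iff)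
          then have "(\<lambda>y. b y ^ m * f y) \<in> Lp_c r" by (rule Lp_c_unshift[OF f_Lp _ b_meas r0])
          then show False using False by simp
        qed
        moreover have "Lp_mean (conj_exponent s) Q (\<lambda>x. norm (g x)) \<noteq> 0"
        proof
          assume "Lp_mean (conj_exponent s) Q (\<lambda>x. norm (g x)) = 0"
          then have "AE x in lebesgue. x \<in> Q \<longrightarrow> norm (g x) = 0"
            using Q by (subst (asm) Lp_mean_eq_0_iff) auto
          then have "AE x in lebesgue. g x = 0"
            by (rule eventually_mono) (use supp cell_Q in auto)
          then show False using g0 by simp
        qed
        ultimately have "sparse_form m r s {Q} b f g = top"
          using Q by (simp add: sparse_form_def ennreal_mult_top ennreal_top_mult)
        then have "bounded_by (\<integral>\<^sup>+x. ennreal (norm (commutator T b m f x) * norm (g x)) \<partial>lebesgue)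
          (C * (\<phi>T lam + \<phi>M lam)) (sparse_form m r s {Q} b f g)"
          by (simp add: bounded_by_def)
        moreover have "sparse_cubes (1 / (2 * 3 ^ CARD('n))) {Q}"
        proof -
          have "1 \<le> 2 * (3 :: real) ^ CARD('n)" using one_le_power[of "3 :: real" "CARD('n)"] by linarith
          then have "ennreal (1 / (2 * 3 ^ CARD('n))) * emeasure lebesgue Q \<le> 1 * emeasure lebesgue Q"
            by (intro mult_right_mono) auto
          then show ?thesis
            using Q by (auto simp: sparse_cubes_def disjoint_family_on_def intro!: exI[of _ "\<lambda>Q. Q"])
        qed
        ultimately show ?thesis by blast
      qed
    qed
  qed
  ultimately show ?thesis using bounds(1,2) by (intro exI[of _ C] exI[of _ lam]) blast
qed

end
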